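(* Let $\Gamma\subset\mathbb{R}^2$ be a two-dimensional convex lattice polygon with lattice $\Lambda=\mathbb{Z}^2$, and let $X\subset\mathbb{P}^r$ be the toric surface defined by $\Gamma$. Let $V$ be the set of primitive viewangles in $\Lambda^*\setminus\{0\}$, where $h$ and $-h$ are identified, let $T$ be the set of toric families on $X$, where families differing only by a reparametrization of the base are identified, and let $\theta_\Gamma:V\to T$ be the viewangles and toric families relation. Then $\theta_\Gamma$ is a bijection, and a viewangle of width $n$ for $\Gamma$ is sent to a toric family of degree $n$ with respect to the embedding $X\subset\mathbb{P}^r$.
   Context: $\Lambda^*=\mathrm{Hom}_{\mathbb{Z}}(\Lambda,\mathbb{Z})$. The width of a viewangle $h$ for $\Gamma$ is $\max_{v\in\Gamma}h(v)-\min_{w\in\Gamma}h(w)$; $h=(m,n)$ acts by $h(a,b)=am+bn$, and is primitive if $\gcd(m,n)=1$. Toric surface of $\Gamma$: if $(a_0,b_0),\dots,(a_r,b_r)$ are the lattice points of $\Gamma$, then $X$ is the Zariski closure in $\mathbb{P}^r$ of the image of $p:(\mathbb{C}^* )^2\to\mathbb{P}^r$, $(s,t)\mapsto(s^{a_0}t^{b_0}:\dots:s^{a_r}t^{b_r})$. Its normal fan $\Sigma$ lives in the lattice $\Lambda^*$, so $\Lambda^*$ is the lattice of one-parameter subgroups of the dense torus. A family $F=(F_i)_{i\in I}$ on a complex projective surface $X$ is given by a nonsingular curve $I$ and an irreducible codimension $1$ algebraic subset $U\subset I\times X$ whose projection to $X$ is dominant, such that, for generic $i\in I$, the fibre $F_i\subset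 X$ of $U$ over $i$ is an irreducible curve. The degree of $F$ is $\deg F_i$ (as a curve in $\mathbb{P}^r$) for generic $i$. $F$ is a fibration family if there is a rational map $f:X\dashrightarrow I$ such that $F_i$ is the closure of $f^{-1}(i)$ for all $i \in I$. $F$ is a toric family if it is a fibration family and, after resolution of base points, the fibration map is a toric morphism (with respect to the given torus of $X$; then $I=\mathbb{P}^1$ and the map induces a toric morphism between the dense tori of $X$ and $I$). The relation $\theta_\Gamma$: for a primitive $h\in\Lambda^*$, the canonical linear map $\Lambda^*\to\Lambda^*/\mathbb{Z}h$ induces a morphism of tori from the dense torus $(\mathbb{C}^* )^2$ of $X$ (one-parameter-subgroup lattice $\Lambda^*$) to the dense torus $\mathbb{C}^*$ of $\mathbb{P}^1$ (one-parameter-subgroup lattice $\Lambda^*/\mathbb{Z}h$), hence a rational map $f:X\dashrightarrow\mathbb{P}^1$; $\theta_\Gamma(h)$ is the family of (closures of) fibres of $f$. In coordinates, for $h=(m,n)$, the map of tori is $(s,t)\mapsto s^{-n}t^{m}$. *)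

theory Defs
  imports "HOL-Analysis.Analysis" "HOL-Library.Poly_Mapping"
begin

section \<open>Polynomials\<close>

type_synonym 'k mpoly = "('k \<Rightarrow>\<^sub>0 nat) \<Rightarrow>\<^sub>0 complex"

definition mpoly_eval :: "'k mpoly \<Rightarrow> ('k \<Rightarrow> complex) \<Rightarrow> complex" where
  "mpoly_eval F v =
     (\<Sum>m\<in>Poly_Mapping.keys F.
        Poly_Mapping.lookup F m * (\<Prod>j\<in>Poly_Mapping.keys m. v j ^ Poly_Mapping.lookup m j))"

definition homogeneous :: "nat \<Rightarrow> 'k mpoly \<Rightarrow> bool" where
  "homogeneous d F \<longleftrightarrow>
     (\<forall>m\<in>Poly_Mapping.keys F. (\<Sum>j\<in>Poly_Mapping.keys m. Poly_Mapping.lookup m j) = d)"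

text \<open>Variables tagged \<open>Inl\<close> and \<open>Inr\<close> are the coordinates of the first and of the second factor
  of a product of two projective spaces.\<close>

definition bihomogeneous :: "nat \<Rightarrow> nat \<Rightarrow> ('j + 'k) mpoly \<Rightarrow> bool" where
  "bihomogeneous d e F \<longleftrightarrow>
     (\<forall>m\<in>Poly_Mapping.keys F.
        (\<Sum>j\<in>Inl -` Poly_Mapping.keys m. Poly_Mapping.lookup m (Inl j)) = d \<and>
        (\<Sum>k\<in>Inr -` Poly_Mapping.keys m. Poly_Mapping.lookup m (Inr k)) = e)"

section \<open>Projective spaces and their Zariski topologies\<close>

text \<open>The homogeneous coordinates of the projective space \<open>pspace J\<close> are indexed by the finite
  set \<open>J\<close>, so its dimension is \<open>card J - 1\<close>. Coordinate vectors vanish outside \<open>J\<close>, and a point is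
  the set of all nonzero multiples of a nonzero coordinate vector.\<close>

definition coords :: "'k set \<Rightarrow> ('k \<Rightarrow> complex) set" where
  "coords J = {v. v \<noteq> (\<lambda>_. 0) \<and> (\<forall>j. j \<notin> J \<longrightarrow> v j = 0)}"

type_synonym 'k point = "('k \<Rightarrow> complex) set"

definition pt :: "('k \<Rightarrow> complex) \<Rightarrow> 'k point" where
  "pt v = {(\<lambda>j. c * v j) | c. c \<noteq> 0}"

definition pspace :: "'k set \<Rightarrow> 'k point set" where
  "pspace J = pt ` coords J"

text \<open>The sets where a single form does not vanish are closed under binary intersections, so the
  closed sets of the topology generated by them are exactly the common zero loci of forms. The
  constant form 1 makes the carrier the whole space.\<close>

definition zariski :: "'k set \<Rightarrow> 'k point topology" where
  "zariski J = topology_generated_by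
     {{pt v | v. v \<in> coords J \<and> mpoly_eval F v \<noteq> 0} | F. \<exists>d. homogeneous d F}"

definition zariski_prod :: "'j set \<Rightarrow> 'k set \<Rightarrow> ('j point \<times> 'k point) topology" where
  "zariski_prod J K = topology_generated_by
     {{(pt v, pt w) | v w. v \<in> coords J \<and> w \<in> coords K \<and> mpoly_eval F (case_sum v w) \<noteq> 0}
       | F. \<exists>d e. bihomogeneous d e F}"

definition irreducible_in :: "'a topology \<Rightarrow> 'a set \<Rightarrow> bool" where
  "irreducible_in T Z \<longleftrightarrow>
     Z \<subseteq> topspace T \<and> Z \<noteq> {} \<and>
     (\<forall>A B. closedin T A \<longrightarrow> closedin T B \<longrightarrow> Z \<subseteq> A \<union> B \<longrightarrow> Z \<subseteq> A \<or> Z \<subseteq> B)"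

definition irreducible_chain :: "'a topology \<Rightarrow> nat \<Rightarrow> (nat \<Rightarrow> 'a set) \<Rightarrow> bool" where
  "irreducible_chain T n Z \<longleftrightarrow>
     (\<forall>k\<le>n. closedin T (Z k) \<and> irreducible_in T (Z k)) \<and> (\<forall>k<n. Z k \<subset> Z (Suc k))"

definition has_dimension :: "'a topology \<Rightarrow> nat \<Rightarrow> bool" where
  "has_dimension T n \<longleftrightarrow>
     (\<exists>Z. irreducible_chain T n Z) \<and> \<not> (\<exists>Z. irreducible_chain T (Suc n) Z)"

definition has_codimension :: "'a topology \<Rightarrow> 'a set \<Rightarrow> nat \<Rightarrow> bool" where
  "has_codimension T U n \<longleftrightarrow>
     (\<exists>Z. irreducible_chain T n Z \<and> Z 0 = U) \<and> \<not> (\<exists>Z. irreducible_chain T (Suc n) Z \<and> Z 0 = U)"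

text \<open>Only used on irreducible spaces, where nonempty open sets are dense.\<close>

definition generically :: "'a topology \<Rightarrow> ('a \<Rightarrow> bool) \<Rightarrow> bool" where
  "generically T P \<longleftrightarrow> (\<exists>W. openin T W \<and> W \<noteq> {} \<and> (\<forall>x\<in>W. P x))"

section \<open>Curves\<close>

definition irreducible_curve :: "'k set \<Rightarrow> 'k point set \<Rightarrow> bool" where
  "irreducible_curve J C \<longleftrightarrow>
     closedin (zariski J) C \<and> irreducible_in (zariski J) C \<and>
     has_dimension (subtopology (zariski J) C) 1"

text \<open>The Zariski tangent space, at \<open>v\<close>, of the affine cone over the closure of \<open>C\<close>; it contains
  the line through \<open>v\<close>, and its dimension is one more than that of the tangent space of \<open>C\<close>
  at \<open>pt v\<close>.\<close>

definition cone_tangent_space ::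
    "'k set \<Rightarrow> 'k point set \<Rightarrow> ('k \<Rightarrow> complex) \<Rightarrow> ('k \<Rightarrow> complex) set" where
  "cone_tangent_space J C v =
     {w. (\<forall>j. j \<notin> J \<longrightarrow> w j = 0) \<and>
         (\<forall>d F. homogeneous d F \<longrightarrow> (\<forall>u\<in>coords J. pt u \<in> C \<longrightarrow> mpoly_eval F u = 0) \<longrightarrow>
            deriv (\<lambda>z. mpoly_eval F (\<lambda>j. v j + z * w j)) 0 = 0)}"

text \<open>Every nonsingular irreducible curve is quasi-projective. The cone tangent space of a curve has
  dimension at least two everywhere; nonsingularity means that it is exactly two.\<close>

definition nonsingular_curve :: "'k set \<Rightarrow> 'k point set \<Rightarrow> bool" where
  "nonsingular_curve J C \<longleftrightarrow>
     finite J \<and>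
     (\<exists>A B. closedin (zariski J) A \<and> openin (zariski J) B \<and> C = A \<inter> B) \<and>
     irreducible_in (zariski J) C \<and>
     has_dimension (subtopology (zariski J) C) 1 \<and>
     (\<forall>v\<in>coords J. pt v \<in> C \<longrightarrow>
        (\<exists>w. cone_tangent_space J C v = {(\<lambda>j. a * v j + b * w j) | a b. True}))"

definition hyperplane :: "'k set \<Rightarrow> 'k point \<Rightarrow> 'k point set" where
  "hyperplane J \<xi> = {x \<in> pspace J. \<forall>u\<in>\<xi>. \<forall>v\<in>x. (\<Sum>j\<in>J. u j * v j) = 0}"

text \<open>Hyperplanes are parametrized by the dual projective space, which has the same index set.\<close>

definition curve_degree :: "'k set \<Rightarrow> 'k point set \<Rightarrow> nat \<Rightarrow> bool" where
  "curve_degree J C n \<longleftrightarrow>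
     generically (zariski J) (\<lambda>\<xi>. finite (C \<inter> hyperplane J \<xi>) \<and> card (C \<inter> hyperplane J \<xi>) = n)"

section \<open>Regular and rational maps\<close>

definition regular_map_on ::
    "'j set \<Rightarrow> 'j point set \<Rightarrow> 'k set \<Rightarrow> 'k point set \<Rightarrow> ('j point \<Rightarrow> 'k point) \<Rightarrow> bool" where
  "regular_map_on J D K Y f \<longleftrightarrow>
     f ` D \<subseteq> Y \<and>
     (\<forall>x\<in>D. \<exists>W d F. openin (subtopology (zariski J) D) W \<and> x \<in> W \<and> (\<forall>k. homogeneous d (F k)) \<and>
        (\<forall>v\<in>coords J. pt v \<in> W \<longrightarrow>
           (\<lambda>k. if k \<in> K then mpoly_eval (F k) v else 0) \<in> coords K \<and>
           f (pt v) = pt (\<lambda>k. if k \<in> K then mpoly_eval (F k) v else 0)))"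

definition curve_isomorphism ::
    "'j set \<Rightarrow> 'j point set \<Rightarrow> 'k set \<Rightarrow> 'k point set \<Rightarrow> ('j point \<Rightarrow> 'k point) \<Rightarrow> bool" where
  "curve_isomorphism J C K D g \<longleftrightarrow>
     bij_betw g C D \<and> regular_map_on J C K D g \<and> regular_map_on K D J C (inv_into C g)"

text \<open>A rational map from an irreducible \<open>X\<close> to \<open>Y\<close> is represented by a regular map \<open>f\<close> on a
  nonempty open subset \<open>D\<close> of \<open>X\<close>; two representatives define the same rational map if they agree on
  the intersection of their domains. \<open>rational_fibre\<close> is the preimage of a point under the rational
  map, that is, the preimage in its full domain of definition, whichever representative is given.\<close>

definition rational_map ::
    "'j set \<Rightarrow> 'j point set \<Rightarrow> 'k set \<Rightarrow> 'k point set \<Rightarrow> 'j point set \<Rightarrow> ('j point \<Rightarrow> 'k point) \<Rightarrow> bool"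
  where
  "rational_map J X K Y D f \<longleftrightarrow>
     openin (subtopology (zariski J) X) D \<and> D \<noteq> {} \<and> regular_map_on J D K Y f"

definition rational_fibre ::
    "'j set \<Rightarrow> 'j point set \<Rightarrow> 'k set \<Rightarrow> 'k point set \<Rightarrow> 'j point set \<Rightarrow> ('j point \<Rightarrow> 'k point)
      \<Rightarrow> 'k point \<Rightarrow> 'j point set" where
  "rational_fibre J X K Y D f y =
     {x. \<exists>D' f'. rational_map J X K Y D' f' \<and> (\<forall>z\<in>D \<inter> D'. f' z = f z) \<and> x \<in> D' \<and> f' x = y}"

section \<open>Families of curves\<close>

text \<open>\<open>X\<close> is a surface in \<open>pspace S\<close>, the base \<open>I\<close> a curve in \<open>pspace J\<close>. A family is determined by
  its total space \<open>U\<close>.\<close>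

definition fibre :: "('j point \<times> 'k point) set \<Rightarrow> 'j point \<Rightarrow> 'k point set" where
  "fibre U i = {x. (i, x) \<in> U}"

definition is_family ::
    "'j set \<Rightarrow> 'j point set \<Rightarrow> 'k set \<Rightarrow> 'k point set \<Rightarrow> ('j point \<times> 'k point) set \<Rightarrow> bool" where
  "is_family J I S X U \<longleftrightarrow>
     nonsingular_curve J I \<and>
     closedin (subtopology (zariski_prod J S) (I \<times> X)) U \<and>
     irreducible_in (subtopology (zariski_prod J S) (I \<times> X)) U \<and>
     has_codimension (subtopology (zariski_prod J S) (I \<times> X)) U 1 \<and>
     (zariski S) closure_of (snd ` U) = X \<and>
     generically (subtopology (zariski J) I) (\<lambda>i. irreducible_curve S (fibre U i))"

definition family_degree ::
    "'j set \<Rightarrow> 'j point set \<Rightarrow> 'k set \<Rightarrow> ('j point \<times> 'k point) set \<Rightarrow> nat \<Rightarrow> bool" where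
  "family_degree J I S U n \<longleftrightarrow>
     generically (subtopology (zariski J) I) (\<lambda>i. curve_degree S (fibre U i) n)"

definition is_fibration_map ::
    "'j set \<Rightarrow> 'j point set \<Rightarrow> 'k set \<Rightarrow> 'k point set \<Rightarrow> ('j point \<times> 'k point) set
      \<Rightarrow> 'k point set \<Rightarrow> ('k point \<Rightarrow> 'j point) \<Rightarrow> bool" where
  "is_fibration_map J I S X U D f \<longleftrightarrow>
     rational_map S X J I D f \<and>
     (\<forall>i\<in>I. fibre U i = (zariski S) closure_of (rational_fibre S X J I D f i))"

definition fibration_family ::
    "'j set \<Rightarrow> 'j point set \<Rightarrow> 'k set \<Rightarrow> 'k point set \<Rightarrow> ('j point \<times> 'k point) set \<Rightarrow> bool" where
  "fibration_family J I S X U \<longleftrightarrow>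
     is_family J I S X U \<and> (\<exists>D f. is_fibration_map J I S X U D f)"

definition reparametrize ::
    "('j point \<Rightarrow> 'i point) \<Rightarrow> ('j point \<times> 'k point) set \<Rightarrow> ('i point \<times> 'k point) set" where
  "reparametrize g U = (\<lambda>(i, x). (g i, x)) ` U"

section \<open>The toric surface of a lattice polygon\<close>

definition lattice_polygon :: "(real \<times> real) set \<Rightarrow> bool" where
  "lattice_polygon \<Gamma> \<longleftrightarrow>
     (\<exists>A. finite A \<and> A \<subseteq> \<int> \<times> \<int> \<and> \<Gamma> = convex hull A) \<and> aff_dim \<Gamma> = 2"

definition lattice_points :: "(real \<times> real) set \<Rightarrow> (int \<times> int) set" where
  "lattice_points \<Gamma> = {(a, b). (real_of_int a, real_of_int b) \<in> \<Gamma>}"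

text \<open>The projective coordinates are indexed by the lattice points themselves.\<close>

definition torus_point :: "(real \<times> real) set \<Rightarrow> complex \<times> complex \<Rightarrow> (int \<times> int) point" where
  "torus_point \<Gamma> = (\<lambda>(s, t).
     pt (\<lambda>(a, b). if (a, b) \<in> lattice_points \<Gamma> then s powi a * t powi b else 0))"

definition torus2 :: "(complex \<times> complex) set" where
  "torus2 = (- {0}) \<times> (- {0})"

definition dense_torus :: "(real \<times> real) set \<Rightarrow> (int \<times> int) point set" where
  "dense_torus \<Gamma> = torus_point \<Gamma> ` torus2"

definition toric_surface :: "(real \<times> real) set \<Rightarrow> (int \<times> int) point set" where
  "toric_surface \<Gamma> = (zariski (lattice_points \<Gamma>)) closure_of (dense_torus \<Gamma>)"

text \<open>The projective line; \<open>P1_affine z\<close> is the point \<open>(1 : z)\<close>, and the dense torus consists of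
  these points for nonzero \<open>z\<close>.\<close>

definition P1 :: "bool point set" where
  "P1 = pspace UNIV"

definition P1_affine :: "complex \<Rightarrow> bool point" where
  "P1_affine z = pt (\<lambda>b. if b then z else 1)"

text \<open>A rational map that becomes a toric morphism after resolution of its base points: the torus of
  \<open>X\<close> contains no base points, and the map restricts there to a homomorphism into the torus of the
  projective line.\<close>

definition toric_rational_map ::
    "(real \<times> real) set \<Rightarrow> (int \<times> int) point set \<Rightarrow> ((int \<times> int) point \<Rightarrow> bool point) \<Rightarrow> bool" where
  "toric_rational_map \<Gamma> D f \<longleftrightarrow>
     rational_map (lattice_points \<Gamma>) (toric_surface \<Gamma>) UNIV P1 D f \<and>
     dense_torus \<Gamma> \<subseteq> D \<and>
     (\<exists>\<phi>. (\<forall>s t. (s, t) \<in> torus2 \<longrightarrow>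
              \<phi> (s, t) \<noteq> 0 \<and> f (torus_point \<Gamma> (s, t)) = P1_affine (\<phi> (s, t))) \<and>
          (\<forall>s t s' t'. (s, t) \<in> torus2 \<longrightarrow> (s', t') \<in> torus2 \<longrightarrow>
              \<phi> (s * s', t * t') = \<phi> (s, t) * \<phi> (s', t')))"

definition toric_family :: "(real \<times> real) set \<Rightarrow> (bool point \<times> (int \<times> int) point) set \<Rightarrow> bool" where
  "toric_family \<Gamma> U \<longleftrightarrow>
     fibration_family UNIV P1 (lattice_points \<Gamma>) (toric_surface \<Gamma>) U \<and>
     (\<exists>D f. is_fibration_map UNIV P1 (lattice_points \<Gamma>) (toric_surface \<Gamma>) U D f \<and>
            toric_rational_map \<Gamma> D f)"

definition toric_families_rel ::
    "(real \<times> real) set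
      \<Rightarrow> ((bool point \<times> (int \<times> int) point) set \<times> (bool point \<times> (int \<times> int) point) set) set" where
  "toric_families_rel \<Gamma> =
     {(U, U'). toric_family \<Gamma> U \<and> toric_family \<Gamma> U' \<and>
        (\<exists>g. curve_isomorphism UNIV P1 UNIV P1 g \<and> U' = reparametrize g U)}"

definition toric_families :: "(real \<times> real) set \<Rightarrow> (bool point \<times> (int \<times> int) point) set set set" where
  "toric_families \<Gamma> = {U. toric_family \<Gamma> U} // toric_families_rel \<Gamma>"

section \<open>Viewangles\<close>

text \<open>The dual lattice is the set of pairs \<open>(m, n)\<close> acting by \<open>(a, b) \<mapsto> a m + b n\<close>.\<close>

definition view :: "int \<times> int \<Rightarrow> real \<times> real \<Rightarrow> real" where
  "view h = (\<lambda>(a, b). a * real_of_int (fst h) + b * real_of_int (snd h))"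

text \<open>On a polygon, which is compact, supremum and infimum are the maximum and the minimum.\<close>

definition width :: "(real \<times> real) set \<Rightarrow> int \<times> int \<Rightarrow> real" where
  "width \<Gamma> h = (SUP v\<in>\<Gamma>. view h v) - (INF w\<in>\<Gamma>. view h w)"

definition primitive_viewangles :: "(int \<times> int) set" where
  "primitive_viewangles = {(m, n). (m, n) \<noteq> (0, 0) \<and> gcd m n = 1}"

definition sign_rel :: "((int \<times> int) \<times> (int \<times> int)) set" where
  "sign_rel = {(h, h'). h \<in> primitive_viewangles \<and> h' \<in> primitive_viewangles \<and>
     (h' = h \<or> h' = (- fst h, - snd h))}"

definition viewangles :: "(int \<times> int) set set" where
  "viewangles = primitive_viewangles // sign_rel"

text \<open>The map of tori obtained from the projection of the dual lattice along \<open>h = (m, n)\<close>.\<close>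

definition view_character :: "int \<times> int \<Rightarrow> complex \<times> complex \<Rightarrow> complex" where
  "view_character h = (\<lambda>(s, t). s powi (- snd h) * t powi fst h)"

definition view_map :: "(real \<times> real) set \<Rightarrow> int \<times> int \<Rightarrow> (int \<times> int) point \<Rightarrow> bool point" where
  "view_map \<Gamma> h x = P1_affine (view_character h (inv_into torus2 (torus_point \<Gamma>) x))"

definition view_family ::
    "(real \<times> real) set \<Rightarrow> int \<times> int \<Rightarrow> (bool point \<times> (int \<times> int) point) set" where
  "view_family \<Gamma> h =
     {(i, x). i \<in> P1 \<and>
        x \<in> (zariski (lattice_points \<Gamma>)) closure_of
              (rational_fibre (lattice_points \<Gamma>) (toric_surface \<Gamma>) UNIV P1
                 (dense_torus \<Gamma>) (view_map \<Gamma> h) i)}"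

text \<open>The map on sign classes induced by \<open>view_family\<close>; it is well defined if
  \<open>\<lambda>h. toric_families_rel \<Gamma> `` {view_family \<Gamma> h}\<close> respects \<open>sign_rel\<close>.\<close>

definition theta ::
    "(real \<times> real) set \<Rightarrow> (int \<times> int) set \<Rightarrow> (bool point \<times> (int \<times> int) point) set set" where
  "theta \<Gamma> c = (\<Union>h\<in>c. toric_families_rel \<Gamma> `` {view_family \<Gamma> h})"

end

theory Submission
  imports Defs "HOL-Complex_Analysis.Complex_Analysis" "Jordan_Normal_Form.Determinant"
    "HOL-Computational_Algebra.Fundamental_Theorem_Algebra"
begin

text \<open>For \<open>h = (m, n)\<close> let \<open>q = (- n, m)\<close>, so that the view family of \<open>h\<close> comes from the character
  \<open>\<chi> = s\<^sup>-\<^sup>n t\<^sup>m\<close> with exponent \<open>q\<close>. Its total space is cut out of \<open>P1 \<times> X\<close> by the binomials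
  \<open>u\<^sub>0\<^sup>k x\<^sup>l = u\<^sub>1\<^sup>k x\<^sup>l'\<close> for monomials \<open>x\<^sup>l / x\<^sup>l' = \<chi>\<^sup>k\<close>, and it is the closure of the graph of \<open>\<chi>\<close>: over
  \<open>z \<noteq> 0, \<infinity>\<close> these equations leave an orbit of the one-parameter subgroup \<open>h\<close> and its two end points,
  and over \<open>0\<close> and \<open>\<infinity>\<close> they leave closures of boundary orbits to which \<open>\<chi>\<close> extends, because a point
  satisfying them has its support on an edge whose inner normal is positive (negative) on \<open>q\<close>.
  Irreducibility follows from the parametrization by a torus, and codimension one from
  pseudo-division by the equation of the graph.

  Conversely, a toric family comes from a homomorphism of tori which is rational near \<open>1\<close>, hence a
  character, and its exponent is primitive because the generic fibre is irreducible. The character,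
  and with it \<open>\<plusminus>h\<close>, is recovered from the fibre through \<open>1\<close>.

  A hyperplane cuts the fibre over \<open>z\<close>, parametrized by \<open>\<lambda> \<mapsto> (c\<^sub>p \<lambda>\<^sup>h\<^sup>(\<^sup>p\<^sup>))\<^sub>p\<close>, in the roots of a polynomial whose
  degree is the width. For a general hyperplane the extreme coefficients and a Sylvester
  determinant do not vanish, so that the roots are simple and nonzero.\<close>

section \<open>Forms as functions\<close>

text \<open>The obstacle is in the special fibres. The definition prescribes every fibre of a
  fibration family as the closure of a full rational fibre, whereas the total space has to be
  irreducible, so over 0 and infinity two different closures must be shown to agree. Both lie in the
  set \<open>G q\<close> of solutions of the binomials, and \<open>G_fibre_minimal\<close> shows
  that a closed set contains a fibre of \<open>G q\<close> as soon as it contains the torus points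
  of the fibre and the relevant open edge orbits. This one statement is applied to both closures.
  That the character extends to these edge orbits rests on a lattice point at height one above each
  edge: it allows the character to be written as a quotient of two monomials only one of which
  vanishes on the edge. The surface itself enters only through its torus parametrization: pairs of
  lists of lattice points with equal length and sum give equations of \<open>X\<close>, and a
  unimodular triangle inside the polygon recovers torus points from them. Boundary points are
  reached along polynomial arcs, where a form that vanishes off 0 also vanishes at 0.\<close>

lemma mpoly_eval_superset:
  assumes "finite S" "Poly_Mapping.keys F \<subseteq> S"
  shows "mpoly_eval F v =
    (\<Sum>m\<in>S. Poly_Mapping.lookup F m * (\<Prod>j\<in>Poly_Mapping.keys m. v j ^ Poly_Mapping.lookup m j))"
  unfolding mpoly_eval_def
  by (rule sum.mono_neutral_left) (use assms in \<open>auto simp: in_keys_iff\<close>)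

lemma mpoly_eval_zero [simp]: "mpoly_eval 0 v = 0"
  by (simp add: mpoly_eval_def)

lemma mpoly_eval_add: "mpoly_eval (F + G) v = mpoly_eval F v + mpoly_eval G v"
proof -
  let ?S = "Poly_Mapping.keys F \<union> Poly_Mapping.keys G"
  have "Poly_Mapping.keys (F + G) \<subseteq> ?S"
    by (rule Poly_Mapping.keys_add)
  then show ?thesis
    by (simp add: mpoly_eval_superset[of ?S] lookup_add algebra_simps sum.distrib)
qed

lemma mpoly_eval_sum: "mpoly_eval (sum F S) v = (\<Sum>i\<in>S. mpoly_eval (F i) v)"
  by (induction S rule: infinite_finite_induct) (auto simp: mpoly_eval_add)

lemma mpoly_eval_single:
  "mpoly_eval (Poly_Mapping.single m c) v =
     c * (\<Prod>j\<in>Poly_Mapping.keys m. v j ^ Poly_Mapping.lookup m j)"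
  by (subst mpoly_eval_superset[of "{m}"]) auto

lemma monomial_prod_superset:
  fixes v :: "'k \<Rightarrow> complex"
  assumes "finite S" "Poly_Mapping.keys m \<subseteq> S"
  shows "(\<Prod>j\<in>Poly_Mapping.keys m. v j ^ Poly_Mapping.lookup m j) =
    (\<Prod>j\<in>S. v j ^ Poly_Mapping.lookup m j)"
  by (rule prod.mono_neutral_left) (use assms in \<open>auto simp: in_keys_iff\<close>)

lemma monomial_prod_add:
  fixes v :: "'k \<Rightarrow> complex"
  shows "(\<Prod>j\<in>Poly_Mapping.keys (m + n). v j ^ Poly_Mapping.lookup (m + n) j) =
    (\<Prod>j\<in>Poly_Mapping.keys m. v j ^ Poly_Mapping.lookup m j) *
    (\<Prod>j\<in>Poly_Mapping.keys n. v j ^ Poly_Mapping.lookup n j)"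
proof -
  let ?S = "Poly_Mapping.keys m \<union> Poly_Mapping.keys n"
  have "Poly_Mapping.keys (m + n) \<subseteq> ?S"
    by (rule Poly_Mapping.keys_add)
  then have "(\<Prod>j\<in>Poly_Mapping.keys (m + n). v j ^ Poly_Mapping.lookup (m + n) j) =
      (\<Prod>j\<in>?S. v j ^ Poly_Mapping.lookup (m + n) j)"
    by (intro monomial_prod_superset) auto
  then show ?thesis
    using monomial_prod_superset[of ?S m v] monomial_prod_superset[of ?S n v]
    by (simp add: lookup_add power_add prod.distrib)
qed

lemma mpoly_sum_monomials:
  "(\<Sum>m\<in>Poly_Mapping.keys F. Poly_Mapping.single m (Poly_Mapping.lookup F m)) = F"
  by (rule poly_mapping_eqI) (auto simp: lookup_sum lookup_single when_def sum.delta in_keys_iff)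

lemma mpoly_mult_sum:
  fixes F G :: "'k mpoly"
  shows "F * G = (\<Sum>m\<in>Poly_Mapping.keys F. \<Sum>n\<in>Poly_Mapping.keys G.
     Poly_Mapping.single (m + n) (Poly_Mapping.lookup F m * Poly_Mapping.lookup G n))"
proof -
  have "F * G = (\<Sum>m\<in>Poly_Mapping.keys F. Poly_Mapping.single m (Poly_Mapping.lookup F m)) *
     (\<Sum>n\<in>Poly_Mapping.keys G. Poly_Mapping.single n (Poly_Mapping.lookup G n))"
    by (simp only: mpoly_sum_monomials)
  also have "\<dots> = (\<Sum>m\<in>Poly_Mapping.keys F. \<Sum>n\<in>Poly_Mapping.keys G.
     Poly_Mapping.single (m + n) (Poly_Mapping.lookup F m * Poly_Mapping.lookup G n))"
    by (simp only: sum_product mult_single)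
  finally show ?thesis .
qed

lemma mpoly_eval_mult: "mpoly_eval (F * G) v = mpoly_eval F v * mpoly_eval G v"
  unfolding mpoly_mult_sum mpoly_eval_sum mpoly_eval_single monomial_prod_add
  by (simp add: mpoly_eval_def sum_product algebra_simps)

text \<open>Induction over polynomial expressions, with the coordinates replaced by functions of a
  parameter \<open>x\<close>. The instances of \<open>Q\<close> are polynomials in one variable,
  Laurent functions on a torus and holomorphic functions.\<close>

lemma mpoly_eval_closed:
  assumes const: "\<And>c. Q (\<lambda>_. c)"
    and add: "\<And>f g. Q f \<Longrightarrow> Q g \<Longrightarrow> Q (\<lambda>x. f x + g x)"
    and mult: "\<And>f g. Q f \<Longrightarrow> Q g \<Longrightarrow> Q (\<lambda>x. f x * g x)"
    and coord: "\<And>j. Q (\<lambda>x. V x j)"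
  shows "Q (\<lambda>x. mpoly_eval F (V x))"
proof -
  have power: "Q (\<lambda>x. V x j ^ n)" for j n
    by (induction n) (auto intro: const mult coord)
  have prod: "Q (\<lambda>x. \<Prod>j\<in>S. V x j ^ e j)" if "finite S" for S e
    using that by (induction S rule: finite_induct) (auto intro: const mult power)
  have "Q (\<lambda>x. \<Sum>m\<in>S. c m * (\<Prod>j\<in>Poly_Mapping.keys m. V x j ^ Poly_Mapping.lookup m j))"
    if "finite S" for S c
    using that by (induction S rule: finite_induct) (auto intro!: const add mult prod)
  then show ?thesis
    by (simp add: mpoly_eval_def)
qed

section \<open>Forms with two gradings\<close>

definition wdeg :: "('k \<Rightarrow> nat) \<Rightarrow> ('k \<Rightarrow>\<^sub>0 nat) \<Rightarrow> nat" where
  "wdeg w m = (\<Sum>j\<in>Poly_Mapping.keys m. Poly_Mapping.lookup m j * w j)"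

lemma wdeg_superset:
  assumes "finite S" "Poly_Mapping.keys m \<subseteq> S"
  shows "wdeg w m = (\<Sum>j\<in>S. Poly_Mapping.lookup m j * w j)"
  unfolding wdeg_def
  by (rule sum.mono_neutral_left) (use assms in \<open>auto simp: in_keys_iff\<close>)

lemma wdeg_add: "wdeg w (m + n) = wdeg w m + wdeg w n"
proof -
  let ?S = "Poly_Mapping.keys m \<union> Poly_Mapping.keys n"
  have "Poly_Mapping.keys (m + n) \<subseteq> ?S"
    by (rule Poly_Mapping.keys_add)
  then show ?thesis
    by (simp add: wdeg_superset[of ?S] lookup_add algebra_simps sum.distrib)
qed

lemma wdeg_zero [simp]: "wdeg w 0 = 0"
  by (simp add: wdeg_def)

lemma wdeg_single [simp]: "wdeg w (Poly_Mapping.single j n) = n * w j"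
  by (subst wdeg_superset[of "{j}"]) auto

text \<open>Two weights at once, so that forms and bihomogeneous forms are instances of one notion.\<close>

definition gform ::
    "('k \<Rightarrow> nat) \<Rightarrow> ('k \<Rightarrow> nat) \<Rightarrow> nat \<Rightarrow> nat \<Rightarrow> (('k \<Rightarrow> complex) \<Rightarrow> complex) \<Rightarrow> bool" where
  "gform w w' d e f \<longleftrightarrow>
     (\<exists>F. (\<forall>m\<in>Poly_Mapping.keys F. wdeg w m = d \<and> wdeg w' m = e) \<and> f = mpoly_eval F)"

abbreviation hform :: "nat \<Rightarrow> (('k \<Rightarrow> complex) \<Rightarrow> complex) \<Rightarrow> bool" where
  "hform d \<equiv> gform (\<lambda>_. Suc 0) (\<lambda>_. 0) d 0"

abbreviation biform :: "nat \<Rightarrow> nat \<Rightarrow> (('j + 'k \<Rightarrow> complex) \<Rightarrow> complex) \<Rightarrow> bool" where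
  "biform \<equiv> gform (case_sum (\<lambda>_. Suc 0) (\<lambda>_. 0)) (case_sum (\<lambda>_. 0) (\<lambda>_. Suc 0))"

lemma hform_iff: "hform d f \<longleftrightarrow> (\<exists>F. homogeneous d F \<and> f = mpoly_eval F)"
  by (simp add: gform_def homogeneous_def wdeg_def)

lemma biform_iff: "biform d e f \<longleftrightarrow> (\<exists>F. bihomogeneous d e F \<and> f = mpoly_eval F)"
proof -
  have 1: "(\<Sum>j\<in>Inl -` Poly_Mapping.keys m. Poly_Mapping.lookup m (Inl j)) =
      wdeg (case_sum (\<lambda>_. Suc 0) (\<lambda>_. 0)) m" for m :: "('j + 'k) \<Rightarrow>\<^sub>0 nat"
  proof -
    have "(\<Sum>j\<in>Inl -` Poly_Mapping.keys m. Poly_Mapping.lookup m (Inl j)) =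
       (\<Sum>x\<in>Inl ` (Inl -` Poly_Mapping.keys m). Poly_Mapping.lookup m x)"
      by (subst sum.reindex) auto
    also have "\<dots> = (\<Sum>x\<in>Poly_Mapping.keys m.
        Poly_Mapping.lookup m x * (case_sum (\<lambda>_. Suc 0) (\<lambda>_. 0)) x)"
      by (rule sum.mono_neutral_cong_left) (auto split: sum.splits)
    finally show ?thesis by (simp only: wdeg_def)
  qed
  have 2: "(\<Sum>j\<in>Inr -` Poly_Mapping.keys m. Poly_Mapping.lookup m (Inr j)) =
      wdeg (case_sum (\<lambda>_. 0) (\<lambda>_. Suc 0)) m" for m :: "('j + 'k) \<Rightarrow>\<^sub>0 nat"
  proof -
    have "(\<Sum>j\<in>Inr -` Poly_Mapping.keys m. Poly_Mapping.lookup m (Inr j)) =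
       (\<Sum>x\<in>Inr ` (Inr -` Poly_Mapping.keys m). Poly_Mapping.lookup m x)"
      by (subst sum.reindex) auto
    also have "\<dots> = (\<Sum>x\<in>Poly_Mapping.keys m.
        Poly_Mapping.lookup m x * (case_sum (\<lambda>_. 0) (\<lambda>_. Suc 0)) x)"
      by (rule sum.mono_neutral_cong_left) (auto split: sum.splits)
    finally show ?thesis by (simp only: wdeg_def)
  qed
  show ?thesis unfolding gform_def bihomogeneous_def 1 2 ..
qed

lemma gform_zero: "gform w w' d e (\<lambda>_. 0)"
  unfolding gform_def by (rule exI[of _ 0]) auto

lemma gform_const: "gform w w' 0 0 (\<lambda>_. c)"
  unfolding gform_def
  by (rule exI[of _ "Poly_Mapping.single 0 c"]) (auto simp: fun_eq_iff mpoly_eval_single)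

lemma gform_coord: "gform w w' (w j) (w' j) (\<lambda>v. v j)"
  unfolding gform_def
  by (rule exI[of _ "Poly_Mapping.single (Poly_Mapping.single j 1) 1"])
    (auto simp: fun_eq_iff mpoly_eval_single)

lemma gform_add:
  assumes "gform w w' d e f" "gform w w' d e g"
  shows "gform w w' d e (\<lambda>v. f v + g v)"
proof -
  from assms obtain F G where "\<forall>m\<in>Poly_Mapping.keys F. wdeg w m = d \<and> wdeg w' m = e"
    "f = mpoly_eval F" "\<forall>m\<in>Poly_Mapping.keys G. wdeg w m = d \<and> wdeg w' m = e" "g = mpoly_eval G"
    by (auto simp: gform_def)
  then show ?thesis
    unfolding gform_def using Poly_Mapping.keys_add[of F G]
    by (intro exI[of _ "F + G"]) (auto simp: fun_eq_iff mpoly_eval_add)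
qed

lemma gform_mult:
  assumes "gform w w' d e f" "gform w w' d' e' g" "D = d + d'" "E = e + e'"
  shows "gform w w' D E (\<lambda>v. f v * g v)"
proof -
  from assms obtain F G where "\<forall>m\<in>Poly_Mapping.keys F. wdeg w m = d \<and> wdeg w' m = e"
    "f = mpoly_eval F" "\<forall>m\<in>Poly_Mapping.keys G. wdeg w m = d' \<and> wdeg w' m = e'" "g = mpoly_eval G"
    by (auto simp: gform_def)
  then show ?thesis
    unfolding gform_def using Poly_Mapping.keys_mult[of F G] assms(3,4)
    by (intro exI[of _ "F * G"]) (fastforce simp: fun_eq_iff mpoly_eval_mult wdeg_add)
qed

lemma gform_cmult: "gform w w' d e f \<Longrightarrow> gform w w' d e (\<lambda>v. c * f v)"
  by (rule gform_mult[OF gform_const]) auto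

lemma gform_diff:
  assumes "gform w w' d e f" "gform w w' d e g"
  shows "gform w w' d e (\<lambda>v. f v - g v)"
  using gform_add[OF assms(1) gform_cmult[OF assms(2), of "-1"]] by simp

lemma gform_sum:
  assumes "\<And>i. i \<in> S \<Longrightarrow> gform w w' d e (f i)"
  shows "gform w w' d e (\<lambda>v. \<Sum>i\<in>S. f i v)"
  using assms by (induction S rule: infinite_finite_induct) (auto intro: gform_zero gform_add)

lemma gform_prod:
  assumes "finite S" "\<And>i. i \<in> S \<Longrightarrow> gform w w' (d i) (e i) (f i)"
    "D = sum d S" "E = sum e S"
  shows "gform w w' D E (\<lambda>v. \<Prod>i\<in>S. f i v)"
  unfolding assms(3,4) using assms(1,2)
  by (induction S rule: finite_induct) (auto intro!: gform_const gform_mult)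

lemma gform_if:
  "gform w w' d e f \<Longrightarrow> gform w w' d e g \<Longrightarrow> gform w w' d e (\<lambda>u. if b then f u else g u)"
  by (cases b) auto

lemma gform_power:
  assumes "gform w w' d e f" "D = n * d" "E = n * e"
  shows "gform w w' D E (\<lambda>v. f v ^ n)"
  unfolding assms(2,3) by (induction n) (auto intro!: gform_const gform_mult[OF assms(1)])

lemma hform_coord: "d = 1 \<Longrightarrow> hform d (\<lambda>v. v j)"
  using gform_coord[of "\<lambda>_. Suc 0" "\<lambda>_. 0" j] by simp

lemma biform_Inl: "d = 1 \<Longrightarrow> e = 0 \<Longrightarrow> biform d e (\<lambda>v. v (Inl j))"
  using gform_coord[of "case_sum (\<lambda>_. Suc 0) (\<lambda>_. 0)" "case_sum (\<lambda>_. 0) (\<lambda>_. Suc 0)" "Inl j"] by simp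

lemma biform_Inr: "d = 0 \<Longrightarrow> e = 1 \<Longrightarrow> biform d e (\<lambda>v. v (Inr j))"
  using gform_coord[of "case_sum (\<lambda>_. Suc 0) (\<lambda>_. 0)" "case_sum (\<lambda>_. 0) (\<lambda>_. Suc 0)" "Inr j"] by simp

lemma gform_prod_list:
  assumes "\<And>j. j \<in> set l \<Longrightarrow> gform w w' a b (f j)" "D = length l * a" "E = length l * b"
  shows "gform w w' D E (\<lambda>v. prod_list (map (\<lambda>j. f j v) l))"
  unfolding assms(2,3) using assms(1)
  by (induction l) (auto intro!: gform_const gform_mult)

lemma gform_eval:
  assumes "gform w w' d e f"
  obtains F where "f = mpoly_eval F"
  using assms by (auto simp: gform_def)

lemma gform_closed:
  assumes "gform w w' d e f"
    and "\<And>c. Q (\<lambda>_. c)"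
    and "\<And>f g. Q f \<Longrightarrow> Q g \<Longrightarrow> Q (\<lambda>x. f x + g x)"
    and "\<And>f g. Q f \<Longrightarrow> Q g \<Longrightarrow> Q (\<lambda>x. f x * g x)"
    and "\<And>j. Q (\<lambda>x. V x j)"
  shows "Q (\<lambda>x. f (V x))"
proof -
  obtain F where F: "f = mpoly_eval F" using assms(1) by (rule gform_eval)
  show ?thesis unfolding F by (rule mpoly_eval_closed) (use assms in auto)
qed

lemma gform_scale:
  assumes "gform w w' d e f"
  shows "f (\<lambda>j. a ^ w j * b ^ w' j * v j) = a ^ d * b ^ e * f v"
proof -
  obtain F where F: "\<forall>m\<in>Poly_Mapping.keys F. wdeg w m = d \<and> wdeg w' m = e" "f = mpoly_eval F"
    using assms by (auto simp: gform_def)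
  have "(\<Prod>j\<in>Poly_Mapping.keys m. (a ^ w j * b ^ w' j * v j) ^ Poly_Mapping.lookup m j) =
     a ^ wdeg w m * b ^ wdeg w' m * (\<Prod>j\<in>Poly_Mapping.keys m. v j ^ Poly_Mapping.lookup m j)" for m
    unfolding wdeg_def power_sum
    by (simp add: prod.distrib power_mult_distrib mult.commute flip: power_mult)
  then show ?thesis
    unfolding F(2) mpoly_eval_def sum_distrib_left
    by (intro sum.cong) (auto simp: F(1))
qed

lemma hform_scale: "hform d f \<Longrightarrow> f (\<lambda>j. a * v j) = a ^ d * f v"
  using gform_scale[of "\<lambda>_. 1" "\<lambda>_. 0" d 0 f a 1 v] by simp

lemma biform_scale:
  assumes "biform d e f"
  shows "f (case_sum (\<lambda>j. a * v j) (\<lambda>k. b * w k)) = a ^ d * b ^ e * f (case_sum v w)"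
proof -
  have "case_sum (\<lambda>j. a * v j) (\<lambda>k. b * w k) =
    (\<lambda>x. a ^ (case_sum (\<lambda>_. Suc 0) (\<lambda>_. 0)) x * b ^ (case_sum (\<lambda>_. 0) (\<lambda>_. Suc 0)) x * case_sum v w x)"
    by (auto simp: fun_eq_iff split: sum.splits)
  then show ?thesis using gform_scale[OF assms] by simp
qed

lemma gform_poly_curve:
  assumes "gform w w' d e f"
  obtains P where "\<And>z. f (\<lambda>j. poly (p j) z) = poly P z"
proof -
  have "\<exists>P. (\<lambda>z. f (\<lambda>j. poly (p j) z)) = poly P"
  proof (rule gform_closed[OF assms, where Q = "\<lambda>f. \<exists>P. f = poly P"], goal_cases)
    case (1 c) show ?case by (rule exI[of _ "[:c:]"]) auto
  next
    case (2 f g) then obtain P Q where "f = poly P" "g = poly Q" by auto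
    then show ?case by (intro exI[of _ "P + Q"]) auto
  next
    case (3 f g) then obtain P Q where "f = poly P" "g = poly Q" by auto
    then show ?case by (intro exI[of _ "P * Q"]) auto
  next
    case (4 j) show ?case by auto
  qed
  then show ?thesis using that by (auto simp: fun_eq_iff)
qed

text \<open>Pulled back to a polynomial curve, a form becomes a polynomial, here with infinitely
  many roots. This takes limits at 0 algebraically; boundary points of the surface and of the line
  are reached in this way.\<close>

lemma gform_vanish_at_0:
  assumes "gform w w' d e f" and "\<And>z. z \<noteq> 0 \<Longrightarrow> f (\<lambda>j. poly (p j) z) = 0"
  shows "f (\<lambda>j. poly (p j) 0) = 0"
proof -
  obtain P where P: "\<And>z. f (\<lambda>j. poly (p j) z) = poly P z"
    using gform_poly_curve[OF assms(1)] by blast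
  have "P = 0"
  proof (rule ccontr)
    assume "P \<noteq> 0"
    then have "finite {z. poly P z = 0}" by (rule poly_roots_finite)
    moreover have "- {0} \<subseteq> {z. poly P z = 0}" using assms(2) P by auto
    ultimately have "finite (- {0::complex})" by (rule finite_subset[rotated])
    then show False using infinite_UNIV_char_0[where 'a = complex] by (simp add: Compl_eq_Diff_UNIV)
  qed
  then show ?thesis using P by simp
qed

section \<open>Topologies given by nonvanishing sets\<close>

text \<open>Closure under intersections makes \<open>B\<close> a base, so the generated open sets
  are the unions of members of \<open>B\<close> and no finite intersections have to be carried
  along.\<close>

lemma openin_generated_basis:
  assumes B: "\<And>a b. a \<in> B \<Longrightarrow> b \<in> B \<Longrightarrow> a \<inter> b \<in> B"
  shows "openin (topology_generated_by B) U \<longleftrightarrow> (\<forall>x\<in>U. \<exists>b\<in>B. x \<in> b \<and> b \<subseteq> U)"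
proof
  assume "openin (topology_generated_by B) U"
  then have "generate_topology_on B U" by (simp add: openin_topology_generated_by_iff)
  then show "\<forall>x\<in>U. \<exists>b\<in>B. x \<in> b \<and> b \<subseteq> U"
  proof induction
    case (Int a b)
    show ?case
    proof
      fix x assume "x \<in> a \<inter> b"
      then obtain c d where "c \<in> B" "x \<in> c" "c \<subseteq> a" "d \<in> B" "x \<in> d" "d \<subseteq> b"
        using Int.IH by blast
      then show "\<exists>e\<in>B. x \<in> e \<and> e \<subseteq> a \<inter> b"
        using B by (intro bexI[of _ "c \<inter> d"]) auto
    qed
  next
    case (UN K) then show ?case by (meson UnionE Union_upper subset_trans)
  qed auto
next
  assume *: "\<forall>x\<in>U. \<exists>b\<in>B. x \<in> b \<and> b \<subseteq> U"
  have "openin (topology_generated_by B) b" if "b \<in> B" for b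
    using that by (rule topology_generated_by_Basis)
  then show "openin (topology_generated_by B) U"
    using * by (subst openin_subopen) blast
qed

text \<open>A closed set that contains \<open>S\<close> contains its closure, so a cover of
  \<open>Z\<close> by two closed sets can be tested on \<open>S\<close>.\<close>

lemma irreducible_in_between:
  assumes "irreducible_in T S" "S \<subseteq> Z" "Z \<subseteq> T closure_of S"
  shows "irreducible_in T Z"
  unfolding irreducible_in_def
proof (intro conjI allI impI)
  show "Z \<subseteq> topspace T" using assms(3) closure_of_subset_topspace by fastforce
  show "Z \<noteq> {}" using assms(1,2) by (auto simp: irreducible_in_def)
  fix A B assume AB: "closedin T A" "closedin T B" "Z \<subseteq> A \<union> B"
  then have "S \<subseteq> A \<or> S \<subseteq> B" using assms(1,2) unfolding irreducible_in_def by blast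
  then show "Z \<subseteq> A \<or> Z \<subseteq> B" using AB assms(3) closure_of_minimal[of S _ T] by blast
qed

lemma irreducible_in_closure_of:
  assumes "irreducible_in T Z"
  shows "irreducible_in T (T closure_of Z)"
  using assms by (intro irreducible_in_between[OF assms] closure_of_subset) (auto simp: irreducible_in_def)

lemma irreducible_in_subtopology:
  assumes "Z \<subseteq> S"
  shows "irreducible_in (subtopology T S) Z \<longleftrightarrow> irreducible_in T Z"
proof
  assume L: "irreducible_in (subtopology T S) Z"
  show "irreducible_in T Z"
    unfolding irreducible_in_def
  proof (intro conjI allI impI)
    show "Z \<subseteq> topspace T" "Z \<noteq> {}" using L by (auto simp: irreducible_in_def)
    fix A B assume "closedin T A" "closedin T B" "Z \<subseteq> A \<union> B"
    then have "closedin (subtopology T S) (A \<inter> S)" "closedin (subtopology T S) (B \<inter> S)"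
        "Z \<subseteq> A \<inter> S \<union> B \<inter> S"
      using assms by (auto simp: closedin_subtopology)
    then show "Z \<subseteq> A \<or> Z \<subseteq> B"
      using L unfolding irreducible_in_def by blast
  qed
next
  assume R: "irreducible_in T Z"
  show "irreducible_in (subtopology T S) Z"
    unfolding irreducible_in_def
  proof (intro conjI allI impI)
    show "Z \<subseteq> topspace (subtopology T S)" "Z \<noteq> {}" using R assms by (auto simp: irreducible_in_def)
    fix A B assume "closedin (subtopology T S) A" "closedin (subtopology T S) B" and Z: "Z \<subseteq> A \<union> B"
    then obtain A' B' where "closedin T A'" "A = A' \<inter> S" "closedin T B'" "B = B' \<inter> S"
      by (auto simp: closedin_subtopology)
    then show "Z \<subseteq> A \<or> Z \<subseteq> B"
      using R Z assms unfolding irreducible_in_def by blast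
  qed
qed

text \<open>Every subset of \<open>Z\<close> is closed, so \<open>Z\<close> is the union of the
  closed sets \<open>W\<close> and \<open>Z - W\<close>, and irreducibility makes one of them all of
  \<open>Z\<close>.\<close>

lemma finite_irreducible_subset:
  assumes "irreducible_in T Z" "finite Z" "\<And>x. x \<in> Z \<Longrightarrow> closedin T {x}" "W \<subset> Z"
  shows "W = {}"
proof (rule ccontr)
  have cl: "closedin T S" if "S \<subseteq> Z" for S
  proof -
    have "finite S" using that assms(2) finite_subset by blast
    then have "closedin T (\<Union>x\<in>S. {x})"
      using that assms(3) by (intro closedin_Union) auto
    then show ?thesis by simp
  qed
  assume "W \<noteq> {}"
  have "Z \<subseteq> W \<union> (Z - W)" by auto
  then have "Z \<subseteq> W \<or> Z \<subseteq> Z - W"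
    using assms(1,4) cl[of W] cl[of "Z - W"] unfolding irreducible_in_def by blast
  then show False using \<open>W \<noteq> {}\<close> assms(4) by blast
qed

text \<open>The middle member of a chain of length two would be a proper closed subset of
  \<open>C\<close>, hence finite and irreducible, and \<open>finite_irreducible_subset\<close>
  leaves nothing below it.\<close>

lemma has_dimension_1I:
  assumes C: "closedin T C" "irreducible_in T C" "infinite C"
    and pts: "\<And>x. x \<in> C \<Longrightarrow> closedin T {x}"
    and fin: "\<And>Z. closedin T Z \<Longrightarrow> Z \<subset> C \<Longrightarrow> finite Z"
  shows "has_dimension (subtopology T C) 1"
proof -
  obtain x where x: "x \<in> C" using C(3) by fastforce
  let ?S = "subtopology T C"
  have cl: "closedin ?S Z \<longleftrightarrow> closedin T Z \<and> Z \<subseteq> C" for Z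
    using C(1) closedin_closed_subtopology by blast
  define Z where "Z = (\<lambda>k::nat. if k = 0 then {x} else C)"
  have "irreducible_in T {x}"
    using x pts[OF x] closedin_subset[of T "{x}"] by (auto simp: irreducible_in_def)
  then have "irreducible_chain ?S 1 Z"
    using x C pts[OF x] by (auto simp: irreducible_chain_def Z_def cl irreducible_in_subtopology)
  moreover have "\<not> irreducible_chain ?S (Suc 1) Y" for Y
  proof
    assume ch: "irreducible_chain ?S (Suc 1) Y"
    then have Y: "Y 0 \<subset> Y 1" "Y 1 \<subset> Y 2" "closedin ?S (Y 2)" "closedin ?S (Y 1)"
      "irreducible_in ?S (Y 1)" "irreducible_in ?S (Y 0)"
      by (auto simp: irreducible_chain_def numeral_2_eq_2)
    then have "finite (Y 1)" "irreducible_in T (Y 1)" "Y 1 \<subseteq> C"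
      using fin[of "Y 1"] by (auto simp: cl irreducible_in_subtopology)
    then have "Y 0 = {}"
      using finite_irreducible_subset[of T "Y 1" "Y 0"] Y pts by blast
    then show False using Y by (simp add: irreducible_in_def)
  qed
  ultimately show ?thesis unfolding has_dimension_def by blast
qed

text \<open>The hypothesis \<open>max\<close> leaves no room for a second step in a chain that
  starts at \<open>U\<close>.\<close>

lemma has_codimension_1I:
  assumes "closedin T U" "irreducible_in T U" "irreducible_in T (topspace T)" "U \<noteq> topspace T"
    and max: "\<And>Z. closedin T Z \<Longrightarrow> irreducible_in T Z \<Longrightarrow> U \<subset> Z \<Longrightarrow> Z = topspace T"
  shows "has_codimension T U 1"
proof -
  define Z where "Z = (\<lambda>k::nat. if k = 0 then U else topspace T)"
  have "U \<subset> topspace T" using assms(1,4) closedin_subset by blast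
  then have "irreducible_chain T 1 Z"
    using assms by (auto simp: irreducible_chain_def Z_def)
  moreover have "\<not> (irreducible_chain T (Suc 1) Y \<and> Y 0 = U)" for Y
  proof
    assume ch: "irreducible_chain T (Suc 1) Y \<and> Y 0 = U"
    then have Y: "U \<subset> Y 1" "Y 1 \<subset> Y 2" "closedin T (Y 2)" "closedin T (Y 1)"
      "irreducible_in T (Y 1)"
      by (auto simp: irreducible_chain_def numeral_2_eq_2)
    then show False using max[of "Y 1"] closedin_subset[of T "Y 2"] by blast
  qed
  moreover have "Z 0 = U" by (simp add: Z_def)
  ultimately show ?thesis unfolding has_codimension_def by blast
qed

text \<open>Common ground of \<open>zariski\<close> and \<open>zariski_prod\<close>:
  \<open>\<pi>\<close> sends coordinate vectors to points, and \<open>Fm\<close> consists of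
  functions on vectors whose vanishing depends on the point alone. Closure of \<open>Fm\<close>
  under products makes the nonvanishing sets a base.\<close>

locale forms =
  fixes \<pi> :: "'v \<Rightarrow> 'a" and C :: "'v set" and Fm :: "('v \<Rightarrow> complex) set" and T :: "'a topology"
  assumes inv: "\<And>f v w. f \<in> Fm \<Longrightarrow> v \<in> C \<Longrightarrow> w \<in> C \<Longrightarrow> \<pi> v = \<pi> w \<Longrightarrow> f v = 0 \<longleftrightarrow> f w = 0"
    and mult: "\<And>f g. f \<in> Fm \<Longrightarrow> g \<in> Fm \<Longrightarrow> (\<lambda>v. f v * g v) \<in> Fm"
    and one: "(\<lambda>_. 1) \<in> Fm"
    and T_eq: "T = topology_generated_by {{\<pi> v | v. v \<in> C \<and> f v \<noteq> 0} | f. f \<in> Fm}"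
begin

definition nz :: "('v \<Rightarrow> complex) \<Rightarrow> 'a set" where
  "nz f = {\<pi> v | v. v \<in> C \<and> f v \<noteq> 0}"

lemma mem_nz: "f \<in> Fm \<Longrightarrow> v \<in> C \<Longrightarrow> \<pi> v \<in> nz f \<longleftrightarrow> f v \<noteq> 0"
  unfolding nz_def using inv by blast

lemma nz_subset: "nz f \<subseteq> \<pi> ` C"
  by (auto simp: nz_def)

lemma openin_iff:
  "openin T U \<longleftrightarrow> U \<subseteq> \<pi> ` C \<and>
     (\<forall>v\<in>C. \<pi> v \<in> U \<longrightarrow> (\<exists>f\<in>Fm. f v \<noteq> 0 \<and> (\<forall>u\<in>C. f u \<noteq> 0 \<longrightarrow> \<pi> u \<in> U)))"
proof -
  have int: "a \<inter> b \<in> nz ` Fm" if ab: "a \<in> nz ` Fm" "b \<in> nz ` Fm" for a b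
  proof -
    obtain f g where fg: "f \<in> Fm" "g \<in> Fm" "a = nz f" "b = nz g" using ab by auto
    have "x \<in> nz f \<inter> nz g \<longleftrightarrow> x \<in> nz (\<lambda>v. f v * g v)" for x
    proof (cases "x \<in> \<pi> ` C")
      case True
      then obtain v where "v \<in> C" "x = \<pi> v" by auto
      then show ?thesis using fg(1,2) by (simp add: mem_nz mult)
    next
      case False then show ?thesis using nz_subset by blast
    qed
    then have "a \<inter> b = nz (\<lambda>v. f v * g v)" unfolding fg(3,4) by blast
    then show ?thesis using mult[OF fg(1,2)] by simp
  qed
  have "T = topology_generated_by (nz ` Fm)"
    unfolding T_eq nz_def by (simp add: setcompr_eq_image)
  then have "openin T U \<longleftrightarrow> (\<forall>x\<in>U. \<exists>b\<in>nz ` Fm. x \<in> b \<and> b \<subseteq> U)"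
    using openin_generated_basis[of "nz ` Fm" U] int by simp
  also have "\<dots> \<longleftrightarrow> U \<subseteq> \<pi> ` C \<and> (\<forall>v\<in>C. \<pi> v \<in> U \<longrightarrow> (\<exists>f\<in>Fm. \<pi> v \<in> nz f \<and> nz f \<subseteq> U))"
    using nz_subset by (auto simp: image_iff subset_iff)
  also have "\<dots> \<longleftrightarrow> U \<subseteq> \<pi> ` C \<and>
     (\<forall>v\<in>C. \<pi> v \<in> U \<longrightarrow> (\<exists>f\<in>Fm. f v \<noteq> 0 \<and> (\<forall>u\<in>C. f u \<noteq> 0 \<longrightarrow> \<pi> u \<in> U)))"
  proof -
    have "(\<exists>f\<in>Fm. \<pi> v \<in> nz f \<and> nz f \<subseteq> U) \<longleftrightarrow>
       (\<exists>f\<in>Fm. f v \<noteq> 0 \<and> (\<forall>u\<in>C. f u \<noteq> 0 \<longrightarrow> \<pi> u \<in> U))" if "v \<in> C" for v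
    proof (intro bex_cong refl)
      fix f assume f: "f \<in> Fm"
      have "nz f \<subseteq> U \<longleftrightarrow> (\<forall>u\<in>C. f u \<noteq> 0 \<longrightarrow> \<pi> u \<in> U)" by (auto simp: nz_def)
      then show "\<pi> v \<in> nz f \<and> nz f \<subseteq> U \<longleftrightarrow> f v \<noteq> 0 \<and> (\<forall>u\<in>C. f u \<noteq> 0 \<longrightarrow> \<pi> u \<in> U)"
        using mem_nz[OF f that] by simp
    qed
    then show ?thesis by (intro conj_cong refl ball_cong imp_cong)
  qed
  finally show ?thesis .
qed

lemma topspace_T: "topspace T = \<pi> ` C"
proof
  show "topspace T \<subseteq> \<pi> ` C" using openin_iff openin_topspace by blast
  have "openin T (\<pi> ` C)" unfolding openin_iff using one by (auto intro!: bexI[of _ "\<lambda>_. 1"])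
  then show "\<pi> ` C \<subseteq> topspace T" by (rule openin_subset)
qed

lemma openin_nz:
  assumes "f \<in> Fm"
  shows "openin T (nz f)"
  unfolding openin_iff
proof (intro conjI ballI impI)
  fix v assume "v \<in> C" "\<pi> v \<in> nz f"
  then show "\<exists>f'\<in>Fm. f' v \<noteq> 0 \<and> (\<forall>u\<in>C. f' u \<noteq> 0 \<longrightarrow> \<pi> u \<in> nz f)"
    using assms by (intro bexI[of _ f]) (simp_all add: mem_nz)
qed (rule nz_subset)

lemma closedin_zeros:
  assumes "f \<in> Fm"
  shows "closedin T {\<pi> v | v. v \<in> C \<and> f v = 0}"
proof -
  have "x \<in> {\<pi> v | v. v \<in> C \<and> f v = 0} \<longleftrightarrow> x \<in> \<pi> ` C - nz f" for x
  proof (cases "x \<in> \<pi> ` C")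
    case True
    then obtain v where v: "v \<in> C" "x = \<pi> v" by auto
    have "(\<exists>w. \<pi> v = \<pi> w \<and> w \<in> C \<and> f w = 0) \<longleftrightarrow> f v = 0"
      using v(1) inv[OF assms, of v] by metis
    then show ?thesis using v mem_nz[OF assms v(1)] by simp
  next
    case False then show ?thesis by blast
  qed
  then have "{\<pi> v | v. v \<in> C \<and> f v = 0} = topspace T - nz f" unfolding topspace_T by blast
  then show ?thesis using openin_nz[OF assms] by (simp add: closedin_diff)
qed

lemma closure_of_iff:
  assumes v: "v \<in> C"
  shows "\<pi> v \<in> T closure_of S \<longleftrightarrow> (\<forall>f\<in>Fm. (\<forall>u\<in>C. \<pi> u \<in> S \<longrightarrow> f u = 0) \<longrightarrow> f v = 0)"
proof
  assume L: "\<pi> v \<in> T closure_of S"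
  show "\<forall>f\<in>Fm. (\<forall>u\<in>C. \<pi> u \<in> S \<longrightarrow> f u = 0) \<longrightarrow> f v = 0"
  proof (intro ballI impI, rule ccontr)
    fix f assume f: "f \<in> Fm" "\<forall>u\<in>C. \<pi> u \<in> S \<longrightarrow> f u = 0" "f v \<noteq> 0"
    then have "openin T (nz f)" "\<pi> v \<in> nz f"
      using openin_nz v by (auto simp: mem_nz)
    then obtain y where y: "y \<in> S" "y \<in> nz f"
      using L unfolding in_closure_of by blast
    then obtain u where "u \<in> C" "y = \<pi> u" using nz_subset by blast
    then show False using f y by (simp add: mem_nz)
  qed
next
  assume R: "\<forall>f\<in>Fm. (\<forall>u\<in>C. \<pi> u \<in> S \<longrightarrow> f u = 0) \<longrightarrow> f v = 0"
  show "\<pi> v \<in> T closure_of S"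
    unfolding in_closure_of topspace_T
  proof (intro conjI allI impI)
    show "\<pi> v \<in> \<pi> ` C" using v by blast
    fix W assume W: "\<pi> v \<in> W \<and> openin T W"
    then obtain f where "f \<in> Fm" "f v \<noteq> 0" "\<forall>u\<in>C. f u \<noteq> 0 \<longrightarrow> \<pi> u \<in> W"
      using v unfolding openin_iff by blast
    then show "\<exists>y. y \<in> S \<and> y \<in> W" using R by blast
  qed
qed

lemma closedin_separate:
  assumes "closedin T Z" "v \<in> C" "\<pi> v \<notin> Z"
  obtains f where "f \<in> Fm" "f v \<noteq> 0" "\<And>u. u \<in> C \<Longrightarrow> \<pi> u \<in> Z \<Longrightarrow> f u = 0"
  using closure_of_iff[OF assms(2), of Z] closure_of_closedin[OF assms(1)] assms(3) by auto

text \<open>Together with \<open>irreducible_in_prod\<close> this is the dictionary between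
  irreducible sets and prime ideals: points outside the closed sets \<open>A\<close> and
  \<open>B\<close> are separated from them by forms \<open>f\<close> and \<open>g\<close>, and a
  point where neither form vanishes lies in neither set.\<close>

lemma irreducible_inI:
  assumes "Z \<subseteq> \<pi> ` C" "Z \<noteq> {}"
    and "\<And>f g. f \<in> Fm \<Longrightarrow> g \<in> Fm \<Longrightarrow> \<exists>v\<in>C. \<pi> v \<in> Z \<and> f v \<noteq> 0 \<Longrightarrow> \<exists>v\<in>C. \<pi> v \<in> Z \<and> g v \<noteq> 0 \<Longrightarrow>
       \<exists>v\<in>C. \<pi> v \<in> Z \<and> f v \<noteq> 0 \<and> g v \<noteq> 0"
  shows "irreducible_in T Z"
  unfolding irreducible_in_def topspace_T
proof (intro conjI allI impI assms(1,2), rule ccontr)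
  fix A B assume cl: "closedin T A" "closedin T B" and Z: "Z \<subseteq> A \<union> B" "\<not> (Z \<subseteq> A \<or> Z \<subseteq> B)"
  then obtain a b where ab: "a \<in> C" "\<pi> a \<in> Z" "\<pi> a \<notin> A" "b \<in> C" "\<pi> b \<in> Z" "\<pi> b \<notin> B"
    using assms(1) by blast
  obtain f where f: "f \<in> Fm" "f a \<noteq> 0" "\<And>u. u \<in> C \<Longrightarrow> \<pi> u \<in> A \<Longrightarrow> f u = 0"
    using closedin_separate[OF cl(1) ab(1,3)] by blast
  obtain g where g: "g \<in> Fm" "g b \<noteq> 0" "\<And>u. u \<in> C \<Longrightarrow> \<pi> u \<in> B \<Longrightarrow> g u = 0"
    using closedin_separate[OF cl(2) ab(4,6)] by blast
  obtain v where "v \<in> C" "\<pi> v \<in> Z" "f v \<noteq> 0" "g v \<noteq> 0"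
    using assms(3)[OF f(1) g(1)] ab f g by blast
  then show False using Z(1) f(3) g(3) by blast
qed

lemma irreducible_in_prod:
  assumes "irreducible_in T Z" "f \<in> Fm" "g \<in> Fm" "\<And>v. v \<in> C \<Longrightarrow> \<pi> v \<in> Z \<Longrightarrow> f v * g v = 0"
  shows "(\<forall>v\<in>C. \<pi> v \<in> Z \<longrightarrow> f v = 0) \<or> (\<forall>v\<in>C. \<pi> v \<in> Z \<longrightarrow> g v = 0)"
proof -
  let ?z = "\<lambda>f. topspace T - nz f"
  have Z: "Z \<subseteq> \<pi> ` C" using assms(1) unfolding irreducible_in_def topspace_T by blast
  have "Z \<subseteq> ?z f \<union> ?z g"
  proof
    fix x assume x: "x \<in> Z"
    then obtain v where "v \<in> C" "x = \<pi> v" using Z by blast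
    then show "x \<in> ?z f \<union> ?z g"
      using assms(4)[of v] x mem_nz[OF assms(2)] mem_nz[OF assms(3)]
      by (auto simp: topspace_T)
  qed
  moreover have "closedin T (?z f)" "closedin T (?z g)"
    using openin_nz assms by (auto intro: closedin_diff)
  ultimately have "Z \<subseteq> ?z f \<or> Z \<subseteq> ?z g"
    using assms(1) unfolding irreducible_in_def by blast
  then show ?thesis
    using mem_nz[OF assms(2)] mem_nz[OF assms(3)] by blast
qed

end

section \<open>Points and closed sets of projective spaces\<close>

lemma self_in_pt: "v \<in> pt v"
  unfolding pt_def by (rule CollectI, rule exI[of _ 1]) auto

lemma pt_eq_iff: "pt v = pt w \<longleftrightarrow> (\<exists>c. c \<noteq> 0 \<and> w = (\<lambda>j. c * v j))"
proof
  assume "pt v = pt w"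
  then show "\<exists>c. c \<noteq> 0 \<and> w = (\<lambda>j. c * v j)"
    using self_in_pt[of w] by (auto simp: pt_def)
next
  assume "\<exists>c. c \<noteq> 0 \<and> w = (\<lambda>j. c * v j)"
  then obtain c where c: "c \<noteq> 0" "w = (\<lambda>j. c * v j)" by auto
  show "pt v = pt w"
    unfolding pt_def c(2)
  proof (intro equalityI subsetI; clarify)
    fix a assume "(a::complex) \<noteq> 0"
    then show "\<exists>b. (\<lambda>j. a * v j) = (\<lambda>j. b * (c * v j)) \<and> b \<noteq> 0"
      using c(1) by (intro exI[of _ "a / c"]) auto
  next
    fix a assume "(a::complex) \<noteq> 0"
    then show "\<exists>b. (\<lambda>j. a * (c * v j)) = (\<lambda>j. b * v j) \<and> b \<noteq> 0"
      using c(1) by (intro exI[of _ "a * c"]) auto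
  qed
qed

lemma pt_scale [simp]: "c \<noteq> 0 \<Longrightarrow> pt (\<lambda>j. c * v j) = pt v"
  using pt_eq_iff by metis

lemma coords_scale: "v \<in> coords J \<Longrightarrow> c \<noteq> 0 \<Longrightarrow> (\<lambda>j. c * v j) \<in> coords J"
  by (auto simp: coords_def fun_eq_iff)

lemma coords_outside: "v \<in> coords J \<Longrightarrow> j \<notin> J \<Longrightarrow> v j = 0"
  unfolding coords_def by blast

lemma pt_in_pspace_iff: "pt v \<in> pspace J \<longleftrightarrow> v \<in> coords J"
proof
  assume "pt v \<in> pspace J"
  then obtain w where "w \<in> coords J" "pt w = pt v" by (auto simp: pspace_def)
  then show "v \<in> coords J" using coords_scale by (auto simp: pt_eq_iff)
qed (auto simp: pspace_def)

interpretation zar: forms pt "coords J" "{f. \<exists>d. hform d f}" "zariski J" for J :: "'k set"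
proof
  fix f :: "('k \<Rightarrow> complex) \<Rightarrow> complex" and v w :: "'k \<Rightarrow> complex"
  assume "f \<in> {f. \<exists>d. hform d f}" "pt v = pt w"
  then obtain d c where "hform d f" "c \<noteq> 0" "w = (\<lambda>j. c * v j)" by (auto simp: pt_eq_iff)
  then show "f v = 0 \<longleftrightarrow> f w = 0" using hform_scale[of d f c v] by simp
next
  show "(\<lambda>v. f v * g v) \<in> {f. \<exists>d. hform d f}"
    if "f \<in> {f. \<exists>d. hform d f}" "g \<in> {f. \<exists>d. hform d f}" for f g :: "('k \<Rightarrow> complex) \<Rightarrow> complex"
    using that gform_mult[where w = "\<lambda>_. Suc 0" and w' = "\<lambda>_. 0", OF _ _ refl, of _ 0 f _ 0 g 0] by auto
  show "(\<lambda>_. 1) \<in> {f. \<exists>d. hform d f}" by (auto intro: gform_const)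
  show "zariski J = topology_generated_by
      {{pt v | v. v \<in> coords J \<and> f v \<noteq> 0} | f. f \<in> {f. \<exists>d. hform d f}}"
    unfolding zariski_def hform_iff
  proof (rule arg_cong[of _ _ topology_generated_by], intro equalityI subsetI, goal_cases)
    case (1 x)
    then obtain F d where F: "homogeneous d F" "x = {pt v | v. v \<in> coords J \<and> mpoly_eval F v \<noteq> 0}"
      by blast
    then show ?case by (intro CollectI exI[of _ "mpoly_eval F"]) auto
  next
    case (2 x)
    then obtain F d where F: "homogeneous d F" "x = {pt v | v. v \<in> coords J \<and> mpoly_eval F v \<noteq> 0}"
      by (auto simp only: mem_Collect_eq)
    then show ?case by blast
  qed
qed

interpretation zpr: forms "\<lambda>(v, w). (pt v, pt w)" "coords J \<times> coords K"
  "{(\<lambda>(v, w). f (case_sum v w)) | f. \<exists>d e. biform d e f}" "zariski_prod J K"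
  for J :: "'j set" and K :: "'k set"
proof
  let ?F = "{(\<lambda>(v, w). f (case_sum v w)) | f. \<exists>d e. biform d e f}
    :: (('j \<Rightarrow> complex) \<times> ('k \<Rightarrow> complex) \<Rightarrow> complex) set"
  fix f :: "('j \<Rightarrow> complex) \<times> ('k \<Rightarrow> complex) \<Rightarrow> complex"
    and p q :: "('j \<Rightarrow> complex) \<times> ('k \<Rightarrow> complex)"
  assume f: "f \<in> ?F"
    and "(case p of (v, w) \<Rightarrow> (pt v, pt w)) = (case q of (v, w) \<Rightarrow> (pt v, pt w))"
  then obtain v w v' w' where "p = (v, w)" "q = (v', w')" "pt v = pt v'" "pt w = pt w'"
    by (cases p, cases q) auto
  then obtain c c' where "c \<noteq> 0" "c' \<noteq> 0" "p = (v, w)" "q = ((\<lambda>j. c * v j), (\<lambda>j. c' * w j))"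
    by (auto simp: pt_eq_iff)
  moreover obtain d e g where "biform d e g" "f = (\<lambda>(v, w). g (case_sum v w))" using f by auto
  ultimately show "f p = 0 \<longleftrightarrow> f q = 0" using biform_scale[of d e g c v c' w] by simp
next
  let ?F = "{(\<lambda>(v, w). f (case_sum v w)) | f. \<exists>d e. biform d e f}
    :: (('j \<Rightarrow> complex) \<times> ('k \<Rightarrow> complex) \<Rightarrow> complex) set"
  show "(\<lambda>v. f v * g v) \<in> ?F" if fg: "f \<in> ?F" "g \<in> ?F" for f g
  proof -
    obtain d e f' d' e' g' where *: "biform d e f'" "f = (\<lambda>(v, w). f' (case_sum v w))"
      "biform d' e' g'" "g = (\<lambda>(v, w). g' (case_sum v w))"
      using fg by blast
    show ?thesis
    proof (rule CollectI, intro exI conjI)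
      show "biform (d + d') (e + e') (\<lambda>v. f' v * g' v)" using * by (intro gform_mult) auto
    qed (auto simp: *)
  qed
  show "(\<lambda>_. 1) \<in> ?F"
    by (rule CollectI, rule exI[of _ "\<lambda>_. 1"]) (auto intro!: gform_const exI[of _ 0])
  show "zariski_prod J K = topology_generated_by
      {{(case p of (v, w) \<Rightarrow> (pt v, pt w)) | p :: ('j \<Rightarrow> complex) \<times> ('k \<Rightarrow> complex).
          p \<in> coords J \<times> coords K \<and> f p \<noteq> 0} | f. f \<in> ?F}"
    unfolding zariski_prod_def biform_iff
  proof (rule arg_cong[of _ _ topology_generated_by], intro equalityI subsetI, goal_cases)
    case (1 x)
    then obtain F d e where F: "bihomogeneous d e F"
      "x = {(pt v, pt w) | v w. v \<in> coords J \<and> w \<in> coords K \<and> mpoly_eval F (case_sum v w) \<noteq> 0}"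
      by auto
    show ?case
      by (rule CollectI, rule exI[of _ "\<lambda>(v, w). mpoly_eval F (case_sum v w)"]) (use F in auto)
  next
    case (2 x)
    then obtain g where "g \<in> {(\<lambda>(v, w). f (case_sum v w)) | f. \<exists>d e F. bihomogeneous d e F \<and> f = mpoly_eval F}"
      "x = {(case p of (v, w) \<Rightarrow> (pt v, pt w)) | p. p \<in> coords J \<times> coords K \<and> g p \<noteq> 0}"
      by blast
    then obtain F d e where F: "bihomogeneous d e F"
      "x = {(case p of (v, w) \<Rightarrow> (pt v, pt w)) | p. p \<in> coords J \<times> coords K \<and>
          (\<lambda>(v, w). mpoly_eval F (case_sum v w)) p \<noteq> 0}"
      by blast
    then show ?case by (intro CollectI exI[of _ F]) auto
  qed
qed

lemma topspace_zariski [simp]: "topspace (zariski J) = pspace J"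
  by (simp add: zar.topspace_T pspace_def)

lemma topspace_zariski_prod [simp]: "topspace (zariski_prod J K) = pspace J \<times> pspace K"
  by (auto simp: zpr.topspace_T pspace_def image_def)

lemma in_zariski_closure_iff:
  assumes "v \<in> coords J"
  shows "pt v \<in> zariski J closure_of S \<longleftrightarrow>
    (\<forall>d f. hform d f \<longrightarrow> (\<forall>u\<in>coords J. pt u \<in> S \<longrightarrow> f u = 0) \<longrightarrow> f v = 0)"
  using zar.closure_of_iff[OF assms, of S] by auto

lemma in_zariski_prod_closure_iff:
  assumes "v \<in> coords J" "w \<in> coords K"
  shows "(pt v, pt w) \<in> zariski_prod J K closure_of S \<longleftrightarrow>
    (\<forall>d e f. biform d e f \<longrightarrow>
      (\<forall>u\<in>coords J. \<forall>x\<in>coords K. (pt u, pt x) \<in> S \<longrightarrow> f (case_sum u x) = 0) \<longrightarrow> f (case_sum v w) = 0)"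
  (is "?L \<longleftrightarrow> ?R")
proof
  assume ?L
  then have *: "\<forall>g\<in>{(\<lambda>(v, w). f (case_sum v w)) | f. \<exists>d e. biform d e f}.
     (\<forall>p\<in>coords J \<times> coords K. (case p of (v, w) \<Rightarrow> (pt v, pt w)) \<in> S \<longrightarrow> g p = 0) \<longrightarrow> g (v, w) = 0"
    using zpr.closure_of_iff[of "(v, w)" J K S] assms by simp
  show ?R
  proof (intro allI impI)
    fix d e f assume "biform d e f"
      "\<forall>u\<in>coords J. \<forall>x\<in>coords K. (pt u, pt x) \<in> S \<longrightarrow> f (case_sum u x) = 0"
    then show "f (case_sum v w) = 0"
      using *[THEN bspec, of "\<lambda>(v, w). f (case_sum v w)"] by auto
  qed
next
  assume R: ?R
  show ?L
    using zpr.closure_of_iff[of "(v, w)" J K S] assms R by fastforce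
qed

text \<open>The point is cut out by the linear forms \<open>v j * u k - v k * u j\<close> in
  \<open>u\<close>, for one fixed \<open>j\<close> with \<open>v j\<close> nonzero.\<close>

lemma closedin_zariski_point:
  assumes v: "v \<in> coords J"
  shows "closedin (zariski J) {pt v}"
proof -
  have "zariski J closure_of {pt v} \<subseteq> {pt v}"
  proof
    fix x assume x: "x \<in> zariski J closure_of {pt v}"
    then have "x \<in> pspace J" using closure_of_subset_topspace[of "zariski J"] by fastforce
    then obtain u where u: "u \<in> coords J" "x = pt u" by (auto simp: pspace_def)
    obtain j where j: "v j \<noteq> 0" using v by (auto simp: coords_def fun_eq_iff)
    have "v j * u k - v k * u j = 0" for k
    proof -
      have "hform 1 (\<lambda>u. v j * u k - v k * u j)"
        by (intro gform_diff gform_cmult hform_coord refl)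
      moreover have "\<forall>w\<in>coords J. pt w \<in> {pt v} \<longrightarrow> v j * w k - v k * w j = 0"
        by (auto simp: pt_eq_iff[of _ v, symmetric] eq_commute[of _ "pt v"] pt_eq_iff)
      ultimately show ?thesis using x u in_zariski_closure_iff[OF u(1)] by blast
    qed
    then have eq: "u = (\<lambda>k. u j / v j * v k)" using j by (auto simp: field_simps)
    moreover have "u j \<noteq> 0"
    proof
      assume "u j = 0"
      then have "u = (\<lambda>k. 0)" using eq by simp
      then show False using u by (auto simp: coords_def)
    qed
    ultimately have "pt v = pt u" using j by (subst pt_eq_iff) (rule exI[of _ "u j / v j"], auto)
    then show "x \<in> {pt v}" using u by simp
  qed
  then show ?thesis
    using v by (intro closure_of_subset_eq[THEN iffD1]) (auto simp: pt_in_pspace_iff)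
qed

text \<open>Freezing the first argument of a bihomogeneous form at a representative \<open>v\<close>
  of \<open>i\<close> leaves a form of degree \<open>e\<close> on the second factor.\<close>

lemma closedin_slice:
  assumes "closedin (zariski_prod J K) Z" "i \<in> pspace J"
  shows "closedin (zariski K) (fibre Z i)"
proof -
  obtain v where v: "v \<in> coords J" "i = pt v" using assms(2) by (auto simp: pspace_def)
  have Zs: "Z \<subseteq> pspace J \<times> pspace K" using closedin_subset[OF assms(1)] by simp
  then have sub: "fibre Z i \<subseteq> pspace K" by (auto simp: fibre_def)
  have "zariski K closure_of (fibre Z i) \<subseteq> fibre Z i"
  proof
    fix x assume x: "x \<in> zariski K closure_of (fibre Z i)"
    then have "x \<in> pspace K" using closure_of_subset_topspace[of "zariski K"] by fastforce
    then obtain w where w: "w \<in> coords K" "x = pt w" by (auto simp: pspace_def)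
    have "(pt v, pt w) \<in> zariski_prod J K closure_of Z"
      unfolding in_zariski_prod_closure_iff[OF v(1) w(1)]
    proof (intro allI impI)
      fix d e f assume f: "biform d e f"
        "\<forall>u\<in>coords J. \<forall>x\<in>coords K. (pt u, pt x) \<in> Z \<longrightarrow> f (case_sum u x) = 0"
      have "hform e (\<lambda>w. f (case_sum v w))"
      proof -
        obtain F where F: "\<forall>m\<in>Poly_Mapping.keys F. wdeg (case_sum (\<lambda>_. Suc 0) (\<lambda>_. 0)) m = d \<and>
            wdeg (case_sum (\<lambda>_. 0) (\<lambda>_. Suc 0)) m = e" "f = mpoly_eval F"
          using f(1) by (auto simp: gform_def)
        have "hform e (\<lambda>w. Poly_Mapping.lookup F m *
            (\<Prod>j\<in>Poly_Mapping.keys m. case_sum v w j ^ Poly_Mapping.lookup m j))"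
          if m: "m \<in> Poly_Mapping.keys F" for m
        proof (rule gform_cmult, rule gform_prod)
          fix x assume "x \<in> Poly_Mapping.keys m"
          show "hform (Poly_Mapping.lookup m x * case_sum (\<lambda>_. 0) (\<lambda>_. Suc 0) x)
            (\<lambda>w. case_sum v w x ^ Poly_Mapping.lookup m x)"
          proof (cases x)
            case (Inl a) then show ?thesis by (auto intro: gform_const)
          next
            case (Inr b) then show ?thesis by (auto intro!: gform_power[OF hform_coord])
          qed
        next
          show "e = (\<Sum>x\<in>Poly_Mapping.keys m. Poly_Mapping.lookup m x * case_sum (\<lambda>_. 0) (\<lambda>_. Suc 0) x)"
            using F(1) m by (auto simp: wdeg_def)
        qed auto
        then show ?thesis unfolding F(2) mpoly_eval_def by (rule gform_sum)
      qed
      moreover have "\<forall>x\<in>coords K. pt x \<in> fibre Z i \<longrightarrow> f (case_sum v x) = 0"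
        using f(2) v by (auto simp: fibre_def)
      ultimately show "f (case_sum v w) = 0"
        using x w in_zariski_closure_iff[OF w(1)] by blast
    qed
    then show "x \<in> fibre Z i"
      using closure_of_closedin[OF assms(1)] v w by (simp add: fibre_def)
  qed
  then show ?thesis using sub closure_of_subset_eq by fastforce
qed

text \<open>Each form that vanishes on \<open>Z\<close> vanishes along the arc and hence at 0. The
  vector at 0 must be nonzero, which is why arcs are rescaled before the limit is taken.\<close>

lemma zariski_arc_limit:
  assumes "closedin (zariski J) Z" and v0: "(\<lambda>j. poly (v j) 0) \<in> coords J"
    and arc: "\<And>z. z \<noteq> 0 \<Longrightarrow> pt (\<lambda>j. poly (v j) z) \<in> Z"
  shows "pt (\<lambda>j. poly (v j) 0) \<in> Z"
proof -
  have "Z \<subseteq> pspace J" using closedin_subset[OF assms(1)] by simp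
  then have c: "(\<lambda>j. poly (v j) z) \<in> coords J" if "z \<noteq> 0" for z
    using arc[OF that] by (auto simp: pt_in_pspace_iff)
  have "pt (\<lambda>j. poly (v j) 0) \<in> zariski J closure_of Z"
    unfolding in_zariski_closure_iff[OF v0]
  proof (intro allI impI)
    fix d f assume f: "hform d f" "\<forall>u\<in>coords J. pt u \<in> Z \<longrightarrow> f u = 0"
    then show "f (\<lambda>j. poly (v j) 0) = 0"
      using gform_vanish_at_0[OF f(1), of v] c arc by blast
  qed
  then show ?thesis using closure_of_closedin[OF assms(1)] by simp
qed

lemma zariski_prod_arc_limit:
  assumes "closedin (zariski_prod J K) Z"
    and u0: "(\<lambda>j. poly (u j) 0) \<in> coords J" and v0: "(\<lambda>j. poly (v j) 0) \<in> coords K"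
    and arc: "\<And>z. z \<noteq> 0 \<Longrightarrow> (pt (\<lambda>j. poly (u j) z), pt (\<lambda>j. poly (v j) z)) \<in> Z"
  shows "(pt (\<lambda>j. poly (u j) 0), pt (\<lambda>j. poly (v j) 0)) \<in> Z"
proof -
  have "Z \<subseteq> pspace J \<times> pspace K" using closedin_subset[OF assms(1)] by simp
  then have c: "(\<lambda>j. poly (u j) z) \<in> coords J" "(\<lambda>j. poly (v j) z) \<in> coords K" if "z \<noteq> 0" for z
    using arc[OF that] by (auto simp: pt_in_pspace_iff)
  have cs: "case_sum (\<lambda>j. poly (u j) z) (\<lambda>j. poly (v j) z) = (\<lambda>x. poly (case_sum u v x) z)" for z
    by (auto simp: fun_eq_iff split: sum.splits)
  have "(pt (\<lambda>j. poly (u j) 0), pt (\<lambda>j. poly (v j) 0)) \<in> zariski_prod J K closure_of Z"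
    unfolding in_zariski_prod_closure_iff[OF u0 v0]
  proof (intro allI impI)
    fix d e f assume f: "biform d e f"
      "\<forall>u\<in>coords J. \<forall>x\<in>coords K. (pt u, pt x) \<in> Z \<longrightarrow> f (case_sum u x) = 0"
    have "f (\<lambda>x. poly (case_sum u v x) z) = 0" if "z \<noteq> 0" for z
      using f(2) c[OF that] arc[OF that] unfolding cs[symmetric] by blast
    then have "f (\<lambda>x. poly (case_sum u v x) 0) = 0"
      by (rule gform_vanish_at_0[OF f(1)])
    then show "f (case_sum (\<lambda>j. poly (u j) 0) (\<lambda>j. poly (v j) 0)) = 0"
      unfolding cs .
  qed
  then show ?thesis using closure_of_closedin[OF assms(1)] by simp
qed

section \<open>Images of tori\<close>

text \<open>Three coordinates, because the product of the line and the surface is parametrized by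
  \<open>z\<close> and \<open>(s, t)\<close>; the parametrizations of the graph and of a single
  fibre ignore some of them.\<close>

definition torus3 :: "(complex \<times> complex \<times> complex) set" where
  "torus3 = {(z, s, t). z \<noteq> 0 \<and> s \<noteq> 0 \<and> t \<noteq> 0}"

text \<open>A class of functions, not of expressions. What counts is that pullbacks of forms under
  monomial parametrizations belong to it and that its members become entire along exponential
  curves.\<close>

inductive laurent :: "(complex \<times> complex \<times> complex \<Rightarrow> complex) \<Rightarrow> bool" where
  laurent_const: "laurent (\<lambda>_. c)"
| laurent_monom: "laurent (\<lambda>(z, s, t). z powi a * s powi b * t powi c)"
| laurent_add: "laurent f \<Longrightarrow> laurent g \<Longrightarrow> laurent (\<lambda>p. f p + g p)"
| laurent_mult: "laurent f \<Longrightarrow> laurent g \<Longrightarrow> laurent (\<lambda>p. f p * g p)"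

text \<open>The two points where \<open>f\<close> and \<open>g\<close> do not vanish are joined by an entire curve inside the
  torus, to which the identity theorem applies.\<close>

lemma laurent_mult_nonzero:
  assumes "laurent f" "laurent g" "p \<in> torus3" "f p \<noteq> 0" "q \<in> torus3" "g q \<noteq> 0"
  shows "\<exists>r\<in>torus3. f r \<noteq> 0 \<and> g r \<noteq> 0"
proof (rule ccontr)
  assume no: "\<not> (\<exists>r\<in>torus3. f r \<noteq> 0 \<and> g r \<noteq> 0)"
  obtain z s t where p: "p = (z, s, t)" "z \<noteq> 0" "s \<noteq> 0" "t \<noteq> 0"
    using assms(3) by (auto simp: torus3_def)
  obtain z' s' t' where q: "q = (z', s', t')" "z' \<noteq> 0" "s' \<noteq> 0" "t' \<noteq> 0"
    using assms(5) by (auto simp: torus3_def)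
  define \<gamma> where "\<gamma> = (\<lambda>x. (z * exp (x * Ln (z' / z)), s * exp (x * Ln (s' / s)), t * exp (x * Ln (t' / t))))"
  have \<gamma>: "\<gamma> 0 = p" "\<gamma> 1 = q" "\<gamma> x \<in> torus3" for x
    using p q by (auto simp: \<gamma>_def torus3_def exp_Ln)
  have hol: "(\<lambda>x. h (\<gamma> x)) holomorphic_on UNIV" if "laurent h" for h
    using that
  proof induction
    case (laurent_monom a b c)
    show ?case unfolding \<gamma>_def case_prod_conv
      using p by (intro holomorphic_intros) auto
  qed (auto intro!: holomorphic_intros)
  let ?S = "{x. f (\<gamma> x) \<noteq> 0}"
  have "open ?S"
    using hol[OF assms(1)] by (intro open_Collect_neq holomorphic_on_imp_continuous_on) auto
  moreover have "0 \<in> ?S" using assms(4) \<gamma> by simp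
  moreover have "g (\<gamma> x) = 0" if "x \<in> ?S" for x using no \<gamma>(3) that by blast
  ultimately have "g (\<gamma> 1) = 0"
    by (intro analytic_continuation_open[of ?S UNIV "\<lambda>x. g (\<gamma> x)" "\<lambda>_. 0" 1])
      (use hol[OF assms(2)] in auto)
  then show False using \<gamma> assms(6) by simp
qed

lemma (in forms) irreducible_torus_image:
  assumes V: "\<And>p. p \<in> torus3 \<Longrightarrow> V p \<in> C" and L: "\<And>f. f \<in> Fm \<Longrightarrow> laurent (\<lambda>p. f (V p))"
  shows "irreducible_in T ((\<lambda>p. \<pi> (V p)) ` torus3)"
proof (rule irreducible_inI)
  show "(\<lambda>p. \<pi> (V p)) ` torus3 \<subseteq> \<pi> ` C" using V by auto
  have "(1, 1, 1) \<in> torus3" by (auto simp: torus3_def)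
  then show "(\<lambda>p. \<pi> (V p)) ` torus3 \<noteq> {}" by blast
  fix f g assume f: "f \<in> Fm" and g: "g \<in> Fm"
  have ex: "\<exists>p\<in>torus3. h (V p) \<noteq> 0"
    if "h \<in> Fm" and ex: "\<exists>v\<in>C. \<pi> v \<in> (\<lambda>p. \<pi> (V p)) ` torus3 \<and> h v \<noteq> 0" for h
  proof -
    obtain v p where "v \<in> C" "h v \<noteq> 0" "\<pi> v = \<pi> (V p)" "p \<in> torus3" using ex by blast
    then show ?thesis using inv[OF \<open>h \<in> Fm\<close>, of v "V p"] V by blast
  qed
  assume "\<exists>v\<in>C. \<pi> v \<in> (\<lambda>p. \<pi> (V p)) ` torus3 \<and> f v \<noteq> 0"
  then obtain p where p: "p \<in> torus3" "f (V p) \<noteq> 0" using ex[OF f] by blast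
  assume "\<exists>v\<in>C. \<pi> v \<in> (\<lambda>p. \<pi> (V p)) ` torus3 \<and> g v \<noteq> 0"
  then obtain q where q: "q \<in> torus3" "g (V q) \<noteq> 0" using ex[OF g] by blast
  obtain r where "r \<in> torus3" "f (V r) \<noteq> 0" "g (V r) \<noteq> 0"
    using laurent_mult_nonzero[OF L[OF f] L[OF g] p q] by blast
  then show "\<exists>v\<in>C. \<pi> v \<in> (\<lambda>p. \<pi> (V p)) ` torus3 \<and> f v \<noteq> 0 \<and> g v \<noteq> 0" using V by blast
qed

lemma laurent_gform:
  assumes "gform w w' d e f" "\<And>j. laurent (\<lambda>p. V p j)"
  shows "laurent (\<lambda>p. f (V p))"
  by (rule gform_closed[OF assms(1), where Q = laurent]) (auto intro: laurent.intros assms)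

lemma irreducible_zariski_torus_image:
  assumes "\<And>p. p \<in> torus3 \<Longrightarrow> V p \<in> coords J" "\<And>j. laurent (\<lambda>p. V p j)"
  shows "irreducible_in (zariski J) ((\<lambda>p. pt (V p)) ` torus3)"
  by (rule zar.irreducible_torus_image) (auto intro: assms laurent_gform)

lemma irreducible_zariski_prod_torus_image:
  assumes "\<And>p. p \<in> torus3 \<Longrightarrow> V p \<in> coords J" "\<And>j. laurent (\<lambda>p. V p j)"
    and "\<And>p. p \<in> torus3 \<Longrightarrow> W p \<in> coords K" "\<And>j. laurent (\<lambda>p. W p j)"
  shows "irreducible_in (zariski_prod J K) ((\<lambda>p. (pt (V p), pt (W p))) ` torus3)"
proof -
  have "irreducible_in (zariski_prod J K)
    ((\<lambda>p. case (V p, W p) of (v, w) \<Rightarrow> (pt v, pt w)) ` torus3)"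
  proof (rule zpr.irreducible_torus_image)
    show "(V p, W p) \<in> coords J \<times> coords K" if "p \<in> torus3" for p using assms that by auto
    fix g :: "('a \<Rightarrow> complex) \<times> ('b \<Rightarrow> complex) \<Rightarrow> complex"
    assume "g \<in> {(\<lambda>(v, w). f (case_sum v w)) | f. \<exists>d e. biform d e f}"
    then obtain f d e where f: "biform d e f" "g = (\<lambda>(v, w). f (case_sum v w))" by blast
    have "laurent (\<lambda>p. f (case_sum (V p) (W p)))"
    proof (rule laurent_gform[OF f(1)])
      show "laurent (\<lambda>p. case_sum (V p) (W p) j)" for j by (cases j) (auto intro: assms)
    qed
    then show "laurent (\<lambda>p. g (V p, W p))" by (simp add: f(2))
  qed
  then show ?thesis by simp
qed

section \<open>The projective line\<close>

definition P1_infinity :: "bool point" where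
  "P1_infinity = pt (\<lambda>b. if b then 1 else 0)"

lemma affine_coords [simp]:
  "(\<lambda>b. if b then z else 1) \<in> coords (UNIV :: bool set)" "(\<lambda>b. if b then 1 else z) \<in> coords (UNIV :: bool set)"
  by (auto simp: coords_def fun_eq_iff intro: exI[of _ True] exI[of _ False])

lemma P1_affine_in [simp]: "P1_affine z \<in> P1" and P1_infinity_in [simp]: "P1_infinity \<in> P1"
  by (auto simp: P1_affine_def P1_infinity_def P1_def pt_in_pspace_iff)

lemma pt_eq_P1_affine_iff:
  "pt u = P1_affine z \<longleftrightarrow> u False \<noteq> 0 \<and> u True = z * u False"
proof
  assume "pt u = P1_affine z"
  then have "P1_affine z = pt u" by simp
  then obtain c where "c \<noteq> 0" "u = (\<lambda>b. c * (if b then z else 1))"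
    unfolding P1_affine_def pt_eq_iff by blast
  then show "u False \<noteq> 0 \<and> u True = z * u False" by simp
next
  assume R: "u False \<noteq> 0 \<and> u True = z * u False"
  then have "u = (\<lambda>b. u False * (if b then z else 1))" by (auto simp: fun_eq_iff)
  then have "P1_affine z = pt u"
    using R unfolding P1_affine_def pt_eq_iff by blast
  then show "pt u = P1_affine z" by simp
qed

lemma pt_eq_P1_infinity_iff:
  "pt u = P1_infinity \<longleftrightarrow> u False = 0 \<and> u True \<noteq> 0"
proof
  assume "pt u = P1_infinity"
  then have "P1_infinity = pt u" by simp
  then obtain c where "c \<noteq> 0" "u = (\<lambda>b. c * (if b then 1 else 0))"
    unfolding P1_infinity_def pt_eq_iff by blast
  then show "u False = 0 \<and> u True \<noteq> 0" by simp
next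
  assume R: "u False = 0 \<and> u True \<noteq> 0"
  then have "u = (\<lambda>b. u True * (if b then 1 else 0))" by (auto simp: fun_eq_iff)
  then have "P1_infinity = pt u"
    using R unfolding P1_infinity_def pt_eq_iff by blast
  then show "pt u = P1_infinity" by simp
qed

lemma P1_affine_eq_iff [simp]: "P1_affine z = P1_affine w \<longleftrightarrow> z = w"
  using pt_eq_P1_affine_iff[of "\<lambda>b. if b then z else 1" w] by (simp add: P1_affine_def)

lemma P1_affine_neq_infinity [simp]: "P1_affine z \<noteq> P1_infinity" "P1_infinity \<noteq> P1_affine z"
  using pt_eq_P1_infinity_iff[of "\<lambda>b. if b then z else 1"] by (auto simp: P1_affine_def)

lemma P1_cases:
  assumes "x \<in> P1"
  obtains z where "x = P1_affine z" | "x = P1_infinity"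
proof -
  obtain u where u: "u \<in> coords UNIV" "x = pt u" using assms by (auto simp: P1_def pspace_def)
  show ?thesis
  proof (cases "u False = 0")
    case True
    then have "u True \<noteq> 0" using u(1) by (auto simp: coords_def fun_eq_iff all_bool_eq)
    then show ?thesis using that(2) u True pt_eq_P1_infinity_iff by blast
  next
    case False
    then show ?thesis using that(1)[of "u True / u False"] u by (simp add: pt_eq_P1_affine_iff)
  qed
qed

lemma P1_topspace: "topspace (zariski UNIV) = P1"
  by (simp add: P1_def)

lemma openin_P1: "openin (zariski UNIV) P1" and closedin_P1: "closedin (zariski UNIV) P1"
  using openin_topspace[of "zariski (UNIV :: bool set)"] closedin_topspace[of "zariski (UNIV :: bool set)"]
  unfolding P1_topspace by auto

lemma infinite_P1: "infinite P1"
proof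
  assume "finite P1"
  then have "finite (range P1_affine)" by (rule finite_subset[rotated]) auto
  then have "finite (UNIV :: complex set)" by (rule finite_imageD) (simp add: inj_on_def)
  then show False using infinite_UNIV_char_0 by blast
qed

text \<open>Homogeneity reaches every \<open>v\<close> with \<open>v False\<close> nonzero from the
  affine chart; the remaining vectors are values at 0 of arcs whose coordinate \<open>False\<close>
  is the parameter.\<close>

lemma hform_zero_on_P1:
  assumes f: "hform d f" and 0: "\<And>z. f (\<lambda>b. if b then z else 1) = 0"
  shows "f = (\<lambda>_ :: bool \<Rightarrow> complex. 0)"
proof
  fix v :: "bool \<Rightarrow> complex"
  have *: "f v = 0" if v: "v False \<noteq> 0" for v
  proof -
    have "v = (\<lambda>b. v False * (if b then v True / v False else 1))" using v by (auto simp: fun_eq_iff)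
    then have "f v = v False ^ d * f (\<lambda>b. if b then v True / v False else 1)"
      using hform_scale[OF f] by metis
    then show ?thesis using 0 by simp
  qed
  show "f v = 0"
  proof (cases "v False = 0")
    case True
    have "f (\<lambda>b. poly (if b then [:v True:] else [:0, 1:]) 0) = 0"
      by (rule gform_vanish_at_0[OF f]) (auto intro: *)
    moreover have "(\<lambda>b. poly (if b then [:v True:] else [:0, 1:]) 0) = v"
      using True by (auto simp: fun_eq_iff)
    ultimately show ?thesis by simp
  qed (rule *)
qed

text \<open>A form that vanishes on \<open>Z\<close> but not everywhere restricts to a nonzero
  polynomial on the affine chart; besides its roots only infinity can belong to
  \<open>Z\<close>.\<close>

lemma finite_closed_P1:
  assumes "closedin (zariski UNIV) Z" "Z \<subset> P1"
  shows "finite Z"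
proof -
  obtain v where v: "v \<in> coords UNIV" "pt v \<notin> Z"
    using assms(2) by (auto simp: P1_def pspace_def)
  obtain f where f: "\<exists>d. hform d f" "f v \<noteq> 0" "\<And>u. u \<in> coords UNIV \<Longrightarrow> pt u \<in> Z \<Longrightarrow> f u = 0"
    using zar.closedin_separate[OF assms(1) v] by blast
  then obtain d where d: "hform d f" by blast
  obtain P where P: "\<And>z. f (\<lambda>b. poly (if b then [:0, 1:] else [:1:]) z) = poly P z"
    using gform_poly_curve[OF d, of "\<lambda>b. if b then [:0, 1:] else [:1:]"] by blast
  have eq: "(\<lambda>b. poly (if b then [:0, 1:] else [:1:]) z) = (\<lambda>b. if b then z else 1)" for z :: complex
    by (auto simp: fun_eq_iff)
  have "P \<noteq> 0"
    using hform_zero_on_P1[OF d] P f(2) unfolding eq by force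
  then have "finite (P1_affine ` {z. poly P z = 0} \<union> {P1_infinity})"
    using poly_roots_finite by blast
  moreover have "Z \<subseteq> P1_affine ` {z. poly P z = 0} \<union> {P1_infinity}"
  proof
    fix x assume x: "x \<in> Z"
    then have "x \<in> P1" using assms by auto
    then show "x \<in> P1_affine ` {z. poly P z = 0} \<union> {P1_infinity}"
    proof (cases rule: P1_cases)
      case (1 z)
      then show ?thesis using f(3)[of "\<lambda>b. if b then z else 1"] x P[of z] unfolding eq
        by (auto simp: P1_affine_def)
    qed auto
  qed
  ultimately show ?thesis by (rule finite_subset[rotated])
qed

lemma closedin_P1_finite:
  assumes "finite S" "S \<subseteq> P1"
  shows "closedin (zariski UNIV) S"
proof -
  have "closedin (zariski UNIV) (\<Union>x\<in>S. {x})"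
  proof (rule closedin_Union)
    fix Y assume "Y \<in> (\<lambda>x. {x}) ` S"
    then show "closedin (zariski UNIV) Y"
      using assms(2) closedin_zariski_point by (auto simp: P1_def pspace_def)
  qed (use assms in auto)
  then show ?thesis by simp
qed

lemma irreducible_P1: "irreducible_in (zariski UNIV) P1"
  unfolding irreducible_in_def
proof (intro conjI allI impI)
  show "P1 \<subseteq> topspace (zariski UNIV)" by (simp add: P1_def)
  show "P1 \<noteq> {}" using P1_infinity_in by blast
  fix A B assume cl: "closedin (zariski UNIV) A" "closedin (zariski UNIV) B" and "P1 \<subseteq> A \<union> B"
  moreover have "A \<subseteq> P1" "B \<subseteq> P1" using cl closedin_subset P1_topspace by blast+
  ultimately show "P1 \<subseteq> A \<or> P1 \<subseteq> B"
    using finite_closed_P1[of A] finite_closed_P1[of B] infinite_P1 finite_subset[of P1 "A \<union> B"] by auto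
qed

text \<open>Only the zero function is a form vanishing on the whole line, so the cone tangent space
  is the full plane; \<open>v\<close> and a unit vector where the other coordinate of
  \<open>v\<close> is nonzero span it.\<close>

lemma nonsingular_P1: "nonsingular_curve UNIV P1"
  unfolding nonsingular_curve_def
proof (intro conjI ballI impI)
  have "closedin (zariski UNIV) P1" "openin (zariski UNIV) P1"
    using closedin_topspace[of "zariski (UNIV :: bool set)"] openin_topspace[of "zariski (UNIV :: bool set)"]
    unfolding P1_topspace by auto
  then show "\<exists>A B. closedin (zariski UNIV) A \<and> openin (zariski UNIV) B \<and> P1 = A \<inter> B" by blast
  show "has_dimension (subtopology (zariski UNIV) P1) 1"
  proof (rule has_dimension_1I)
    show "closedin (zariski UNIV) P1" by fact
    show "closedin (zariski UNIV) {x}" if "x \<in> P1" for x using that by (simp add: closedin_P1_finite)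
  qed (auto intro: irreducible_P1 finite_closed_P1 simp: infinite_P1)
next
  fix v :: "bool \<Rightarrow> complex" assume v: "v \<in> coords UNIV"
  have F0: "mpoly_eval F = (\<lambda>_. 0)"
    if F: "homogeneous d F" "\<forall>u\<in>coords (UNIV :: bool set). pt u \<in> P1 \<longrightarrow> mpoly_eval F u = 0" for d F
  proof (rule hform_zero_on_P1)
    show "hform d (mpoly_eval F)" using F(1) hform_iff by blast
    show "mpoly_eval F (\<lambda>b. if b then z else 1) = 0" for z
      using F(2) by (auto simp: P1_def pt_in_pspace_iff)
  qed
  then have U: "cone_tangent_space UNIV P1 v = UNIV"
    unfolding cone_tangent_space_def using F0 by fastforce
  show "\<exists>w. cone_tangent_space UNIV P1 v = {\<lambda>j. a * v j + b * w j | a b. True}"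
  proof (cases "v False = 0")
    case False
    have "x = (\<lambda>j. (x False / v False) * v j + (x True - x False / v False * v True) * (if j then 1 else 0))" for x
      using False by (auto simp: fun_eq_iff)
    then show ?thesis unfolding U by (intro exI[of _ "\<lambda>j. if j then 1 else 0"]) blast
  next
    case True
    then have T: "v True \<noteq> 0" using v by (auto simp: coords_def fun_eq_iff all_bool_eq)
    have "x = (\<lambda>j. (x True / v True) * v j + (x False - x True / v True * v False) * (if j then 0 else 1))" for x
      using T by (auto simp: fun_eq_iff)
    then show ?thesis unfolding U by (intro exI[of _ "\<lambda>j. if j then 0 else 1"]) blast
  qed
qed (auto intro: irreducible_P1)

lemma generically_P1I:
  assumes "finite S" "\<And>i. i \<in> P1 \<Longrightarrow> i \<notin> S \<Longrightarrow> P i"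
  shows "generically (subtopology (zariski UNIV) P1) P"
proof -
  have "closedin (zariski UNIV) (S \<inter> P1)" using assms(1) by (intro closedin_P1_finite) auto
  then have "openin (zariski UNIV) (P1 - S \<inter> P1)"
    by (intro openin_diff openin_P1)
  moreover have "P1 - S \<inter> P1 \<noteq> {}"
    using assms(1) infinite_P1 by (metis Diff_eq_empty_iff finite_Int finite_subset)
  ultimately show ?thesis
    unfolding generically_def P1_topspace[symmetric] subtopology_topspace
    using assms(2) by (intro exI[of _ "P1 - S \<inter> P1"]) (auto simp flip: P1_def)
qed

text \<open>A nonempty open set of the line is cofinite, so it meets the infinite set of affine
  points outside \<open>S\<close>; \<open>S\<close> holds the values to be avoided.\<close>

lemma generically_P1D:
  assumes "generically (subtopology (zariski UNIV) P1) P" "finite S"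
  obtains z where "z \<notin> S" "P (P1_affine z)"
proof -
  obtain W where W: "openin (zariski UNIV) W" "W \<noteq> {}" "\<forall>x\<in>W. P x"
    using assms(1) unfolding generically_def P1_topspace[symmetric] subtopology_topspace by blast
  have "finite (P1 - W)"
  proof (rule finite_closed_P1)
    show "closedin (zariski UNIV) (P1 - W)"
      using W(1) by (intro closedin_diff closedin_P1)
    show "P1 - W \<subset> P1" using W openin_subset P1_topspace by blast
  qed
  moreover have "infinite (P1_affine ` (UNIV - S))"
    using assms(2) infinite_UNIV_char_0[where 'a = complex]
    by (subst finite_image_iff) (auto simp: inj_on_def Diff_infinite_finite)
  ultimately have "\<not> P1_affine ` (UNIV - S) \<subseteq> P1 - W" using finite_subset by blast
  then show ?thesis using that W(3) by auto
qed

section \<open>Regular maps\<close>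

lemma regular_map_on_hform:
  "regular_map_on J D K Y f \<longleftrightarrow>
     f ` D \<subseteq> Y \<and>
     (\<forall>x\<in>D. \<exists>W d F. openin (subtopology (zariski J) D) W \<and> x \<in> W \<and> (\<forall>k. hform d (F k)) \<and>
        (\<forall>v\<in>coords J. pt v \<in> W \<longrightarrow>
           (\<lambda>k. if k \<in> K then F k v else 0) \<in> coords K \<and>
           f (pt v) = pt (\<lambda>k. if k \<in> K then F k v else 0)))"
proof -
  have "(\<exists>F. (\<forall>k. homogeneous d (F k)) \<and> P (\<lambda>k. mpoly_eval (F k))) \<longleftrightarrow>
    (\<exists>F. (\<forall>k. hform d (F k)) \<and> P F)" for d and P :: "('k \<Rightarrow> ('j \<Rightarrow> complex) \<Rightarrow> complex) \<Rightarrow> bool"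
  proof
    assume "\<exists>F. (\<forall>k. hform d (F k)) \<and> P F"
    then obtain F where F: "\<forall>k. \<exists>G. homogeneous d G \<and> F k = mpoly_eval G" "P F"
      unfolding hform_iff by blast
    then obtain G where G: "\<forall>k. homogeneous d (G k) \<and> F k = mpoly_eval (G k)" by metis
    then have "F = (\<lambda>k. mpoly_eval (G k))" by auto
    then show "\<exists>F. (\<forall>k. homogeneous d (F k)) \<and> P (\<lambda>k. mpoly_eval (F k))" using F G by auto
  next
    assume "\<exists>F. (\<forall>k. homogeneous d (F k)) \<and> P (\<lambda>k. mpoly_eval (F k))"
    then obtain F where "\<forall>k. homogeneous d (F k)" "P (\<lambda>k. mpoly_eval (F k))" by blast
    then show "\<exists>F. (\<forall>k. hform d (F k)) \<and> P F"
      by (intro exI[of _ "\<lambda>k. mpoly_eval (F k)"]) (auto simp: hform_iff)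
  qed
  note * = this[of _ "\<lambda>F. \<forall>v\<in>coords J. pt v \<in> W \<longrightarrow>
           (\<lambda>k. if k \<in> K then F k v else 0) \<in> coords K \<and>
           f (pt v) = pt (\<lambda>k. if k \<in> K then F k v else 0)" for W]
  show ?thesis unfolding regular_map_on_def by (simp only: * ex_simps)
qed

lemma regular_map_on_cong:
  assumes "\<And>x. x \<in> D \<Longrightarrow> f x = g x"
  shows "regular_map_on J D K Y f \<longleftrightarrow> regular_map_on J D K Y g"
proof -
  have imp: "regular_map_on J D K Y g" if r: "regular_map_on J D K Y f" and fg: "\<And>x. x \<in> D \<Longrightarrow> f x = g x"
    for f g
    unfolding regular_map_on_def
  proof (intro conjI ballI)
    show "g ` D \<subseteq> Y" using r fg unfolding regular_map_on_def by auto
    fix x assume "x \<in> D"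
    then obtain W d F where W: "openin (subtopology (zariski J) D) W" "x \<in> W" "\<forall>k. homogeneous d (F k)"
       "\<forall>v\<in>coords J. pt v \<in> W \<longrightarrow>
           (\<lambda>k. if k \<in> K then mpoly_eval (F k) v else 0) \<in> coords K \<and>
           f (pt v) = pt (\<lambda>k. if k \<in> K then mpoly_eval (F k) v else 0)"
      using r unfolding regular_map_on_def by blast
    moreover have "W \<subseteq> D" using openin_subset[OF W(1)] by auto
    then have "g (pt v) = f (pt v)" if "pt v \<in> W" for v using fg that by auto
    ultimately show "\<exists>W d F. openin (subtopology (zariski J) D) W \<and> x \<in> W \<and> (\<forall>k. homogeneous d (F k)) \<and>
        (\<forall>v\<in>coords J. pt v \<in> W \<longrightarrow>
           (\<lambda>k. if k \<in> K then mpoly_eval (F k) v else 0) \<in> coords K \<and>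
           g (pt v) = pt (\<lambda>k. if k \<in> K then mpoly_eval (F k) v else 0))"
      by (intro exI[of _ W] exI[of _ d] exI[of _ F]) simp
  qed
  show ?thesis using imp[of f g] imp[of g f] assms by auto
qed

lemma gform_subst:
  assumes "hform d f" "\<And>j. gform w w' a b (\<lambda>v. V v j)" "D = d * a" "E = d * b"
  shows "gform w w' D E (\<lambda>v. f (V v))"
proof -
  obtain F where F: "homogeneous d F" "f = mpoly_eval F" using assms(1) hform_iff by blast
  have "gform w w' D E (\<lambda>v. Poly_Mapping.lookup F m *
       (\<Prod>j\<in>Poly_Mapping.keys m. V v j ^ Poly_Mapping.lookup m j))"
    if "m \<in> Poly_Mapping.keys F" for m
  proof (rule gform_cmult, rule gform_prod)
    show "gform w w' (Poly_Mapping.lookup m j * a) (Poly_Mapping.lookup m j * b)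
      (\<lambda>v. V v j ^ Poly_Mapping.lookup m j)" for j
      by (rule gform_power[OF assms(2)]) auto
    have "d = (\<Sum>j\<in>Poly_Mapping.keys m. Poly_Mapping.lookup m j)"
      using F(1) that by (auto simp: homogeneous_def)
    then show "D = (\<Sum>j\<in>Poly_Mapping.keys m. Poly_Mapping.lookup m j * a)"
      "E = (\<Sum>j\<in>Poly_Mapping.keys m. Poly_Mapping.lookup m j * b)"
      using assms(3,4) by (simp_all add: sum_distrib_right)
  qed auto
  then show ?thesis unfolding F(2) mpoly_eval_def by (rule gform_sum)
qed

lemma biform_of_hform:
  assumes "hform e f"
  shows "biform 0 e (\<lambda>x. f (\<lambda>k. x (Inr k)))"
  by (rule gform_subst[OF assms biform_Inr]) auto

text \<open>The inversion that exchanges 0 and infinity. It relates the families of \<open>h\<close>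
  and \<open>-h\<close>, whose characters are inverse to each other.\<close>

definition P1_swap :: "bool point \<Rightarrow> bool point" where
  "P1_swap x = (\<lambda>v. v \<circ> Not) ` x"

lemma P1_swap_pt: "P1_swap (pt v) = pt (\<lambda>b. v (\<not> b))"
proof -
  have "P1_swap (pt v) = {(\<lambda>j. c * v j) \<circ> Not | c. c \<noteq> 0}"
    unfolding P1_swap_def pt_def by blast
  then show ?thesis by (simp add: pt_def comp_def)
qed

lemma coords_swap: "(\<lambda>b. v (\<not> b)) \<in> coords UNIV \<longleftrightarrow> v \<in> coords (UNIV :: bool set)"
  by (auto simp: coords_def fun_eq_iff all_bool_eq)

lemma P1_swap_swap [simp]: "x \<in> P1 \<Longrightarrow> P1_swap (P1_swap x) = x"
  by (auto simp: P1_def pspace_def P1_swap_pt)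

lemma P1_swap_in: "x \<in> P1 \<Longrightarrow> P1_swap x \<in> P1"
  by (auto simp: P1_def pspace_def P1_swap_pt image_iff coords_swap intro!: bexI[of _ "\<lambda>b. _ (\<not> b)"])

text \<open>Complements of nonempty open sets are finite, and the swap keeps finite sets
  finite.\<close>

lemma openin_P1_swap:
  assumes "openin (zariski UNIV) W"
  shows "openin (zariski UNIV) (P1_swap ` W)"
proof -
  have W: "W \<subseteq> P1" using openin_subset[OF assms] P1_topspace by blast
  have "P1 - P1_swap ` W = P1_swap ` (P1 - W)"
  proof (intro equalityI subsetI)
    fix x assume x: "x \<in> P1 - P1_swap ` W"
    then have "P1_swap x \<in> P1 - W" using P1_swap_in by (metis DiffD1 DiffD2 DiffI P1_swap_swap imageI)
    then show "x \<in> P1_swap ` (P1 - W)" using x by (metis DiffD1 P1_swap_swap imageI)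
  next
    fix x assume "x \<in> P1_swap ` (P1 - W)"
    then obtain y where "y \<in> P1" "y \<notin> W" "x = P1_swap y" by auto
    then show "x \<in> P1 - P1_swap ` W" using P1_swap_in W by (metis DiffI P1_swap_swap imageE subsetD)
  qed
  moreover have "closedin (zariski UNIV) (P1_swap ` (P1 - W))"
  proof (cases "W = {}")
    case True
    have "P1_swap ` P1 = P1"
    proof (intro equalityI subsetI)
      fix x assume "x \<in> P1" then show "x \<in> P1_swap ` P1" using P1_swap_in P1_swap_swap by (metis imageI)
    qed (auto intro: P1_swap_in)
    then show ?thesis using True closedin_P1 by simp
  next
    case False
    have "closedin (zariski UNIV) (P1 - W)"
      using assms by (intro closedin_diff closedin_P1)
    then have "finite (P1 - W)" using False W by (intro finite_closed_P1) auto
    then show ?thesis by (intro closedin_P1_finite) (auto intro: P1_swap_in)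
  qed
  moreover have "P1_swap ` W \<subseteq> P1" using W P1_swap_in by blast
  ultimately show ?thesis by (simp add: openin_closedin_eq flip: P1_def)
qed

lemma regular_map_swap_left:
  assumes "regular_map_on J D UNIV P1 f"
  shows "regular_map_on J D UNIV P1 (\<lambda>x. P1_swap (f x))"
  unfolding regular_map_on_hform
proof (intro conjI ballI)
  show "(\<lambda>x. P1_swap (f x)) ` D \<subseteq> P1" using assms P1_swap_in unfolding regular_map_on_hform by blast
  fix x assume "x \<in> D"
  then obtain W d F where "openin (subtopology (zariski J) D) W" "x \<in> W" "\<forall>k. hform d (F k)"
       "\<forall>v\<in>coords J. pt v \<in> W \<longrightarrow> (\<lambda>k. F k v) \<in> coords UNIV \<and> f (pt v) = pt (\<lambda>k. F k v)"
    using assms unfolding regular_map_on_hform by force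
  then show "\<exists>W d F. openin (subtopology (zariski J) D) W \<and> x \<in> W \<and> (\<forall>k. hform d (F k)) \<and>
        (\<forall>v\<in>coords J. pt v \<in> W \<longrightarrow>
           (\<lambda>k. if k \<in> UNIV then F k v else 0) \<in> coords UNIV \<and>
           P1_swap (f (pt v)) = pt (\<lambda>k. if k \<in> UNIV then F k v else 0))"
    by (intro exI[of _ W] exI[of _ d] exI[of _ "\<lambda>k. F (\<not> k)"])
      (auto simp: P1_swap_pt coords_swap[of "\<lambda>k. F k _"])
qed

lemma regular_map_swap_right:
  assumes "regular_map_on UNIV P1 K Y f"
  shows "regular_map_on UNIV P1 K Y (\<lambda>x. f (P1_swap x))"
  unfolding regular_map_on_hform
proof (intro conjI ballI)
  show "(\<lambda>x. f (P1_swap x)) ` P1 \<subseteq> Y" using assms P1_swap_in unfolding regular_map_on_hform by blast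
  fix x assume x: "x \<in> P1"
  then obtain W d F where W: "openin (zariski UNIV) W" "P1_swap x \<in> W" "\<forall>k. hform d (F k)"
       "\<forall>v\<in>coords UNIV. pt v \<in> W \<longrightarrow> (\<lambda>k. if k \<in> K then F k v else 0) \<in> coords K \<and>
         f (pt v) = pt (\<lambda>k. if k \<in> K then F k v else 0)"
    using assms P1_swap_in[OF x]
    unfolding regular_map_on_hform P1_topspace[symmetric] subtopology_topspace by blast
  have sub: "hform d (\<lambda>v. F k (\<lambda>b. v (\<not> b)))" for k
    by (rule gform_subst) (use W(3) in \<open>auto intro: hform_coord\<close>)
  have mem: "pt (\<lambda>b. v (\<not> b)) \<in> W" if v: "pt v \<in> P1_swap ` W" for v
  proof -
    obtain y where "y \<in> W" "pt v = P1_swap y" using v by blast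
    then show ?thesis using openin_subset[OF W(1)] P1_swap_swap[of y] unfolding P1_topspace P1_swap_pt[symmetric]
      by auto
  qed
  show "\<exists>W d F. openin (subtopology (zariski UNIV) P1) W \<and> x \<in> W \<and> (\<forall>k. hform d (F k)) \<and>
        (\<forall>v\<in>coords UNIV. pt v \<in> W \<longrightarrow>
           (\<lambda>k. if k \<in> K then F k v else 0) \<in> coords K \<and>
           f (P1_swap (pt v)) = pt (\<lambda>k. if k \<in> K then F k v else 0))"
    unfolding P1_topspace[symmetric] subtopology_topspace
    using openin_P1_swap[OF W(1)] W(2,4) sub mem x
    by (intro exI[of _ "P1_swap ` W"] exI[of _ d] exI[of _ "\<lambda>k v. F k (\<lambda>b. v (\<not> b))"])
      (auto simp: P1_swap_pt coords_swap image_iff intro!: bexI[of _ "P1_swap x"])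
qed

lemma curve_isomorphism_swap_right:
  assumes "curve_isomorphism UNIV P1 UNIV P1 g"
  shows "curve_isomorphism UNIV P1 UNIV P1 (\<lambda>x. g (P1_swap x))"
proof -
  have g: "bij_betw g P1 P1" "regular_map_on UNIV P1 UNIV P1 g" "regular_map_on UNIV P1 UNIV P1 (inv_into P1 g)"
    using assms by (auto simp: curve_isomorphism_def)
  have sw: "bij_betw P1_swap P1 P1"
    by (rule bij_betw_byWitness[of _ P1_swap]) (auto intro: P1_swap_in)
  have bij: "bij_betw (\<lambda>x. g (P1_swap x)) P1 P1"
    using bij_betw_trans[OF sw g(1)] by (simp add: comp_def)
  have inv: "inv_into P1 (\<lambda>x. g (P1_swap x)) y = P1_swap (inv_into P1 g y)" if "y \<in> P1" for y
  proof (rule inv_into_f_eq)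
    show "inj_on (\<lambda>x. g (P1_swap x)) P1" using bij by (simp add: bij_betw_def)
    have i: "inv_into P1 g y \<in> P1" using g(1) that by (simp add: bij_betw_def inv_into_into)
    then show "P1_swap (inv_into P1 g y) \<in> P1" by (rule P1_swap_in)
    show "g (P1_swap (P1_swap (inv_into P1 g y))) = y"
      using i g(1) that by (simp add: bij_betw_inv_into_right)
  qed
  show ?thesis
    unfolding curve_isomorphism_def
    using bij regular_map_swap_right[OF g(2)] regular_map_swap_left[OF g(3)]
      regular_map_on_cong[of P1 "inv_into P1 (\<lambda>x. g (P1_swap x))" "\<lambda>y. P1_swap (inv_into P1 g y)"] inv
    by auto
qed

lemma curve_isomorphism_id: "curve_isomorphism UNIV P1 UNIV P1 (\<lambda>x. x)"
proof -
  have r: "regular_map_on UNIV P1 UNIV P1 (\<lambda>x. x)"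
    unfolding regular_map_on_hform P1_topspace[symmetric] subtopology_topspace
  proof (intro conjI ballI)
    fix x assume x: "x \<in> topspace (zariski (UNIV :: bool set))"
    show "\<exists>W d F. openin (zariski UNIV) W \<and> x \<in> W \<and> (\<forall>k::bool. hform d (F k)) \<and>
        (\<forall>v\<in>coords UNIV. pt v \<in> W \<longrightarrow> (\<lambda>k. if k \<in> UNIV then F k v else 0) \<in> coords UNIV \<and>
           pt v = pt (\<lambda>k. if k \<in> UNIV then F k v else 0))"
      using x by (intro exI[of _ "topspace (zariski (UNIV :: bool set))"] exI[of _ 1] exI[of _ "\<lambda>k v. v k"])
        (auto intro!: hform_coord simp del: topspace_zariski)
  qed auto
  have "inv_into P1 (\<lambda>x. x) y = y" if "y \<in> P1" for y
    using that by (intro inv_into_f_eq) (auto simp: inj_on_def)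
  then show ?thesis
    unfolding curve_isomorphism_def
    using r regular_map_on_cong[of P1 "inv_into P1 (\<lambda>x. x)" "\<lambda>y. y"] by (auto simp: bij_betw_def)
qed

section \<open>Lattice points of a polygon\<close>

text \<open>For \<open>q = (- n, m)\<close> the function \<open>cross q\<close> is the negative of
  the viewangle \<open>(m, n)\<close>; for primitive \<open>q\<close> its zeros are the multiples of
  \<open>q\<close>. It also pairs an exponent \<open>p\<close> with the one-parameter subgroup
  \<open>(- snd w, fst w)\<close> attached to a direction \<open>w\<close>.\<close>

definition cross :: "int \<times> int \<Rightarrow> int \<times> int \<Rightarrow> int" where
  "cross d e = fst d * snd e - snd d * fst e"

definition mon :: "complex \<times> complex \<Rightarrow> int \<times> int \<Rightarrow> complex" where
  "mon c p = fst c powi fst p * snd c powi snd p"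

lemma mon_nonzero [simp]: "c \<in> torus2 \<Longrightarrow> mon c p \<noteq> 0"
  by (auto simp: mon_def torus2_def)

lemma mon_add: "c \<in> torus2 \<Longrightarrow> mon c (p + q) = mon c p * mon c q"
  by (auto simp: mon_def torus2_def power_int_add mem_Times_iff)

lemma mon_minus: "mon c (- p) = inverse (mon c p)"
  by (auto simp: mon_def power_int_minus)

lemma mon_diff: "c \<in> torus2 \<Longrightarrow> mon c (p - q) = mon c p / mon c q"
  using mon_add[of c p "- q"] by (simp add: mon_minus divide_inverse)

lemma mon_zero [simp]: "mon c 0 = 1"
  by (simp add: mon_def)

lemma mon_scale: "c \<in> torus2 \<Longrightarrow> mon c (k * a, k * b) = mon c (a, b) powi k"
  by (auto simp: mon_def torus2_def power_int_mult power_int_mult_distrib mult.commute[of k])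

lemma mon_mult: "mon (s * s', t * t') p = mon (s, t) p * mon (s', t') p"
  by (simp add: mon_def power_int_mult_distrib)

text \<open>Multisets of lattice points, given as lists, stand for monomials in the homogeneous
  coordinates.\<close>

definition lsum :: "(int \<times> int) list \<Rightarrow> int \<times> int" where
  "lsum l = (sum_list (map fst l), sum_list (map snd l))"

lemma lsum_simps [simp]:
  "lsum [] = 0" "lsum (p # l) = p + lsum l" "lsum (l @ l') = lsum l + lsum l'"
  "lsum (replicate n p) = (int n * fst p, int n * snd p)"
  by (auto simp: lsum_def zero_prod_def plus_prod_def map_replicate sum_list_replicate)

definition vm :: "('k \<Rightarrow> complex) \<Rightarrow> 'k list \<Rightarrow> complex" where
  "vm v l = prod_list (map v l)"

lemma vm_simps [simp]:
  "vm v [] = 1" "vm v (p # l) = v p * vm v l" "vm v (l @ l') = vm v l * vm v l'"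
  "vm v (replicate n p) = v p ^ n"
  by (auto simp: vm_def map_replicate prod_list_replicate)

lemma vm_scale: "vm (\<lambda>p. c * v p) l = c ^ length l * vm v l"
  by (induction l) auto

lemma vm_mult: "vm (\<lambda>p. v p * w p) l = vm v l * vm w l"
  by (induction l) auto

lemma vm_cong: "(\<And>p. p \<in> set l \<Longrightarrow> v p = w p) \<Longrightarrow> vm v l = vm w l"
  by (induction l) auto

lemma vm_mon: "c \<in> torus2 \<Longrightarrow> vm (mon c) l = mon c (lsum l)"
  by (induction l) (auto simp: mon_add)

lemma hform_vm: "hform (length l) (\<lambda>v. vm v l)"
  unfolding vm_def by (rule gform_prod_list) (auto intro: hform_coord)

text \<open>Cramer's rule in the lattice basis \<open>w\<close>, \<open>w'\<close>.\<close>

lemma unimodular_expansion: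
  assumes "cross w w' = 1"
  shows "d = (cross d w' * fst w + cross w d * fst w', cross d w' * snd w + cross w d * snd w')"
proof -
  have "cross d w' * fst w + cross w d * fst w' = fst d * cross w w'"
    "cross d w' * snd w + cross w d * snd w' = snd d * cross w w'"
    by (auto simp: cross_def algebra_simps)
  then show ?thesis using assms by (simp add: prod_eq_iff)
qed

lemma primitive_complement:
  fixes w :: "int \<times> int"
  assumes "gcd (fst w) (snd w) = 1"
  obtains w' where "cross w w' = 1"
proof -
  obtain a b where "a * fst w + b * snd w = 1"
    using bezout_int[of "fst w" "snd w"] assms by auto
  then have "cross w (- b, a) = 1" by (auto simp: cross_def algebra_simps)
  then show ?thesis by (rule that)
qed

lemma mon_unimodular_surj:
  assumes "cross w w' = 1" "a \<noteq> 0" "b \<noteq> 0"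
  obtains c where "c \<in> torus2" "mon c w = a" "mon c w' = b"
proof -
  \<comment> \<open>The exponents are the rows of the inverse of the matrix with rows
    \<open>w\<close> and \<open>w'\<close>, which is integral because the determinant is 1.\<close>
  define c where "c = (mon (a, b) (snd w', - snd w), mon (a, b) (- fst w', fst w))"
  have ab: "(a, b) \<in> torus2" using assms by (auto simp: torus2_def)
  then have c: "c \<in> torus2" unfolding c_def by (simp add: torus2_def[of])
  have key: "mon c p = mon (a, b) (fst p * snd w' + snd p * - fst w', fst p * - snd w + snd p * fst w)" for p
  proof -
    have "mon c p = mon (a, b) (snd w', - snd w) powi fst p * mon (a, b) (- fst w', fst w) powi snd p"
      unfolding mon_def[of c p] by (simp add: c_def)
    also have "\<dots> = mon (a, b) ((fst p * snd w', fst p * - snd w) + (snd p * - fst w', snd p * fst w))"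
      by (simp only: mon_add[OF ab] mon_scale[OF ab])
    finally show ?thesis by (simp only: add_Pair)
  qed
  have 1: "(fst w * snd w' + snd w * - fst w', fst w * - snd w + snd w * fst w) = (1, 0)"
    "(fst w' * snd w' + snd w' * - fst w', fst w' * - snd w + snd w' * fst w) = (0, 1)"
    using assms(1) by (auto simp: cross_def algebra_simps)
  have "mon c w = a" "mon c w' = b"
    unfolding key 1 by (simp_all add: mon_def)
  then show ?thesis using c that by blast
qed

text \<open>The characters with exponents \<open>w\<close> and \<open>w'\<close> generate all
  characters, in particular the two coordinates of the torus.\<close>

lemma mon_unimodular_inj:
  assumes "cross w w' = 1" "c \<in> torus2" "c' \<in> torus2" "mon c w = mon c' w" "mon c w' = mon c' w'"
  shows "c = c'"
proof -
  have "mon c d = mon c' d" for d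
  proof -
    have d: "d = (cross d w' * fst w, cross d w' * snd w) + (cross w d * fst w', cross w d * snd w')"
      using unimodular_expansion[OF assms(1), of d] by (simp add: add_Pair)
    have "mon c d = mon c w powi cross d w' * mon c w' powi cross w d" if "c \<in> torus2" for c
      by (subst d) (simp only: mon_add[OF that] mon_scale[OF that] prod.collapse)
    then show ?thesis using assms by simp
  qed
  from this[of "(1, 0)"] this[of "(0, 1)"] show ?thesis by (simp add: mon_def prod_eq_iff)
qed

lemma cross_eq_0_multiple:
  assumes "gcd (fst q) (snd q) = 1" "cross q d = 0"
  obtains k where "d = (k * fst q, k * snd q)"
proof -
  obtain q' where q': "cross q q' = 1" using primitive_complement[OF assms(1)] by blast
  then show ?thesis using unimodular_expansion[OF q', of d] assms(2) that by simp
qed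

lemma cross_arith:
  "cross w (p + p') = cross w p + cross w p'" "cross w (p - p') = cross w p - cross w p'"
  "cross (w + w') p = cross w p + cross w' p" "cross (w - w') p = cross w p - cross w' p"
  "cross (- w) p = - cross w p" "cross w (- p) = - cross w p" "cross w w = 0" "cross w 0 = 0"
  "cross w (k * a, k * b) = k * cross w (a, b)" "cross (k * a, k * b) p = k * cross (a, b) p"
  by (auto simp: cross_def algebra_simps)

lemma cross_commute: "cross w p = - cross p w"
  by (simp add: cross_def)

section \<open>Primitive steps and unimodular triangles\<close>

locale polygon =
  fixes \<Gamma> :: "(real \<times> real) set"
  assumes polygon: "lattice_polygon \<Gamma>"
begin

abbreviation "A \<equiv> lattice_points \<Gamma>"
abbreviation "X \<equiv> toric_surface \<Gamma>"
abbreviation "TT \<equiv> dense_torus \<Gamma>"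

lemma hull:
  obtains S where "finite S" "S \<subseteq> A" "S \<noteq> {}"
    "\<Gamma> = convex hull ((\<lambda>p. (real_of_int (fst p), real_of_int (snd p))) ` S)"
proof -
  obtain B where B: "finite B" "B \<subseteq> \<int> \<times> \<int>" "\<Gamma> = convex hull B" and dim: "aff_dim \<Gamma> = 2"
    using polygon by (auto simp: lattice_polygon_def)
  define S where "S = {p. (real_of_int (fst p), real_of_int (snd p)) \<in> B}"
  have im: "(\<lambda>p. (real_of_int (fst p), real_of_int (snd p))) ` S = B"
  proof (intro equalityI subsetI)
    fix x assume x: "x \<in> B"
    then obtain a b where "x = (real_of_int a, real_of_int b)" using B(2) by (auto elim!: Ints_cases)
    then show "x \<in> (\<lambda>p. (real_of_int (fst p), real_of_int (snd p))) ` S"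
      using x by (auto simp: S_def image_iff intro!: exI[of _ a] exI[of _ b])
  qed (auto simp: S_def)
  have "finite S"
    using B(1) unfolding im[symmetric] by (rule finite_imageD) (auto simp: inj_on_def prod_eq_iff)
  moreover have "S \<subseteq> A" using hull_subset[of B convex] by (auto simp: S_def lattice_points_def B(3))
  moreover have "S \<noteq> {}" using dim B(3) im by auto
  ultimately show ?thesis using that im B(3) by metis
qed

lemma finite_A: "finite A"
proof -
  obtain B where "finite B" "\<Gamma> = convex hull B" using polygon by (auto simp: lattice_polygon_def)
  then have "bounded \<Gamma>" by (simp add: finite_imp_bounded bounded_convex_hull)
  then obtain K where K: "\<And>x. x \<in> \<Gamma> \<Longrightarrow> norm x \<le> K" by (auto simp: bounded_iff)
  have "A \<subseteq> {- \<lceil>K\<rceil>..\<lceil>K\<rceil>} \<times> {- \<lceil>K\<rceil>..\<lceil>K\<rceil>}"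
  proof
    fix p assume p: "p \<in> A"
    then have "norm (real_of_int (fst p), real_of_int (snd p)) \<le> K"
      by (intro K) (auto simp: lattice_points_def)
    then have "norm (real_of_int (fst p)) \<le> K" "norm (real_of_int (snd p)) \<le> K"
      using norm_fst_le[of "real_of_int (fst p)" "real_of_int (snd p)"]
        norm_snd_le[of "real_of_int (snd p)" "real_of_int (fst p)"] by auto
    then have "real_of_int \<bar>fst p\<bar> \<le> real_of_int \<lceil>K\<rceil>" "real_of_int \<bar>snd p\<bar> \<le> real_of_int \<lceil>K\<rceil>"
      using le_of_int_ceiling[of K] by (simp_all, linarith+)
    then have "\<bar>fst p\<bar> \<le> \<lceil>K\<rceil>" "\<bar>snd p\<bar> \<le> \<lceil>K\<rceil>" by (simp_all only: of_int_le_iff)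
    then show "p \<in> {- \<lceil>K\<rceil>..\<lceil>K\<rceil>} \<times> {- \<lceil>K\<rceil>..\<lceil>K\<rceil>}" by (cases p) auto
  qed
  then show ?thesis by (rule finite_subset) auto
qed

text \<open>Convexity in integral form: the multiplicities in the list act as rational barycentric
  weights, so that later constructions of lattice points reduce to integer arithmetic.\<close>

lemma average_in_A:
  assumes l: "set l \<subseteq> A" "l \<noteq> []" and avg: "lsum l = (int (length l) * fst p, int (length l) * snd p)"
  shows "p \<in> A"
proof -
  let ?r = "\<lambda>p. (real_of_int (fst p), real_of_int (snd p))"
  have "convex \<Gamma>" using polygon by (auto simp: lattice_polygon_def)
  then have "(\<Sum>i<length l. (1 / real (length l)) *\<^sub>R ?r (l ! i)) \<in> \<Gamma>"
  proof (rule convex_sum[rotated])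
    show "?r (l ! i) \<in> \<Gamma>" if "i \<in> {..<length l}" for i
    proof -
      have "l ! i \<in> A" using that l(1) nth_mem by fastforce
      then show ?thesis by (auto simp: lattice_points_def)
    qed
  qed (use l in auto)
  also have "(\<Sum>i<length l. (1 / real (length l)) *\<^sub>R ?r (l ! i)) = ?r p"
  proof -
    have sl: "(\<Sum>i<length l. real_of_int (f (l ! i))) = real_of_int (sum_list (map f l))" for f :: "int \<times> int \<Rightarrow> int"
      by (simp add: sum_list_sum_nth atLeast0LessThan)
    have "(\<Sum>i<length l. real_of_int (fst (l ! i))) = real (length l) * fst p"
      "(\<Sum>i<length l. real_of_int (snd (l ! i))) = real (length l) * snd p"
      unfolding sl using avg by (simp_all add: lsum_def)
    then show ?thesis
      using l(2) unfolding scaleR_right.sum[symmetric]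
      by (simp add: prod_eq_iff fst_sum snd_sum)
  qed
  finally show ?thesis by (cases p) (simp add: lattice_points_def)
qed

text \<open>Otherwise all points of the spanning set \<open>S\<close>, and with them the polygon,
  lie on one line, against dimension two.\<close>

lemma noncollinear:
  obtains e0 e1 e2 where "e0 \<in> A" "e1 \<in> A" "e2 \<in> A" "cross (e1 - e0) (e2 - e0) \<noteq> 0"
proof (rule ccontr)
  assume *: "\<not> thesis"
  let ?r = "\<lambda>p. (real_of_int (fst p), real_of_int (snd p))"
  obtain S where S: "finite S" "S \<subseteq> A" "S \<noteq> {}" "\<Gamma> = convex hull (?r ` S)" by (rule hull)
  have dim: "aff_dim \<Gamma> = 2" using polygon by (auto simp: lattice_polygon_def)
  obtain e0 where e0: "e0 \<in> S" using S by auto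
  show False
  proof (cases "\<exists>e1\<in>S. e1 \<noteq> e0")
    case False
    then have "S = {e0}" using e0 by blast
    then have "aff_dim \<Gamma> = 0" using S(4) by simp
    then show False using dim by simp
  next
    case True
    then obtain e1 where e1: "e1 \<in> S" "e1 \<noteq> e0" by auto
    define a where "a = (real_of_int (- snd (e1 - e0)), real_of_int (fst (e1 - e0)))"
    define b where "b = a \<bullet> ?r e0"
    have "?r ` S \<subseteq> {x. a \<bullet> x = b}"
    proof
      fix x assume "x \<in> ?r ` S"
      then obtain p where p: "p \<in> S" "x = ?r p" by auto
      then have "cross (e1 - e0) (p - e0) = 0" using * that S(2) e0 e1 by blast
      then have "real_of_int (cross (e1 - e0) (p - e0)) = 0" by simp
      then show "x \<in> {x. a \<bullet> x = b}"
        using p(2) by (simp add: a_def b_def cross_def algebra_simps)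
    qed
    then have "\<Gamma> \<subseteq> {x. a \<bullet> x = b}"
      unfolding S(4) by (intro hull_minimal) (auto simp: convex_hyperplane)
    moreover have "a \<noteq> 0"
      using e1(2) by (auto simp: a_def prod_eq_iff)
    then have "aff_dim {x. a \<bullet> x = b} = 1"
      by (simp add: aff_dim_hyperplane)
    ultimately show False using aff_dim_subset[of \<Gamma> "{x. a \<bullet> x = b}"] dim by simp
  qed
qed

lemma primitive_step:
  assumes "j0 \<in> A" "j1 \<in> A" "j0 \<noteq> j1"
  obtains w g where "g \<ge> 1" "gcd (fst w) (snd w) = 1" "j0 + w \<in> A" "j1 - j0 = (g * fst w, g * snd w)"
proof -
  define d where "d = j1 - j0"
  define g where "g = gcd (fst d) (snd d)"
  define w where "w = (fst d div g, snd d div g)"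
  have "d \<noteq> 0" using assms(3) by (simp add: d_def)
  then have g: "g > 0" by (auto simp: g_def prod_eq_iff)
  have dw: "d = (g * fst w, g * snd w)" by (simp add: w_def g_def)
  have prim: "gcd (fst w) (snd w) = 1"
    unfolding w_def g_def fst_conv snd_conv using \<open>d \<noteq> 0\<close> by (intro div_gcd_coprime[THEN coprime_imp_gcd_eq_1]) (auto simp: prod_eq_iff)
  have "j0 + w \<in> A"
  \<comment> \<open>One copy of \<open>j1\<close> and \<open>g - 1\<close> copies of
    \<open>j0\<close> have mean \<open>j0 + (j1 - j0) / g\<close>.\<close>
  proof (rule average_in_A[of "j1 # replicate (nat (g - 1)) j0"])
    have "j1 = j0 + (g * fst w, g * snd w)" unfolding dw[symmetric] by (simp add: d_def)
    then show "lsum (j1 # replicate (nat (g - 1)) j0) =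
      (int (length (j1 # replicate (nat (g - 1)) j0)) * fst (j0 + w), int (length (j1 # replicate (nat (g - 1)) j0)) * snd (j0 + w))"
      using g by (simp add: prod_eq_iff algebra_simps)
  qed (use assms in auto)
  then show ?thesis using that[of g w] g prim dw by (simp add: d_def)
qed

text \<open>The triangle spanned by a primitive edge and a point at height \<open>k \<ge> 1\<close> meets the line at height 1
  in an interval of length \<open>(k - 1) / k\<close> with an end point in \<open>\<int> / k\<close>, which contains a lattice point.\<close>

lemma height_one:
  assumes "e0 \<in> A" "e0 + w \<in> A" "p \<in> A" "gcd (fst w) (snd w) = 1" "cross w (p - e0) \<ge> 1"
  obtains r where "e0 + r \<in> A" "cross w r = 1"
proof -
  obtain w' where w': "cross w w' = 1" using primitive_complement[OF assms(4)] by blast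
  define k where "k = cross w (p - e0)"
  define c where "c = cross (p - e0) w'"
  \<comment> \<open>\<open>a\<close> is the ceiling of \<open>c / k\<close>, so that the defect
    \<open>m = k * a - c\<close> lies between 0 and \<open>k - 1\<close> and can serve as a
    multiplicity.\<close>
  define a where "a = - (- c div k)"
  define m where "m = k * a - c"
  have k: "k \<ge> 1" using assms(5) by (simp add: k_def)
  have m: "m = (- c) mod k" by (simp add: m_def a_def minus_div_mult_eq_mod[symmetric] algebra_simps)
  then have m0: "0 \<le> m" "m < k" using k by auto
  define r where "r = (a * fst w + fst w', a * snd w + snd w')"
  have p: "p = e0 + (c * fst w + k * fst w', c * snd w + k * snd w')"
    using unimodular_expansion[OF w', of "p - e0"] by (simp add: c_def k_def algebra_simps)
  \<comment> \<open>These \<open>k\<close> points have mean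
    \<open>e0 + ((c + m) / k) w + w'\<close>, and \<open>c + m = k * a\<close>.\<close>
  let ?l = "p # replicate (nat m) (e0 + w) @ replicate (nat (k - 1 - m)) e0"
  have "e0 + r \<in> A"
  proof (rule average_in_A[of ?l])
    have len: "int (length ?l) = k" using m0 by simp
    have ca: "k * a = c + m" by (simp add: m_def)
    have "lsum ?l = (k * fst (e0 + r), k * snd (e0 + r))"
    proof -
      have *: "a * (k * x) = c * x + m * x" for x
        using arg_cong[OF ca, of "\<lambda>y. y * x"] by (simp add: algebra_simps)
      show ?thesis using m0 p *[of "fst w"] *[of "snd w"] by (simp add: r_def prod_eq_iff algebra_simps)
    qed
    then show "lsum ?l = (int (length ?l) * fst (e0 + r), int (length ?l) * snd (e0 + r))"
      by (simp only: len)
  qed (use assms in auto)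
  moreover have "cross w r = 1" using w' by (simp add: r_def cross_def algebra_simps)
  ultimately show ?thesis by (rule that)
qed

text \<open>A primitive step and a lattice point at height one above it; if the third point lies on
  the negative side, the step is traversed backwards from \<open>e0 + w\<close>. The coordinates at
  the three corners detect and determine torus points.\<close>

lemma unimodular_triangle:
  obtains e w w' where "e \<in> A" "e + w \<in> A" "e + w' \<in> A" "cross w w' = 1"
proof -
  obtain e0 e1 e2 where e: "e0 \<in> A" "e1 \<in> A" "e2 \<in> A" "cross (e1 - e0) (e2 - e0) \<noteq> 0"
    by (rule noncollinear)
  then have "e0 \<noteq> e1" by (auto simp: cross_def)
  then obtain w g where w: "g \<ge> 1" "gcd (fst w) (snd w) = 1" "e0 + w \<in> A" "e1 - e0 = (g * fst w, g * snd w)"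
    by (rule primitive_step[OF e(1,2)])
  have "cross (e1 - e0) (e2 - e0) = g * cross w (e2 - e0)"
    unfolding w(4) by (simp add: cross_def algebra_simps)
  then consider "cross w (e2 - e0) \<ge> 1" | "cross w (e2 - e0) \<le> -1" using e(4) by fastforce
  then show ?thesis
  proof cases
    case 1
    obtain r where "e0 + r \<in> A" "cross w r = 1" by (rule height_one[OF e(1) w(3) e(3) w(2) 1])
    then show ?thesis by (rule that[OF e(1) w(3)])
  next
    case 2
    have "cross (- w) (e2 - (e0 + w)) = - cross w (e2 - e0)"
      by (simp add: cross_def algebra_simps)
    then have *: "e0 + w + - w \<in> A" "gcd (fst (- w)) (snd (- w)) = 1" "cross (- w) (e2 - (e0 + w)) \<ge> 1"
      using e(1) w(2) 2 by auto
    obtain r where "e0 + w + r \<in> A" "cross (- w) r = 1" by (rule height_one[OF w(3) *(1) e(3) *(2,3)])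
    then show ?thesis by (rule that[OF w(3) *(1)])
  qed
qed

section \<open>Torus points and the binomial equations of the surface\<close>

definition tvec :: "complex \<times> complex \<Rightarrow> int \<times> int \<Rightarrow> complex" where
  "tvec c = (\<lambda>p. if p \<in> A then mon c p else 0)"

lemma torus_point_eq: "torus_point \<Gamma> c = pt (tvec c)"
  by (auto simp: torus_point_def tvec_def mon_def split: prod.splits intro!: arg_cong[of _ _ pt])

lemma A_nonempty: "A \<noteq> {}"
  using unimodular_triangle by blast

lemma tvec_coords: "c \<in> torus2 \<Longrightarrow> tvec c \<in> coords A"
  using A_nonempty by (auto simp: coords_def tvec_def fun_eq_iff)

lemma vm_tvec: "set l \<subseteq> A \<Longrightarrow> c \<in> torus2 \<Longrightarrow> vm (tvec c) l = mon c (lsum l)"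
  using vm_cong[of l "tvec c" "mon c"] vm_mon[of c l] by (simp add: tvec_def subset_iff del: split_paired_All)

lemma TT_subset_X: "TT \<subseteq> X"
  unfolding toric_surface_def
  by (rule closure_of_subset) (auto simp: dense_torus_def torus_point_eq pt_in_pspace_iff tvec_coords)

lemma closedin_X: "closedin (zariski A) X"
  by (simp add: toric_surface_def)

lemma X_subset: "X \<subseteq> pspace A"
  using closedin_subset[OF closedin_X] by simp

lemma pt_X_coords: "pt v \<in> X \<Longrightarrow> v \<in> coords A"
  using X_subset pt_in_pspace_iff by blast

lemma hform_vanish_X:
  assumes "hform d f" "\<And>c. c \<in> torus2 \<Longrightarrow> f (tvec c) = 0" "pt v \<in> X"
  shows "f v = 0"
proof -
  have "f u = 0" if u: "u \<in> coords A" "pt u \<in> TT" for u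
  proof -
    obtain c where c: "c \<in> torus2" "pt (tvec c) = pt u" using u by (auto simp: dense_torus_def torus_point_eq)
    then obtain a where "u = (\<lambda>j. a * tvec c j)" by (auto simp: pt_eq_iff)
    then show ?thesis using hform_scale[OF assms(1)] assms(2)[OF c(1)] by simp
  qed
  then show ?thesis
    using assms(1,3) in_zariski_closure_iff[OF pt_X_coords[OF assms(3)], of TT]
    unfolding toric_surface_def by blast
qed

text \<open>\<open>x\<^sup>l / x\<^sup>l'\<close> is the \<open>k\<close>-th power of the character with exponent \<open>q\<close>.\<close>

definition bal :: "int \<times> int \<Rightarrow> nat \<Rightarrow> (int \<times> int) list \<Rightarrow> (int \<times> int) list \<Rightarrow> bool" where
  "bal q k l l' \<longleftrightarrow> set l \<subseteq> A \<and> set l' \<subseteq> A \<and> length l = length l' \<and>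
     lsum l = lsum l' + (int k * fst q, int k * snd q)"

text \<open>The binomial equations satisfied by all points of \<open>X\<close>. They are put to use
  in two ways: to recover torus points (\<open>toric_point\<close>) and to compare coordinates along
  an edge (\<open>face_in_closed\<close>).\<close>

definition toric :: "(int \<times> int \<Rightarrow> complex) \<Rightarrow> bool" where
  "toric v \<longleftrightarrow> (\<forall>l l'. set l \<subseteq> A \<longrightarrow> set l' \<subseteq> A \<longrightarrow> length l = length l' \<longrightarrow> lsum l = lsum l' \<longrightarrow> vm v l = vm v l')"

lemma toric_X:
  assumes "pt v \<in> X"
  shows "toric v"
  unfolding toric_def
proof (intro allI impI)
  fix l l' assume l: "set l \<subseteq> A" "set l' \<subseteq> A" "length l = length l'" "lsum l = lsum l'"
  have "vm v l - vm v l' = 0"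
  proof (rule hform_vanish_X[OF _ _ assms])
    show "hform (length l) (\<lambda>v. vm v l - vm v l')"
      using hform_vm[of l] hform_vm[of l'] l(3) by (intro gform_diff) auto
  qed (use l in \<open>simp add: vm_tvec\<close>)
  then show "vm v l = vm v l'" by simp
qed

lemma toricD:
  "toric v \<Longrightarrow> set l \<subseteq> A \<Longrightarrow> set l' \<subseteq> A \<Longrightarrow> length l = length l' \<Longrightarrow> lsum l = lsum l' \<Longrightarrow> vm v l = vm v l'"
  unfolding toric_def by blast

text \<open>The coordinates at the corners of the triangle fix \<open>c\<close> and the scalar. Any
  other coordinate is then forced, because \<open>p\<close> is an integral affine combination of the
  corners, which is a binomial relation once negative coefficients are moved to the other
  side.\<close>

lemma toric_point:
  assumes v: "toric v" and e: "e \<in> A" "e + w \<in> A" "e + w' \<in> A" "cross w w' = 1"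
    and nz: "v e \<noteq> 0" "v (e + w) \<noteq> 0" "v (e + w') \<noteq> 0"
  obtains a c where "c \<in> torus2" "a \<noteq> 0" "\<And>p. p \<in> A \<Longrightarrow> v p = a * mon c p"
proof -
  define x y where "x = v (e + w) / v e" and "y = v (e + w') / v e"
  have "x \<noteq> 0" "y \<noteq> 0" using nz by (auto simp: x_def y_def)
  then obtain c where c: "c \<in> torus2" "mon c w = x" "mon c w' = y"
    by (rule mon_unimodular_surj[OF e(4)])
  have "v p = v e / mon c e * mon c p" if p: "p \<in> A" for p
  proof -
    define \<alpha> \<beta> where "\<alpha> = cross (p - e) w'" and "\<beta> = cross w (p - e)"
    have pe: "p - e = (\<alpha> * fst w, \<alpha> * snd w) + (\<beta> * fst w', \<beta> * snd w')"
      using unimodular_expansion[OF e(4), of "p - e"] by (simp add: \<alpha>_def \<beta>_def)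
    \<comment> \<open>Positive and negative parts of the coefficients, since multiplicities in a
      list are nonnegative; the copies of \<open>e\<close> make the two lengths equal.\<close>
    define a1 a2 b1 b2 where ab: "a1 = nat \<alpha>" "a2 = nat (- \<alpha>)" "b1 = nat \<beta>" "b2 = nat (- \<beta>)"
    have \<alpha>: "\<alpha> = int a1 - int a2" "\<beta> = int b1 - int b2" by (auto simp: ab)
    have "vm v (p # replicate a2 (e + w) @ replicate b2 (e + w') @ replicate (a1 + b1) e) =
      vm v (e # replicate a1 (e + w) @ replicate b1 (e + w') @ replicate (a2 + b2) e)"
    proof (rule toricD[OF v])
      have "p = e + ((\<alpha> * fst w, \<alpha> * snd w) + (\<beta> * fst w', \<beta> * snd w'))" using pe by (simp add: algebra_simps)
      then show "lsum (p # replicate a2 (e + w) @ replicate b2 (e + w') @ replicate (a1 + b1) e) =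
        lsum (e # replicate a1 (e + w) @ replicate b1 (e + w') @ replicate (a2 + b2) e)"
        by (simp add: \<alpha> prod_eq_iff algebra_simps)
    qed (use p e in auto)
    then have "v p * ((x * v e) ^ a2 * (y * v e) ^ b2 * v e ^ (a1 + b1)) =
       v e * ((x * v e) ^ a1 * (y * v e) ^ b1 * v e ^ (a2 + b2))"
      using nz by (simp add: x_def y_def mult.assoc)
    then have "(v e ^ (a1 + a2 + b1 + b2)) * (v p * (x ^ a2 * y ^ b2)) = (v e ^ (a1 + a2 + b1 + b2)) * (v e * (x ^ a1 * y ^ b1))"
      by (simp add: power_mult_distrib power_add algebra_simps)
    then have "v p * (x ^ a2 * y ^ b2) = v e * (x ^ a1 * y ^ b1)" using nz by simp
    moreover have "x powi \<alpha> = x ^ a1 / x ^ a2" "y powi \<beta> = y ^ b1 / y ^ b2"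
      using \<open>x \<noteq> 0\<close> \<open>y \<noteq> 0\<close> by (auto simp: \<alpha> power_int_diff)
    ultimately have "v p * (x ^ a2 * y ^ b2) = (v e * (x powi \<alpha> * y powi \<beta>)) * (x ^ a2 * y ^ b2)"
      using \<open>x \<noteq> 0\<close> \<open>y \<noteq> 0\<close> by simp
    then have "v p = v e * (x powi \<alpha> * y powi \<beta>)"
      using \<open>x \<noteq> 0\<close> \<open>y \<noteq> 0\<close> by simp
    also have "x powi \<alpha> * y powi \<beta> = mon c (p - e)"
      unfolding pe mon_add[OF c(1)] mon_scale[OF c(1)] prod.collapse c(2,3) ..
    finally show ?thesis using c(1) by (simp add: mon_diff)
  qed
  then show ?thesis using that[of c "v e / mon c e"] c(1) nz(1) by simp
qed

lemma toric_in_TT: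
  assumes v: "pt v \<in> X" and e: "e \<in> A" "e + w \<in> A" "e + w' \<in> A" "cross w w' = 1"
    and nz: "v e \<noteq> 0" "v (e + w) \<noteq> 0" "v (e + w') \<noteq> 0"
  obtains c where "c \<in> torus2" "pt v = pt (tvec c)"
proof -
  obtain a c where c: "c \<in> torus2" "a \<noteq> 0" "\<And>p. p \<in> A \<Longrightarrow> v p = a * mon c p"
    using toric_point[OF toric_X[OF v] e nz] by metis
  have "v = (\<lambda>p. a * tvec c p)"
    using c(3) pt_X_coords[OF v] by (auto simp: fun_eq_iff tvec_def coords_def)
  then have "pt v = pt (tvec c)" using c(2) by simp
  then show ?thesis using that c(1) by blast
qed

lemma tvec_inj:
  assumes "c \<in> torus2" "c' \<in> torus2" "pt (tvec c) = pt (tvec c')"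
  shows "c = c'"
proof -
  obtain e w w' where e: "e \<in> A" "e + w \<in> A" "e + w' \<in> A" "cross w w' = 1" by (rule unimodular_triangle)
  obtain a where a: "a \<noteq> 0" "tvec c' = (\<lambda>j. a * tvec c j)" using assms(3) by (auto simp: pt_eq_iff)
  then have *: "mon c' p = a * mon c p" if "p \<in> A" for p
    using that unfolding fun_eq_iff tvec_def by (metis)
  have eq: "mon c' d = mon c d" if "e + d \<in> A" for d
    using *[OF e(1)] *[OF that] assms a(1) by (simp add: mon_add)
  show ?thesis using mon_unimodular_inj[OF e(4) assms(1,2)] eq e by simp
qed

lemma torus_point_inv: "c \<in> torus2 \<Longrightarrow> inv_into torus2 (torus_point \<Gamma>) (torus_point \<Gamma> c) = c"
  using tvec_inj by (intro inv_into_f_f inj_onI) (auto simp: torus_point_eq simp del: split_paired_All)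

lemma TT_eq: "TT = (\<lambda>c. pt (tvec c)) ` torus2"
  by (auto simp: dense_torus_def torus_point_eq)

text \<open>A point of \<open>X\<close> belongs to the torus as soon as the product of its three
  coordinates at a unimodular triangle is nonzero.\<close>

lemma TT_open: "openin (subtopology (zariski A) X) TT"
proof -
  obtain e w w' where e: "e \<in> A" "e + w \<in> A" "e + w' \<in> A" "cross w w' = 1" by (rule unimodular_triangle)
  define f where "f = (\<lambda>v. vm v [e, e + w, e + w'] :: complex)"
  have f: "f \<in> {f. \<exists>d. hform d f}" using hform_vm[of "[e, e + w, e + w']"] by (auto simp: f_def)
  have "TT = zar.nz A f \<inter> X"
  proof (intro equalityI subsetI)
    fix x assume x: "x \<in> TT"
    then obtain c where c: "c \<in> torus2" "x = pt (tvec c)" by (auto simp: TT_eq)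
    then have "f (tvec c) \<noteq> 0" using e unfolding f_def by (subst vm_tvec) auto
    then show "x \<in> zar.nz A f \<inter> X" using c x TT_subset_X zar.mem_nz[OF f tvec_coords[OF c(1)]] by auto
  next
    fix x assume x: "x \<in> zar.nz A f \<inter> X"
    then obtain v where v: "v \<in> coords A" "x = pt v" using X_subset by (auto simp: pspace_def)
    then have "f v \<noteq> 0" using x zar.mem_nz[OF f] by auto
    then have "v e \<noteq> 0" "v (e + w) \<noteq> 0" "v (e + w') \<noteq> 0" "pt v \<in> X" using x v by (auto simp: f_def)
    then obtain c where "c \<in> torus2" "pt v = pt (tvec c)"
      using toric_in_TT[OF _ e] by metis
    then show "x \<in> TT" using v by (auto simp: TT_eq)
  qed
  then show ?thesis using zar.openin_nz[OF f] by (auto simp: openin_subtopology)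
qed

lemma off_line:
  assumes "gcd (fst w) (snd w) = 1"
  obtains p where "p \<in> A" "cross w (p - e) \<noteq> 0"
proof (rule ccontr)
  assume no: "\<not> thesis"
  note witness = that
  have *: "cross w (p - e) = 0" if p: "p \<in> A" for p using no witness[OF p] by blast
  obtain e0 e1 e2 where a: "e0 \<in> A" "e1 \<in> A" "e2 \<in> A" "cross (e1 - e0) (e2 - e0) \<noteq> 0"
    by (rule noncollinear)
  have "cross w (e1 - e0) = 0" "cross w (e2 - e0) = 0"
    using *[OF a(1)] *[OF a(2)] *[OF a(3)] by (auto simp: cross_arith)
  then obtain k k' where "e1 - e0 = (k * fst w, k * snd w)" "e2 - e0 = (k' * fst w, k' * snd w)"
    using cross_eq_0_multiple[OF assms] by metis
  then show False using a(4) by (simp add: cross_def)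
qed

text \<open>The edges of a unimodular triangle generate the lattice, so every character is a
  quotient of two monomials; padding with \<open>e\<close> gives both the same degree.\<close>

lemma bal_exists:
  obtains l l' where "bal q 1 l l'"
proof -
  obtain e w w' where e: "e \<in> A" "e + w \<in> A" "e + w' \<in> A" "cross w w' = 1" by (rule unimodular_triangle)
  define \<alpha> \<beta> where "\<alpha> = cross q w'" and "\<beta> = cross w q"
  have q: "q = (\<alpha> * fst w, \<alpha> * snd w) + (\<beta> * fst w', \<beta> * snd w')"
    using unimodular_expansion[OF e(4), of q] by (simp add: \<alpha>_def \<beta>_def)
  define a1 a2 b1 b2 where ab: "a1 = nat \<alpha>" "a2 = nat (- \<alpha>)" "b1 = nat \<beta>" "b2 = nat (- \<beta>)"
  have \<alpha>: "\<alpha> = int a1 - int a2" "\<beta> = int b1 - int b2" by (auto simp: ab)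
  have "bal q 1 (replicate a1 (e + w) @ replicate b1 (e + w') @ replicate (a2 + b2) e)
    (replicate a2 (e + w) @ replicate b2 (e + w') @ replicate (a1 + b1) e)"
    unfolding bal_def
  proof (intro conjI)
    show "lsum (replicate a1 (e + w) @ replicate b1 (e + w') @ replicate (a2 + b2) e) =
      lsum (replicate a2 (e + w) @ replicate b2 (e + w') @ replicate (a1 + b1) e) + (int 1 * fst q, int 1 * snd q)"
      by (subst (1 2) q) (simp add: \<alpha> prod_eq_iff algebra_simps)
  qed (use e in auto)
  then show ?thesis by (rule that)
qed

end

section \<open>The equations of a view family\<close>

definition qv :: "int \<times> int \<Rightarrow> int \<times> int" where
  "qv h = (- snd h, fst h)"

lemma view_character_eq: "view_character h c = mon c (qv h)"
  by (simp add: view_character_def mon_def qv_def split: prod.splits)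

context polygon
begin

text \<open>\<open>X\<close> is the closure of the dense torus, so a nonempty open part of
  \<open>W\<close> on which \<open>f\<close> does not vanish would contain a torus point.\<close>

lemma hform_vanish_open:
  assumes W: "openin (subtopology (zariski A) X) W" and f: "hform d f"
    and 0: "\<And>c. c \<in> torus2 \<Longrightarrow> pt (tvec c) \<in> W \<Longrightarrow> f (tvec c) = 0" and v: "pt v \<in> W"
  shows "f v = 0"
proof (rule ccontr)
  assume nz: "f v \<noteq> 0"
  have fF: "f \<in> {f. \<exists>d. hform d f}" using f by blast
  obtain Y where Y: "openin (zariski A) Y" "W = Y \<inter> X" using W by (auto simp: openin_subtopology)
  have "v \<in> coords A" using pt_X_coords v Y by blast
  then have "pt v \<in> Y \<inter> zar.nz A f" using v Y nz by (simp add: zar.mem_nz[OF fF])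
  moreover have "openin (zariski A) (Y \<inter> zar.nz A f)" using Y(1) zar.openin_nz[OF fF] by (rule openin_Int)
  moreover have "pt v \<in> zariski A closure_of TT" using v Y by (simp add: toric_surface_def)
  ultimately obtain y where y: "y \<in> TT" "y \<in> Y" "y \<in> zar.nz A f" unfolding in_closure_of by blast
  then obtain c where c: "c \<in> torus2" "y = pt (tvec c)" by (auto simp: TT_eq)
  then have "f (tvec c) \<noteq> 0" using y(3) zar.mem_nz[OF fF tvec_coords] by blast
  moreover have "pt (tvec c) \<in> W" using y c Y TT_subset_X by blast
  ultimately show False using 0 c by blast
qed

text \<open>The rational function \<open>vm v l / vm v l'\<close> as a map to the line. The
  representative is chosen arbitrarily, which is harmless for lists of equal length
  (\<open>ratio_pt\<close>).\<close>

definition ratio :: "(int \<times> int) list \<Rightarrow> (int \<times> int) list \<Rightarrow> (int \<times> int) point \<Rightarrow> bool point" where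
  "ratio l l' x = pt (\<lambda>b. if b then vm (SOME v. v \<in> x) l else vm (SOME v. v \<in> x) l')"

lemma ratio_pt:
  assumes "length l = length l'"
  shows "ratio l l' (pt v) = pt (\<lambda>b. if b then vm v l else vm v l')"
proof -
  have "(SOME w. w \<in> pt v) \<in> pt v" by (rule someI[of "\<lambda>w. w \<in> pt v", OF self_in_pt])
  then obtain a where a: "a \<noteq> 0" "(SOME w. w \<in> pt v) = (\<lambda>j. a * v j)" by (auto simp: pt_def)
  have "ratio l l' (pt v) = pt (\<lambda>b. a ^ length l * (if b then vm v l else vm v l'))"
    unfolding ratio_def a(2) vm_scale using assms by (intro arg_cong[of _ _ pt]) auto
  then show ?thesis using a(1) by simp
qed

lemma rational_map_ratio:
  assumes D: "openin (subtopology (zariski A) X) D" "D \<noteq> {}" and len: "length l = length l'"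
    and nz: "\<And>v. pt v \<in> D \<Longrightarrow> vm v l \<noteq> 0 \<or> vm v l' \<noteq> 0" and f: "\<And>x. x \<in> D \<Longrightarrow> f x = ratio l l' x"
  shows "rational_map A X UNIV P1 D f"
  unfolding rational_map_def
proof (intro conjI D)
  have c: "(\<lambda>b. if b then vm v l else vm v l') \<in> coords UNIV" if "pt v \<in> D" for v
    using nz[OF that] by (auto simp: coords_def fun_eq_iff)
  show "regular_map_on A D UNIV P1 f"
    unfolding regular_map_on_hform
  proof (intro conjI ballI)
    show "f ` D \<subseteq> P1"
    proof
      fix y assume "y \<in> f ` D"
      then obtain x where x: "x \<in> D" "y = f x" by blast
      then have "x \<in> X" using openin_subset[OF D(1)] by auto
      then obtain v where "x = pt v" using X_subset by (auto simp: pspace_def)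
      then show "y \<in> P1" using x f c[of v] by (simp add: ratio_pt[OF len] P1_def pt_in_pspace_iff)
    qed
    fix x assume x: "x \<in> D"
    have "openin (subtopology (zariski A) D) D"
      using openin_subset[OF D(1)] by (metis openin_subtopology_refl topspace_subtopology le_inf_iff)
    moreover have "\<forall>k. hform (length l) (\<lambda>v. if k then vm v l else vm v l')"
      using hform_vm[of l] hform_vm[of l'] len by (simp add: all_bool_eq)
    ultimately show "\<exists>W d F. openin (subtopology (zariski A) D) W \<and> x \<in> W \<and> (\<forall>k. hform d (F k)) \<and>
       (\<forall>v\<in>coords A. pt v \<in> W \<longrightarrow> (\<lambda>k. if k \<in> UNIV then F k v else 0) \<in> coords UNIV \<and>
          f (pt v) = pt (\<lambda>k. if k \<in> UNIV then F k v else 0))"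
      using c f x by (intro exI[of _ D] exI[of _ "length l"] exI[of _ "\<lambda>k v. if k then vm v l else vm v l'"])
        (auto simp: ratio_pt[OF len])
  qed
qed

lemma bal_torus:
  assumes "bal q k l l'" "c \<in> torus2"
  shows "vm (tvec c) l = mon c q ^ k * vm (tvec c) l'"
  using assms mon_scale[of c "int k" "fst q" "snd q"]
  by (simp add: bal_def vm_tvec mon_add)

lemma vm_tvec_nonzero: "set l \<subseteq> A \<Longrightarrow> c \<in> torus2 \<Longrightarrow> vm (tvec c) l \<noteq> 0"
  by (simp add: vm_tvec)

lemma ratio_torus:
  assumes "bal q 1 l l'" "c \<in> torus2"
  shows "ratio l l' (pt (tvec c)) = P1_affine (mon c q)"
  using assms bal_torus[OF assms] vm_tvec_nonzero[of l' c]
  by (simp add: ratio_pt pt_eq_P1_affine_iff bal_def)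

lemma view_map_torus: "c \<in> torus2 \<Longrightarrow> view_map \<Gamma> h (pt (tvec c)) = P1_affine (mon c (qv h))"
  by (simp add: view_map_def torus_point_inv view_character_eq flip: torus_point_eq)

lemma rational_map_view: "rational_map A X UNIV P1 TT (view_map \<Gamma> h)"
proof -
  obtain l l' where b: "bal (qv h) 1 l l'" by (rule bal_exists)
  show ?thesis
  proof (rule rational_map_ratio[of _ l l'])
    show "TT \<noteq> {}" by (auto simp: TT_eq torus2_def)
    show "vm v l \<noteq> 0 \<or> vm v l' \<noteq> 0" if v: "pt v \<in> TT" for v
    proof -
      obtain c where c: "c \<in> torus2" "pt (tvec c) = pt v" using v by (auto simp: TT_eq)
      then obtain a where "a \<noteq> 0" "v = (\<lambda>j. a * tvec c j)" by (auto simp: pt_eq_iff)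
      then show ?thesis using vm_tvec_nonzero[of l c] b c by (simp add: vm_scale bal_def)
    qed
    show "view_map \<Gamma> h x = ratio l l' x" if "x \<in> TT" for x
      using that ratio_torus[OF b] view_map_torus[of _ h] by (auto simp: TT_eq)
  qed (use b TT_open in \<open>auto simp: bal_def\<close>)
qed

abbreviation "R h \<equiv> rational_fibre A X UNIV P1 TT (view_map \<Gamma> h)"

text \<open>The quotient of the two monomials is another representative of the rational map of
  \<open>h\<close>, agreeing with \<open>view_map\<close> on the torus, and it is defined at
  \<open>v\<close>. This is how boundary points enter a rational fibre.\<close>

lemma rational_fibre_lower:
  assumes b: "bal (qv h) 1 l l'" and v: "pt v \<in> X" and nz: "vm v l \<noteq> 0 \<or> vm v l' \<noteq> 0"
  shows "pt v \<in> R h (pt (\<lambda>b. if b then vm v l else vm v l'))"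
proof -
  let ?N = "zar.nz A (\<lambda>v. vm v l) \<union> zar.nz A (\<lambda>v. vm v l')"
  have F: "(\<lambda>v. vm v l) \<in> {f. \<exists>d. hform d f}" "(\<lambda>v. vm v l') \<in> {f. \<exists>d. hform d f}"
    using hform_vm by blast+
  have len: "length l = length l'" using b by (simp add: bal_def)
  have mem: "pt u \<in> ?N \<longleftrightarrow> vm u l \<noteq> 0 \<or> vm u l' \<noteq> 0" if "u \<in> coords A" for u
    using zar.mem_nz[OF F(1) that] zar.mem_nz[OF F(2) that] by auto
  have "openin (subtopology (zariski A) X) (?N \<inter> X)"
    using zar.openin_nz[OF F(1)] zar.openin_nz[OF F(2)] openin_Un by (metis openin_subtopology)
  moreover have pv: "pt v \<in> ?N \<inter> X" using v nz mem pt_X_coords by blast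
  ultimately have "rational_map A X UNIV P1 (?N \<inter> X) (ratio l l')"
    by (intro rational_map_ratio[of _ l l']) (use mem pt_X_coords len in blast)+
  moreover have "ratio l l' z = view_map \<Gamma> h z" if "z \<in> TT \<inter> (?N \<inter> X)" for z
    using that ratio_torus[OF b] view_map_torus[of _ h] by (auto simp: TT_eq)
  ultimately show ?thesis
    unfolding rational_fibre_def using pv ratio_pt[OF len, of v] by blast
qed

lemma torus_in_fibre: "c \<in> torus2 \<Longrightarrow> pt (tvec c) \<in> R h (P1_affine (mon c (qv h)))"
  unfolding rational_fibre_def using rational_map_view[of h] view_map_torus[of c h] TT_eq by blast

lemma rational_map_local:
  assumes D: "rational_map A X UNIV P1 D f" and v: "pt v \<in> D"
  obtains W d F where "openin (subtopology (zariski A) X) W" "pt v \<in> W" "W \<subseteq> D" "\<forall>k. hform d (F k)"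
    "\<forall>u\<in>coords A. pt u \<in> W \<longrightarrow> (\<lambda>k. F k u) \<in> coords UNIV \<and> f (pt u) = pt (\<lambda>k. F k u)"
proof -
  have DX: "openin (subtopology (zariski A) X) D" using D by (simp add: rational_map_def)
  have DX': "D \<subseteq> X" using openin_subset[OF DX] by auto
  have "regular_map_on A D UNIV P1 f" using D by (simp add: rational_map_def)
  from this[unfolded regular_map_on_hform, THEN conjunct2, THEN bspec, OF v]
  show ?thesis
  proof (elim exE conjE)
    fix W d F assume W: "openin (subtopology (zariski A) D) W" "pt v \<in> W" "\<forall>k. hform d (F k)"
      "\<forall>u\<in>coords A. pt u \<in> W \<longrightarrow> (\<lambda>k. if k \<in> UNIV then F k u else 0) \<in> coords UNIV \<and>
         f (pt u) = pt (\<lambda>k. if k \<in> UNIV then F k u else 0)"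
    have "openin (subtopology (zariski A) X) W"
      using openin_trans_full[OF _ DX, of W] W(1) DX' by (simp add: subtopology_subtopology Int_absorb1)
    moreover have "W \<subseteq> D" using openin_subset[OF W(1)] by auto
    ultimately show ?thesis using that W by simp
  qed
qed

lemma rational_fibre_subset_X: "rational_fibre A X UNIV P1 D f i \<subseteq> X"
proof
  fix x assume "x \<in> rational_fibre A X UNIV P1 D f i"
  then obtain D' f' where "rational_map A X UNIV P1 D' f'" "x \<in> D'" by (auto simp: rational_fibre_def)
  then show "x \<in> X" using openin_subset[of "subtopology (zariski A) X" D'] by (auto simp: rational_map_def)
qed

text \<open>For any local expression \<open>F\<close> of any representative, the cross-multiplied
  equation \<open>F False v ^ k * vm v l = F True v ^ k * vm v l'\<close> compares two forms that
  agree on the torus points of an open set, hence also at \<open>v\<close>.\<close>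

lemma rational_fibre_equations:
  assumes x: "pt v \<in> rational_fibre A X UNIV P1 D f (pt u)" and D: "TT \<subseteq> D"
    and f: "\<And>c. c \<in> torus2 \<Longrightarrow> f (pt (tvec c)) = P1_affine (mon c q)" and b: "bal q k l l'"
  shows "u False ^ k * vm v l = u True ^ k * vm v l'"
proof -
  obtain D' f' where D': "rational_map A X UNIV P1 D' f'" "\<forall>z\<in>D \<inter> D'. f' z = f z" "pt v \<in> D'" "f' (pt v) = pt u"
    using x by (auto simp: rational_fibre_def)
  obtain W d F where W: "openin (subtopology (zariski A) X) W" "pt v \<in> W" "W \<subseteq> D'" "\<forall>k. hform d (F k)"
    "\<forall>u\<in>coords A. pt u \<in> W \<longrightarrow> (\<lambda>k. F k u) \<in> coords UNIV \<and> f' (pt u) = pt (\<lambda>k. F k u)"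
    by (rule rational_map_local[OF D'(1,3)])
  have vA: "v \<in> coords A" using openin_subset[OF W(1)] W(2) pt_X_coords by auto
  have "F False v ^ k * vm v l - F True v ^ k * vm v l' = 0"
  proof (rule hform_vanish_open[OF W(1), where f = "\<lambda>v. F False v ^ k * vm v l - F True v ^ k * vm v l'"])
    show "hform (k * d + length l) (\<lambda>v. F False v ^ k * vm v l - F True v ^ k * vm v l')"
    proof (rule gform_diff)
      show "hform (k * d + length l) (\<lambda>v. F False v ^ k * vm v l)"
        by (rule gform_mult[OF gform_power[OF W(4)[rule_format] refl refl] hform_vm]) auto
      show "hform (k * d + length l) (\<lambda>v. F True v ^ k * vm v l')"
        by (rule gform_mult[OF gform_power[OF W(4)[rule_format] refl refl] hform_vm]) (use b in \<open>auto simp: bal_def\<close>)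
    qed
    fix c assume c: "c \<in> torus2" "pt (tvec c) \<in> W"
    then have "f' (pt (tvec c)) = P1_affine (mon c q)" using f[OF c(1)] D'(2) D W(3) TT_eq by auto
    moreover have "f' (pt (tvec c)) = pt (\<lambda>k. F k (tvec c))" using W(5) c tvec_coords by blast
    ultimately have "F True (tvec c) = mon c q * F False (tvec c)"
      using pt_eq_P1_affine_iff[of "\<lambda>k. F k (tvec c)"] by simp
    then show "F False (tvec c) ^ k * vm (tvec c) l - F True (tvec c) ^ k * vm (tvec c) l' = 0"
      using bal_torus[OF b c(1)] by (simp add: power_mult_distrib)
  qed (rule W(2))
  moreover have "pt (\<lambda>k. F k v) = pt u" using W(2,5) vA D'(4) by simp
  then obtain a where "u = (\<lambda>k. a * F k v)" by (auto simp: pt_eq_iff)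
  ultimately show ?thesis by (simp add: power_mult_distrib algebra_simps)
qed

text \<open>The equations are cross-multiplied so that they make sense over 0 and infinity.
  Primitivity of \<open>q\<close> is not built in: the exponent of a toric family is compared with
  \<open>G q\<close> before it is known to be primitive.\<close>

definition G :: "int \<times> int \<Rightarrow> (bool point \<times> (int \<times> int) point) set" where
  "G q = {(pt u, pt v) | u v. u \<in> coords UNIV \<and> pt v \<in> X \<and>
     (\<forall>k l l'. bal q k l l' \<longrightarrow> u False ^ k * vm v l = u True ^ k * vm v l')}"

lemma mem_G:
  "(pt u, pt v) \<in> G q \<longleftrightarrow> u \<in> coords UNIV \<and> pt v \<in> X \<and>
     (\<forall>k l l'. bal q k l l' \<longrightarrow> u False ^ k * vm v l = u True ^ k * vm v l')"
proof
  assume "(pt u, pt v) \<in> G q"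
  then obtain u' v' where *: "pt u' = pt u" "pt v' = pt v" "u' \<in> coords UNIV" "pt v' \<in> X"
    "\<forall>k l l'. bal q k l l' \<longrightarrow> u' False ^ k * vm v' l = u' True ^ k * vm v' l'"
    unfolding G_def by auto
  then obtain a b where ab: "a \<noteq> 0" "b \<noteq> 0" "u = (\<lambda>j. a * u' j)" "v = (\<lambda>j. b * v' j)"
    by (auto simp: pt_eq_iff)
  then have "u \<in> coords UNIV" using *(3) coords_scale by blast
  moreover have "pt v \<in> X" using * by simp
  moreover have "u False ^ k * vm v l = u True ^ k * vm v l'" if "bal q k l l'" for k l l'
    using *(5)[rule_format, OF that] that
    by (simp add: ab vm_scale power_mult_distrib bal_def algebra_simps)
  ultimately show "u \<in> coords UNIV \<and> pt v \<in> X \<and>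
     (\<forall>k l l'. bal q k l l' \<longrightarrow> u False ^ k * vm v l = u True ^ k * vm v l')" by blast
qed (auto simp: G_def)

lemma G_subset: "G q \<subseteq> P1 \<times> X"
  by (auto simp: G_def P1_def pspace_def)

lemma closedin_G: "closedin (zariski_prod UNIV A) (G q)"
proof -
  have sub: "G q \<subseteq> topspace (zariski_prod UNIV A)"
    using G_subset[of q] X_subset by (auto simp: P1_def)
  have "zariski_prod UNIV A closure_of G q \<subseteq> G q"
  proof
    fix y assume y: "y \<in> zariski_prod UNIV A closure_of G q"
    then have "y \<in> pspace UNIV \<times> pspace A" using closure_of_subset_topspace by fastforce
    then obtain u v where uv: "u \<in> coords UNIV" "v \<in> coords A" "y = (pt u, pt v)" by (auto simp: pspace_def)
    have *: "f (case_sum u v) = 0" if "biform d e f"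
      "\<And>u v. (pt u, pt v) \<in> G q \<Longrightarrow> f (case_sum u v) = 0" for d e f
      using y that unfolding uv(3) in_zariski_prod_closure_iff[OF uv(1,2)] by blast
    have "pt v \<in> zariski A closure_of X"
      unfolding in_zariski_closure_iff[OF uv(2)]
    proof (intro allI impI)
      fix d f assume f: "hform d f" "\<forall>u\<in>coords A. pt u \<in> X \<longrightarrow> f u = 0"
      have "f (\<lambda>k. case_sum u v (Inr k)) = 0"
        by (rule *[OF biform_of_hform[OF f(1)]]) (use f(2) pt_X_coords in \<open>auto simp: mem_G\<close>)
      then show "f v = 0" by simp
    qed
    then have "pt v \<in> X" using closure_of_closedin[OF closedin_X] by simp
    moreover have "u False ^ k * vm v l = u True ^ k * vm v l'" if b: "bal q k l l'" for k l l'
    proof -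
      let ?f = "\<lambda>x. x (Inl False) ^ k * vm (\<lambda>k. x (Inr k)) l - x (Inl True) ^ k * vm (\<lambda>k. x (Inr k)) l'"
      have "biform k (length m) (\<lambda>x. x (Inl j) ^ k * vm (\<lambda>k. x (Inr k)) m)" for j :: bool and m :: "(int \<times> int) list"
        by (rule gform_mult[OF gform_power[OF biform_Inl[OF refl refl] refl refl] biform_of_hform[OF hform_vm]]) auto
      from gform_diff[OF this[of l False] this[of l' True, folded b[unfolded bal_def, THEN conjunct2, THEN conjunct2, THEN conjunct1]]]
      have "biform k (length l) ?f" .
      then have "?f (case_sum u v) = 0" by (rule *) (use b in \<open>auto simp: mem_G\<close>)
      then show ?thesis by simp
    qed
    ultimately show "y \<in> G q" unfolding uv(3) mem_G using uv(1) by blast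
  qed
  then show ?thesis using sub closure_of_subset_eq by blast
qed

text \<open>On the torus no monomial vanishes, so a single equation with \<open>k = 1\<close>
  determines the base point.\<close>

lemma torus_G_iff:
  assumes c: "c \<in> torus2"
  shows "(i, pt (tvec c)) \<in> G q \<longleftrightarrow> i = P1_affine (mon c q)"
proof
  assume L: "(i, pt (tvec c)) \<in> G q"
  then obtain u where u: "i = pt u" "u \<in> coords UNIV" using G_subset[of q] by (auto simp: P1_def pspace_def)
  obtain l l' where b: "bal q 1 l l'" by (rule bal_exists)
  then have "u False ^ 1 * vm (tvec c) l = u True ^ 1 * vm (tvec c) l'" using L unfolding u(1) mem_G by blast
  then have "u True = mon c q * u False"
    using bal_torus[OF b c] vm_tvec_nonzero[of l' c] c b by (simp add: bal_def mult.commute)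
  moreover have "u False \<noteq> 0"
    using calculation u(2) by (auto simp: coords_def fun_eq_iff all_bool_eq)
  ultimately show "i = P1_affine (mon c q)" unfolding u(1) by (simp add: pt_eq_P1_affine_iff)
next
  assume "i = P1_affine (mon c q)"
  then show "(i, pt (tvec c)) \<in> G q"
    using TT_subset_X c bal_torus[OF _ c] unfolding P1_affine_def by (auto simp: mem_G TT_eq)
qed

text \<open>Upper bound for the fibres of any family whose map is the character \<open>q\<close> on
  the torus; it applies to view families and to arbitrary toric families alike. The matching lower
  bound is \<open>G_fibre_minimal\<close>.\<close>

lemma closure_fibre_subset_G:
  assumes "TT \<subseteq> D" "\<And>c. c \<in> torus2 \<Longrightarrow> f (pt (tvec c)) = P1_affine (mon c q)" "i \<in> P1"
    and "x \<in> zariski A closure_of rational_fibre A X UNIV P1 D f i"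
  shows "(i, x) \<in> G q"
proof -
  obtain u where u: "u \<in> coords UNIV" "i = pt u" using assms(3) by (auto simp: P1_def pspace_def)
  have "rational_fibre A X UNIV P1 D f i \<subseteq> fibre (G q) i"
  proof
    fix x assume x: "x \<in> rational_fibre A X UNIV P1 D f i"
    then have "x \<in> X" using rational_fibre_subset_X by blast
    then obtain v where v: "x = pt v" using X_subset by (auto simp: pspace_def)
    show "x \<in> fibre (G q) i"
      using rational_fibre_equations[OF x[unfolded v u(2)] assms(1,2)] \<open>x \<in> X\<close> u(1)
      unfolding fibre_def v u(2) by (auto simp: mem_G)
  qed
  moreover have "closedin (zariski A) (fibre (G q) i)"
    using closedin_slice[OF closedin_G] assms(3) by (simp add: P1_def)
  ultimately show ?thesis using assms(4) closure_of_minimal by (fastforce simp: fibre_def)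
qed

text \<open>Points of the boundary divisor given by the one-parameter subgroup orthogonal to \<open>w\<close>, where
  \<open>e\<close> lies on the corresponding face.\<close>

definition face_vec :: "int \<times> int \<Rightarrow> int \<times> int \<Rightarrow> complex \<times> complex \<Rightarrow> int \<times> int \<Rightarrow> complex" where
  "face_vec w e c = (\<lambda>p. if p \<in> A \<and> cross w (p - e) = 0 then mon c p else 0)"

lemma face_vec_coords:
  assumes "e \<in> A" "c \<in> torus2"
  shows "face_vec w e c \<in> coords A"
proof -
  have "face_vec w e c e \<noteq> 0" using assms by (simp add: face_vec_def cross_def)
  then have "face_vec w e c \<noteq> (\<lambda>_. 0)" by (auto simp only: fun_eq_iff)
  then show ?thesis by (simp add: coords_def face_vec_def)
qed

section \<open>The graph of the character and limits along one-parameter subgroups\<close>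

definition graph :: "int \<times> int \<Rightarrow> (bool point \<times> (int \<times> int) point) set" where
  "graph q = (\<lambda>c. (P1_affine (mon c q), pt (tvec c))) ` torus2"

text \<open>The limit for \<open>t \<rightarrow> 0\<close> of
  \<open>mon c q * t powi cross w q\<close> in the line, that is, of the character along the
  one-parameter subgroup attached to \<open>w\<close>.\<close>

definition face_value :: "int \<times> int \<Rightarrow> int \<times> int \<Rightarrow> complex \<times> complex \<Rightarrow> bool point" where
  "face_value q w c = (if cross w q = 0 then P1_affine (mon c q)
     else if cross w q > 0 then P1_affine 0 else P1_infinity)"

text \<open>Translation of \<open>c\<close> by the value at \<open>z\<close> of the one-parameter
  subgroup \<open>(- snd w, fst w)\<close>.\<close>

lemma torus_arc:
  assumes c: "c \<in> torus2" and z: "z \<noteq> (0::complex)"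
  obtains c' where "c' \<in> torus2" "\<And>p. mon c' p = mon c p * z powi cross w p"
proof -
  define c' where "c' = (fst c * z powi (- snd w), snd c * z powi fst w)"
  have "c' \<in> torus2" using c z by (auto simp: c'_def torus2_def)
  moreover have "mon c' p = mon c p * z powi cross w p" for p
  proof -
    have "z powi cross w p = (z powi (- snd w)) powi fst p * (z powi fst w) powi snd p"
      using z by (simp add: cross_def power_int_diff power_int_minus power_int_mult divide_inverse
          flip: power_int_inverse)
    then show ?thesis by (simp add: mon_def c'_def power_int_mult_distrib)
  qed
  ultimately show ?thesis by (rule that)
qed

text \<open>The orbit of \<open>c\<close> under the one-parameter subgroup of \<open>q\<close>,
  rescaled so that the exponent at \<open>e\<close> is 0. If \<open>e\<close> minimizes
  \<open>cross q\<close>, the exponents become nonnegative and the arc extends to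
  \<open>t = 0\<close>, where its value is a \<open>face_vec\<close>.\<close>

definition arc_vec :: "int \<times> int \<Rightarrow> int \<times> int \<Rightarrow> complex \<times> complex \<Rightarrow> complex \<Rightarrow> int \<times> int \<Rightarrow> complex" where
  "arc_vec q e c t = (\<lambda>p. if p \<in> A then mon c p * t ^ nat (cross q (p - e)) else 0)"

lemma arc_vec_torus:
  assumes "c \<in> torus2" "t \<noteq> 0" and e: "\<forall>p\<in>A. cross q (p - e) \<ge> 0"
  obtains c' where "c' \<in> torus2" "\<forall>d. mon c' d = mon c d * t powi cross q d" "pt (arc_vec q e c t) = pt (tvec c')"
proof -
  obtain c' where c': "c' \<in> torus2" "\<And>d. mon c' d = mon c d * t powi cross q d"
    using torus_arc[OF assms(1,2)] by blast
  have "arc_vec q e c t p = t powi (- cross q e) * tvec c' p" for p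
  proof (cases "p \<in> A")
    case True
    then have "t ^ nat (cross q (p - e)) = t powi (cross q p - cross q e)"
      using e by (simp add: power_int_def cross_arith)
    then show ?thesis
      using True assms(2) by (simp add: arc_vec_def tvec_def c'(2) power_int_diff power_int_minus divide_inverse)
  qed (simp add: arc_vec_def tvec_def)
  then have "arc_vec q e c t = (\<lambda>p. t powi (- cross q e) * tvec c' p)" by blast
  then have "pt (arc_vec q e c t) = pt (tvec c')" using assms(2) by simp
  then show ?thesis using that c' by blast
qed

lemma arc_vec_poly: "arc_vec w e c t = (\<lambda>p. poly (if p \<in> A then monom (mon c p) (nat (cross w (p - e))) else 0) t)"
  by (auto simp: arc_vec_def poly_monom)

lemma arc_vec_0:
  assumes "\<forall>p\<in>A. cross w (p - e) \<ge> 0"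
  shows "arc_vec w e c 0 = face_vec w e c"
proof
  fix p show "arc_vec w e c 0 p = face_vec w e c p"
    using assms by (cases "p \<in> A") (force simp: arc_vec_def face_vec_def power_0_left)+
qed

lemma face_limit:
  assumes e: "e \<in> A" "\<And>p. p \<in> A \<Longrightarrow> cross w (p - e) \<ge> 0" and c: "c \<in> torus2"
    and Z: "closedin (zariski_prod UNIV A) Z" "graph q \<subseteq> Z"
  shows "(face_value q w c, pt (face_vec w e c)) \<in> Z"
proof -
  define V where "V = (\<lambda>p. if p \<in> A then monom (mon c p) (nat (cross w (p - e))) else 0)"
  \<comment> \<open>Numerator and denominator of \<open>mon c q * z powi cross w q\<close>.
    Truncation by \<open>nat\<close> makes at least one of them constant, so they have no common
    zero at 0.\<close>
  define U where "U = (\<lambda>b. if b then monom (mon c q) (nat (cross w q)) else monom 1 (nat (- cross w q)))"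
  have e': "\<forall>p\<in>A. cross w (p - e) \<ge> 0" using e(2) by blast
  have V: "(\<lambda>p. poly (V p) t) = arc_vec w e c t" for t unfolding V_def arc_vec_poly ..
  note V0 = V[of 0, unfolded arc_vec_0[OF e']]
  have U0: "(\<lambda>b. poly (U b) 0) \<in> coords UNIV" "pt (\<lambda>b. poly (U b) 0) = face_value q w c"
  proof -
    have U0: "(\<lambda>b. poly (U b) 0) = (\<lambda>b. if b then (if cross w q \<le> 0 then mon c q else 0) else (if cross w q \<ge> 0 then 1 else 0))"
      by (auto simp: U_def fun_eq_iff poly_monom power_0_left)
    show "(\<lambda>b. poly (U b) 0) \<in> coords UNIV"
      unfolding U0 using c by (auto simp: coords_def fun_eq_iff all_bool_eq)
    show "pt (\<lambda>b. poly (U b) 0) = face_value q w c"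
      unfolding U0 face_value_def using c by (auto simp: pt_eq_P1_affine_iff pt_eq_P1_infinity_iff)
  qed
  have "(pt (\<lambda>b. poly (U b) 0), pt (\<lambda>p. poly (V p) 0)) \<in> Z"
  proof (rule zariski_prod_arc_limit[OF Z(1) U0(1)])
    show "(\<lambda>p. poly (V p) 0) \<in> coords A" unfolding V0 by (rule face_vec_coords[OF e(1) c])
    fix z :: complex assume z: "z \<noteq> 0"
    obtain c' where c': "c' \<in> torus2" "\<forall>d. mon c' d = mon c d * z powi cross w d" "pt (arc_vec w e c z) = pt (tvec c')"
      by (rule arc_vec_torus[OF c z e'])
    have "pt (\<lambda>b. poly (U b) z) = P1_affine (mon c' q)"
      using z c'(2)[rule_format, of q] unfolding pt_eq_P1_affine_iff
      by (auto simp: U_def poly_monom power_int_def power_inverse)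
    then show "(pt (\<lambda>b. poly (U b) z), pt (\<lambda>p. poly (V p) z)) \<in> Z"
      unfolding V c'(3) using Z(2) c'(1) by (auto simp: graph_def)
  qed
  then show ?thesis unfolding U0(2) V0 .
qed

text \<open>If \<open>w\<close> is parallel to \<open>q\<close>, the arc does not leave its fibre of
  the character, so the limit can be taken inside the surface instead of in the product.\<close>

lemma face_limit_orbit:
  assumes e: "e \<in> A" "\<And>p. p \<in> A \<Longrightarrow> cross w (p - e) \<ge> 0" and c: "c \<in> torus2" and q: "cross w q = 0"
    and Z: "closedin (zariski A) Z" "\<And>c'. c' \<in> torus2 \<Longrightarrow> mon c' q = mon c q \<Longrightarrow> pt (tvec c') \<in> Z"
  shows "pt (face_vec w e c) \<in> Z"
proof -
  define V where "V = (\<lambda>p. if p \<in> A then monom (mon c p) (nat (cross w (p - e))) else 0)"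
  have e': "\<forall>p\<in>A. cross w (p - e) \<ge> 0" using e(2) by blast
  have V: "(\<lambda>p. poly (V p) t) = arc_vec w e c t" for t unfolding V_def arc_vec_poly ..
  note V0 = V[of 0, unfolded arc_vec_0[OF e']]
  have "pt (\<lambda>p. poly (V p) 0) \<in> Z"
  proof (rule zariski_arc_limit[OF Z(1)])
    show "(\<lambda>p. poly (V p) 0) \<in> coords A" unfolding V0 by (rule face_vec_coords[OF e(1) c])
    fix z :: complex assume z: "z \<noteq> 0"
    obtain c' where c': "c' \<in> torus2" "\<forall>d. mon c' d = mon c d * z powi cross w d" "pt (arc_vec w e c z) = pt (tvec c')"
      by (rule arc_vec_torus[OF c z e'])
    have "mon c' q = mon c q" using c'(2)[rule_format, of q] q by simp
    then show "pt (\<lambda>p. poly (V p) z) \<in> Z" unfolding V c'(3) using Z(2)[OF c'(1)] by simp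
  qed
  then show ?thesis unfolding V0 .
qed

end

section \<open>Fibres of the closure of the graph\<close>

context polygon
begin

lemma bal_uminus: "bal (- q) k l l' \<longleftrightarrow> bal q k l' l"
  by (auto simp: bal_def prod_eq_iff)

text \<open>The sign \<open>\<sigma>\<close> orders the columns, that is, the values of
  \<open>cross q\<close>, so that \<open>b\<close> lies between \<open>a\<close> and
  \<open>p\<close>. The multiplicities balance \<open>M + N\<close> copies of \<open>b\<close>
  against \<open>N\<close> copies of \<open>a\<close> and \<open>M\<close> of \<open>p\<close> to
  the same column, hence their sums differ by a multiple \<open>k\<close> of \<open>q\<close>. The
  three cases are \<open>b\<close> above, below and on the chord from \<open>a\<close> to
  \<open>p\<close>; the hypothesis \<open>P\<close> annihilates the monomial on the higher
  side.\<close>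

lemma three_points:
  assumes v: "toric v" and P: "\<forall>k l l'. bal q k l l' \<longrightarrow> k \<ge> 1 \<longrightarrow> vm v l = 0"
    and A: "a \<in> A" "b \<in> A" "p \<in> A"
    and MN: "0 \<le> \<sigma> * cross q (b - a)" "0 \<le> \<sigma> * cross q (p - b)" "0 < \<sigma> * cross q (p - a)"
  shows "\<sigma> * cross (b - a) (p - b) \<ge> 1 \<Longrightarrow> v b = 0"
    and "\<sigma> * cross (b - a) (p - b) \<le> -1 \<Longrightarrow> v a = 0 \<or> v p = 0"
    and "cross (b - a) (p - b) = 0 \<Longrightarrow>
      v b = 0 \<longleftrightarrow> (0 < \<sigma> * cross q (p - b) \<and> v a = 0) \<or> (0 < \<sigma> * cross q (b - a) \<and> v p = 0)"
proof -
  define M N where "M = nat (\<sigma> * cross q (b - a))" and "N = nat (\<sigma> * cross q (p - b))"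
  define k where "k = \<sigma> * cross (b - a) (p - b)"
  have int: "int M = \<sigma> * cross q (b - a)" "int N = \<sigma> * cross q (p - b)" using MN by (auto simp: M_def N_def)
  let ?l = "replicate (M + N) b" and ?l' = "replicate N a @ replicate M p"
  have sum: "lsum ?l = lsum ?l' + (k * fst q, k * snd q)"
    by (simp add: prod_eq_iff int k_def cross_def algebra_simps)
  have sets: "set ?l \<subseteq> A" "set ?l' \<subseteq> A" "length ?l = length ?l'" using A by auto
  have "int (M + N) = \<sigma> * cross q (p - a)" by (simp add: int cross_arith algebra_simps)
  then have MN0: "M + N > 0" using MN(3) by linarith
  show "v b = 0" if "\<sigma> * cross (b - a) (p - b) \<ge> 1"
  proof -
    have "bal q (nat k) ?l ?l'" using that sum sets by (simp add: bal_def k_def)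
    then have "vm v ?l = 0" using that by (intro P[rule_format]) (auto simp: k_def)
    then show ?thesis by simp
  qed
  show "v a = 0 \<or> v p = 0" if "\<sigma> * cross (b - a) (p - b) \<le> -1"
  proof -
    have "bal q (nat (- k)) ?l' ?l"
      unfolding bal_def using that sum sets by (simp add: k_def prod_eq_iff)
    then have "vm v ?l' = 0" using that by (intro P[rule_format]) (auto simp: k_def)
    then show ?thesis by auto
  qed
  show "v b = 0 \<longleftrightarrow> (0 < \<sigma> * cross q (p - b) \<and> v a = 0) \<or> (0 < \<sigma> * cross q (b - a) \<and> v p = 0)"
    if "cross (b - a) (p - b) = 0"
  proof -
    have "lsum ?l = lsum ?l'" using sum that by (simp add: k_def)
    then have "vm v ?l = vm v ?l'" using toricD[OF v sets] by blast
    then have "v b ^ (M + N) = v a ^ N * v p ^ M" by simp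
    then have "v b = 0 \<longleftrightarrow> (N > 0 \<and> v a = 0) \<or> (M > 0 \<and> v p = 0)"
      using MN0 by (metis (no_types, lifting) mult_eq_0_iff power_eq_0_iff)
    then show ?thesis by (simp add: M_def N_def)
  qed
qed

text \<open>Points with equal \<open>cross q\<close> differ by a multiple of \<open>q\<close>. If
  \<open>a\<close> were the higher one, the equation of the one-element lists would force
  \<open>v a = 0\<close>; so support points are lowest in their columns.\<close>

lemma same_column:
  assumes P: "\<forall>k l l'. bal q k l l' \<longrightarrow> k \<ge> 1 \<longrightarrow> vm v l = 0" and q: "gcd (fst q) (snd q) = 1"
    and A: "a \<in> A" "b \<in> A" "v a \<noteq> 0" "cross q (b - a) = 0"
  obtains k where "k \<ge> 0" "b - a = (k * fst q, k * snd q)"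
proof -
  obtain k where k: "b - a = (k * fst q, k * snd q)" using cross_eq_0_multiple[OF q A(4)] by blast
  have "k \<ge> 0"
  proof (rule ccontr)
    assume "\<not> k \<ge> 0"
    moreover have "fst b - fst a = k * fst q" "snd b - snd a = k * snd q" using k by (auto simp: prod_eq_iff)
    ultimately have "bal q (nat (- k)) [a] [b]" using A by (auto simp: bal_def prod_eq_iff)
    then have "vm v [a] = 0" using \<open>\<not> k \<ge> 0\<close> by (intro P[rule_format]) auto
    then show False using A(3) by simp
  qed
  then show ?thesis using k that by blast
qed

text \<open>Start and direction of the primitive step from \<open>j0\<close> are exchanged when
  \<open>\<sigma> = 1\<close>, so that in both cases the polygon lies on the nonnegative side of
  \<open>w\<close> and \<open>w\<close> is positive on \<open>q\<close>.\<close>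

lemma edge_through:
  assumes A: "j0 \<in> A" "j1 \<in> A" and \<sigma>: "\<sigma> = 1 \<or> \<sigma> = -1" and q: "\<sigma> * cross q (j1 - j0) > 0"
    and le: "\<And>p. p \<in> A \<Longrightarrow> \<sigma> * cross (j1 - j0) (p - j0) \<le> 0"
  obtains e w w0 g where "e \<in> A" "e + w \<in> A" "gcd (fst w) (snd w) = 1" "cross w q > 0"
    "\<And>p. p \<in> A \<Longrightarrow> cross w (p - e) \<ge> 0" "\<And>p. cross w (p - e) = 0 \<longleftrightarrow> cross (j1 - j0) (p - j0) = 0"
    "{e, e + w} = {j0, j0 + w0}" "g \<ge> 1" "j1 - j0 = (g * fst w0, g * snd w0)"
proof -
  have "j0 \<noteq> j1" using q by (auto simp: cross_def)
  then obtain w0 g where w0: "g \<ge> 1" "gcd (fst w0) (snd w0) = 1" "j0 + w0 \<in> A" "j1 - j0 = (g * fst w0, g * snd w0)"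
    by (rule primitive_step[OF A])
  have d: "cross (j1 - j0) x = g * cross w0 x" "cross x (j1 - j0) = g * cross x w0" for x
    unfolding w0(4) by (simp_all add: cross_arith)
  have 1: "\<sigma> * cross w0 (p - j0) \<le> 0" if "p \<in> A" for p
    using le[OF that] w0(1) unfolding d by (simp add: mult.left_commute[of \<sigma>] mult_le_0_iff)
  have 2: "\<sigma> * cross q w0 > 0" using q w0(1) unfolding d by (simp add: mult.left_commute[of \<sigma>] zero_less_mult_iff)
  from \<sigma> show ?thesis
  proof
    assume "\<sigma> = 1"
    have "cross (- w0) (p - (j0 + w0)) \<ge> 0" if "p \<in> A" for p
      using 1[OF that] \<open>\<sigma> = 1\<close> by (simp add: cross_arith)
    moreover have "cross (- w0) (p - (j0 + w0)) = 0 \<longleftrightarrow> cross (j1 - j0) (p - j0) = 0" for p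
      using w0(1) unfolding d by (auto simp: cross_arith)
    moreover have "cross (- w0) q > 0" using 2 \<open>\<sigma> = 1\<close> by (simp add: cross_arith cross_commute[of q])
    moreover have "{j0 + w0, j0 + w0 + - w0} = {j0, j0 + w0}" by auto
    ultimately show ?thesis
      using A w0 by (intro that[of "j0 + w0" "- w0" w0 g]) auto
  next
    assume "\<sigma> = -1"
    have "cross w0 (p - j0) \<ge> 0" if "p \<in> A" for p
      using 1[OF that] \<open>\<sigma> = -1\<close> by simp
    moreover have "cross w0 (p - j0) = 0 \<longleftrightarrow> cross (j1 - j0) (p - j0) = 0" for p
      using w0(1) unfolding d by simp
    moreover have "cross w0 q > 0" using 2 \<open>\<sigma> = -1\<close> by (simp add: cross_commute[of w0])
    ultimately show ?thesis
      using A w0 by (intro that[of j0 w0 w0 g]) auto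
  qed
qed

text \<open>The support of a point in the fibre over \<open>0\<close> lies on an edge whose inner normal is positive
  on \<open>q\<close>; if it is a single vertex, the edge is chosen to end there.\<close>

lemma lower_edge:
  assumes v: "toric v" "pt v \<in> X" and P: "\<forall>k l l'. bal q k l l' \<longrightarrow> k \<ge> 1 \<longrightarrow> vm v l = 0"
    and q: "gcd (fst q) (snd q) = 1"
  obtains e w where "e \<in> A" "e + w \<in> A" "gcd (fst w) (snd w) = 1" "cross w q > 0"
    "\<forall>p\<in>A. cross w (p - e) \<ge> 0" "\<forall>p\<in>A. v p \<noteq> 0 \<longrightarrow> cross w (p - e) = 0"
    "v e \<noteq> 0 \<and> v (e + w) \<noteq> 0 \<or>
     (\<exists>j u. j \<in> A \<and> cross w (j - e) = 0 \<and> v j \<noteq> 0 \<and> (\<forall>p\<in>A. p \<noteq> j \<longrightarrow> v p = 0) \<and>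
       (\<forall>p\<in>A. cross w (p - e) = 0 \<longrightarrow> p \<noteq> j \<longrightarrow> cross (p - j) u > 0))"
proof -
  have "v \<in> coords A" by (rule pt_X_coords[OF v(2)])
  then obtain j where j: "j \<in> A" "v j \<noteq> 0" by (auto simp: coords_def fun_eq_iff)
  note three = three_points[OF v(1) P]
  show ?thesis
  proof (cases "\<exists>j'\<in>A. v j' \<noteq> 0 \<and> j' \<noteq> j")
    case True
    then obtain j' where j': "j' \<in> A" "v j' \<noteq> 0" "j' \<noteq> j" by blast
    \<comment> \<open>Two support points in one column would each lie above the other.\<close>
    have "cross q (j' - j) \<noteq> 0"
    proof
      assume 0: "cross q (j' - j) = 0"
      then have z: "cross q (j - j') = 0" by (simp add: cross_arith)
      obtain k where k: "k \<ge> 0" "j' - j = (k * fst q, k * snd q)"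
        using same_column[OF P q j(1) j'(1) j(2) 0] by blast
      obtain k' where k': "k' \<ge> 0" "j - j' = (k' * fst q, k' * snd q)"
        using same_column[OF P q j'(1) j(1) j'(2) z] by blast
      have "(k + k') * fst q = 0" "(k + k') * snd q = 0"
        using k(2) k'(2) by (auto simp: prod_eq_iff algebra_simps)
      then have "k + k' = 0" using q by auto
      then have "k = 0" using k(1) k'(1) by simp
      then show False using k(2) j'(3) by (simp add: prod_eq_iff)
    qed
    then have "cross q (j' - j) > 0 \<or> cross q (j - j') > 0" by (auto simp: cross_arith)
    then obtain j0 j1 where J: "j0 \<in> A" "v j0 \<noteq> 0" "j1 \<in> A" "v j1 \<noteq> 0" "cross q (j1 - j0) > 0"
      using j j' by metis
    define d where "d = j1 - j0"
    have qd: "cross q (j1 - j0) = cross q d" "0 < cross q d" using J by (auto simp: d_def)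
    \<comment> \<open>In the direction of \<open>q\<close> no lattice point is below the line
      through \<open>j0\<close> and \<open>j1\<close>, and the support lies on this line. Whichever
      of \<open>j0\<close>, \<open>j1\<close>, \<open>p\<close> has the middle column plays the role
      of \<open>b\<close> in \<open>three_points\<close>.\<close>
    have sgn: "cross d (p - j0) \<le> 0 \<and> (v p \<noteq> 0 \<longrightarrow> cross d (p - j0) = 0)" if p: "p \<in> A" for p
    proof -
      have *: "cross (j1 - j0) (p - j1) = cross d (p - j0)" "cross (j0 - p) (j1 - j0) = cross d (p - j0)"
        "cross (p - j0) (j1 - p) = - cross d (p - j0)"
        by (simp_all add: d_def cross_def algebra_simps)
      have qs: "cross q (p - j0) = cross q (p - j1) + cross q d" "cross q (j0 - p) = - cross q (p - j0)"
        "cross q (j1 - p) = - cross q (p - j1)"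
        by (simp_all add: d_def cross_arith)
      consider "cross q (p - j1) \<ge> 0" | "cross q (p - j0) \<le> 0" | "cross q (p - j0) \<ge> 0" "cross q (p - j1) \<le> 0" by linarith
      then show ?thesis
      proof cases
        case 1
        show ?thesis
          using three(1,2)[OF J(1,3) p, of 1] 1 qd qs J(2,4) unfolding * by force
      next
        case 2
        show ?thesis
          using three(1,2)[OF p J(1,3), of 1] 2 qd qs J(2,4) unfolding * by force
      next
        case 3
        show ?thesis
          using three(1,2)[OF J(1) p J(3), of 1] 3 qd qs J(2,4) unfolding * by force
      qed
    qed
    obtain e w w0 g where ew: "e \<in> A" "e + w \<in> A" "gcd (fst w) (snd w) = 1" "cross w q > 0"
      "\<And>p. p \<in> A \<Longrightarrow> cross w (p - e) \<ge> 0" "\<And>p. cross w (p - e) = 0 \<longleftrightarrow> cross (j1 - j0) (p - j0) = 0"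
      "{e, e + w} = {j0, j0 + w0}" "g \<ge> 1" "j1 - j0 = (g * fst w0, g * snd w0)"
      by (rule edge_through[OF J(1,3), of 1 q]) (use J(5) sgn in \<open>auto simp: d_def\<close>)
    have w0A: "j0 + w0 \<in> A" using ew(1,2,7) by (metis insertI1 insert_iff singletonD)
    \<comment> \<open>This lattice point is on the segment from \<open>j0\<close> to
      \<open>j1\<close>, so the collinear case of \<open>three_points\<close> carries over the
      nonvanishing at the ends.\<close>
    have "v (j0 + w0) \<noteq> 0"
    proof -
      have gd: "cross q d = g * cross q w0" unfolding d_def ew(9) by (simp add: cross_arith)
      then have c: "cross q w0 > 0" using qd(2) ew(8) by (simp add: zero_less_mult_iff)
      have "cross q (j1 - (j0 + w0)) = (g - 1) * cross q w0"
        using gd by (simp add: d_def cross_arith algebra_simps)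
      then have "cross q (j1 - (j0 + w0)) \<ge> 0" using c ew(8) by simp
      moreover have "cross (j0 + w0 - j0) (j1 - (j0 + w0)) = 0"
      proof -
        have e: "j1 - (j0 + w0) = (g * fst w0, g * snd w0) - w0" using ew(9) by (simp add: algebra_simps)
        show ?thesis unfolding e by (simp add: cross_arith)
      qed
      ultimately show ?thesis
        using three(3)[OF J(1) w0A J(3), of 1] c qd J(2,4) by auto
    qed
    then have "v e \<noteq> 0 \<and> v (e + w) \<noteq> 0" using ew(7) J(2) by (metis insertI1 insert_iff singletonD)
    moreover have "\<forall>p\<in>A. v p \<noteq> 0 \<longrightarrow> cross w (p - e) = 0" using sgn unfolding ew(6) d_def by blast
    ultimately show ?thesis using that[OF ew(1-4)] ew(5) by blast
  next
    case False
    then have single: "\<And>p. p \<in> A \<Longrightarrow> p \<noteq> j \<Longrightarrow> v p = 0" by blast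
    obtain q' where q': "cross q q' = 1" using primitive_complement[OF q] by blast
    obtain p where p: "p \<in> A" "cross q (p - j) \<noteq> 0" by (rule off_line[OF q])
    define \<sigma> where "\<sigma> = sgn (cross q (p - j))"
    have \<sigma>: "\<sigma> = 1 \<or> \<sigma> = -1" "\<sigma> * cross q (p - j) > 0" using p(2) by (auto simp: \<sigma>_def sgn_if)
    define Q where "Q = {p \<in> A. \<sigma> * cross q (p - j) > 0}"
    \<comment> \<open>The numerator is the coefficient of \<open>q\<close> in \<open>p - j\<close>
      with respect to the basis \<open>q\<close>, \<open>q'\<close>, the denominator the distance of
      the columns. The least slope on the side \<open>\<sigma>\<close> gives the lower edge that
      starts at \<open>j\<close>.\<close>
    define slope where "slope = (\<lambda>p. real_of_int (cross (p - j) q') / real_of_int (\<sigma> * cross q (p - j)))"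
    have "p \<in> Q" "finite Q" using finite_A p \<sigma> by (simp_all add: Q_def)
    then obtain j1 where j1: "j1 \<in> Q" "\<And>p. p \<in> Q \<Longrightarrow> slope j1 \<le> slope p"
      using ex_is_arg_min_if_finite[of Q slope] by (auto simp: is_arg_min_linorder)
    have j1A: "j1 \<in> A" "\<sigma> * cross q (j1 - j) > 0" using j1 by (auto simp: Q_def)
    define d where "d = j1 - j"
    have exp: "cross x y = cross x q' * cross q y - cross q x * cross y q'" for x y
    proof -
      have "cross x y = cross x y * cross q q'" using q' by simp
      also have "\<dots> = cross x q' * cross q y - cross q x * cross y q'" by (simp add: cross_def algebra_simps)
      finally show ?thesis .
    qed
    have clear: "x * w \<le> z * y" if "x / y \<le> z / w" "0 < y" "0 < w" for x y z w :: real
      using that by (simp add: field_simps)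
    have le: "\<sigma> * cross d (p - j) \<le> 0 \<and> (cross d (p - j) = 0 \<longrightarrow> p \<noteq> j \<longrightarrow> \<sigma> * cross q (p - j) > 0)"
      if p: "p \<in> A" for p
    proof -
      consider "\<sigma> * cross q (p - j) > 0" | "cross q (p - j) = 0" | "\<sigma> * cross q (p - j) < 0"
        using \<sigma>(1) by fastforce
      then show ?thesis
      proof cases
        case 1
        then have "slope j1 \<le> slope p" using j1(2) p by (simp add: Q_def)
        then have "real_of_int (cross d q') / real_of_int (\<sigma> * cross q d) \<le>
            real_of_int (cross (p - j) q') / real_of_int (\<sigma> * cross q (p - j))"
          by (simp only: slope_def d_def)
        moreover have "0 < real_of_int (\<sigma> * cross q d)" "0 < real_of_int (\<sigma> * cross q (p - j))"
          using 1 j1A(2) by (simp_all only: of_int_0_less_iff d_def)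
        ultimately have "real_of_int (cross d q') * real_of_int (\<sigma> * cross q (p - j)) \<le>
            real_of_int (cross (p - j) q') * real_of_int (\<sigma> * cross q d)"
          by (intro clear)
        then have "cross d q' * (\<sigma> * cross q (p - j)) \<le> cross (p - j) q' * (\<sigma> * cross q d)"
          by (simp only: of_int_le_iff flip: of_int_mult)
        moreover have "\<sigma> * cross d (p - j) = cross d q' * (\<sigma> * cross q (p - j)) - cross (p - j) q' * (\<sigma> * cross q d)"
          unfolding exp[of d "p - j"] by (simp add: algebra_simps)
        ultimately have "\<sigma> * cross d (p - j) \<le> 0" by linarith
        then show ?thesis using 1 by blast
      next
        case 2
        then obtain k where k: "k \<ge> 0" "p - j = (k * fst q, k * snd q)"
          using same_column[OF P q j(1) p j(2)] by blast
        have "cross d (p - j) = - (k * cross q d)"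
          unfolding k(2) by (simp add: cross_arith cross_commute[of d])
        then have e: "\<sigma> * cross d (p - j) = - (k * (\<sigma> * cross q d))" by simp
        then have "\<sigma> * cross d (p - j) \<le> 0" using k(1) j1A(2) by (simp add: d_def)
        moreover have "p = j" if "cross d (p - j) = 0"
          using e that j1A(2) k(2) by (auto simp: d_def prod_eq_iff)
        ultimately show ?thesis by blast
      next
        \<comment> \<open>On the other side of the column of \<open>j\<close>: as \<open>v j\<close>
          is nonzero, \<open>j\<close> is not above the chord from \<open>p\<close> to
          \<open>j1\<close>, and it is not on the chord either, because all coordinates except that
          of \<open>j\<close> vanish.\<close>
        case 3
        have c: "cross (j - p) (j1 - j) = cross d (p - j)" by (simp add: d_def cross_def algebra_simps)
        have m: "0 \<le> \<sigma> * cross q (j - p)" "0 \<le> \<sigma> * cross q (j1 - j)" "0 < \<sigma> * cross q (j1 - p)" "0 < \<sigma> * cross q (j - p)"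
          using 3 j1A(2) by (simp_all add: cross_arith algebra_simps)
        have "\<not> \<sigma> * cross d (p - j) \<ge> 1"
          using three(1)[OF p j(1) j1A(1) m(1-3)] j(2) unfolding c by blast
        moreover have "cross d (p - j) \<noteq> 0"
        proof
          assume "cross d (p - j) = 0"
          moreover have "p \<noteq> j" using 3 by (auto simp: cross_def)
          ultimately show False
            using three(3)[OF p j(1) j1A(1) m(1-3)] j(2) j1A(2) single[OF p] unfolding c by blast
        qed
        ultimately show ?thesis by linarith
      qed
    qed
    obtain e w w0 g where ew: "e \<in> A" "e + w \<in> A" "gcd (fst w) (snd w) = 1" "cross w q > 0"
      "\<And>p. p \<in> A \<Longrightarrow> cross w (p - e) \<ge> 0" "\<And>p. cross w (p - e) = 0 \<longleftrightarrow> cross (j1 - j) (p - j) = 0"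
      "{e, e + w} = {j, j + w0}" "g \<ge> 1" "j1 - j = (g * fst w0, g * snd w0)"
      by (rule edge_through[OF j(1) j1A(1) \<sigma>(1) j1A(2)]) (use le in \<open>auto simp: d_def\<close>)
    \<comment> \<open>The witness is \<open>- \<sigma>\<close> times \<open>q\<close>, for which
      \<open>cross (p - j) u\<close> is \<open>\<sigma> * cross q (p - j)\<close>, positive along
      the chosen edge.\<close>
    have "\<forall>p\<in>A. cross w (p - e) = 0 \<longrightarrow> p \<noteq> j \<longrightarrow> cross (p - j) (- \<sigma> * fst q, - \<sigma> * snd q) > 0"
    proof (intro ballI impI)
      fix p assume "p \<in> A" "cross w (p - e) = 0" "p \<noteq> j"
      then have "\<sigma> * cross q (p - j) > 0" using le ew(6) by (simp add: d_def)
      then show "cross (p - j) (- \<sigma> * fst q, - \<sigma> * snd q) > 0"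
        by (simp add: cross_def algebra_simps)
    qed
    moreover have c: "cross w (j - e) = 0" unfolding ew(6) by (simp add: cross_def)
    moreover have "\<forall>p\<in>A. v p \<noteq> 0 \<longrightarrow> cross w (p - e) = 0" using c single by blast
    moreover have "\<forall>p\<in>A. cross w (p - e) \<ge> 0" using ew(5) by blast
    ultimately show ?thesis using that[OF ew(1-4)] j single by blast
  qed
qed

text \<open>Two nonzero coordinates at neighbouring lattice points of the edge put \<open>v\<close>
  in the open orbit of the edge, up to scaling; a point supported at a vertex is a limit of points
  of that orbit.\<close>

lemma face_in_closed:
  assumes v: "toric v" "pt v \<in> X" and P: "\<forall>k l l'. bal q k l l' \<longrightarrow> k \<ge> 1 \<longrightarrow> vm v l = 0"
    and q: "gcd (fst q) (snd q) = 1" and Z: "closedin (zariski A) Z"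
    and faces: "\<And>e w c. e \<in> A \<Longrightarrow> e + w \<in> A \<Longrightarrow> gcd (fst w) (snd w) = 1 \<Longrightarrow> cross w q > 0 \<Longrightarrow>
      \<forall>p\<in>A. cross w (p - e) \<ge> 0 \<Longrightarrow> c \<in> torus2 \<Longrightarrow> pt (face_vec w e c) \<in> Z"
  shows "pt v \<in> Z"
proof -
  obtain e w where ew: "e \<in> A" "e + w \<in> A" "gcd (fst w) (snd w) = 1" "cross w q > 0"
    "\<forall>p\<in>A. cross w (p - e) \<ge> 0" "\<forall>p\<in>A. v p \<noteq> 0 \<longrightarrow> cross w (p - e) = 0"
    and alt: "v e \<noteq> 0 \<and> v (e + w) \<noteq> 0 \<or>
     (\<exists>j u. j \<in> A \<and> cross w (j - e) = 0 \<and> v j \<noteq> 0 \<and> (\<forall>p\<in>A. p \<noteq> j \<longrightarrow> v p = 0) \<and>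
       (\<forall>p\<in>A. cross w (p - e) = 0 \<longrightarrow> p \<noteq> j \<longrightarrow> cross (p - j) u > 0))"
    by (rule lower_edge[OF v P q])
  have face: "pt (face_vec w e c) \<in> Z" if "c \<in> torus2" for c
    using faces[OF ew(1-4) _ that] ew(5) by blast
  have vA: "v \<in> coords A" by (rule pt_X_coords[OF v(2)])
  from alt show ?thesis
  proof
    assume nz: "v e \<noteq> 0 \<and> v (e + w) \<noteq> 0"
    obtain w' where w': "cross w w' = 1" using primitive_complement[OF ew(3)] by blast
    define x where "x = v (e + w) / v e"
    have "x \<noteq> 0" using nz by (simp add: x_def)
    then obtain c where c: "c \<in> torus2" "mon c w = x" "mon c w' = 1"
      using mon_unimodular_surj[OF w', of x 1] by auto
    have "v p = v e / mon c e * face_vec w e c p" for p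
    proof (cases "p \<in> A \<and> cross w (p - e) = 0")
      case False
      then have "v p = 0" using ew(6) coords_outside[OF vA] by blast
      then show ?thesis using False unfolding face_vec_def by (simp only: if_False mult_zero_right)
    next
      case True
      then obtain k where k: "p - e = (k * fst w, k * snd w)" using cross_eq_0_multiple[OF ew(3)] by blast
      define k1 k2 where "k1 = nat k" and "k2 = nat (- k)"
      have kk: "k = int k1 - int k2" by (simp add: k1_def k2_def)
      have "vm v (p # replicate k2 (e + w) @ replicate k1 e) = vm v (e # replicate k1 (e + w) @ replicate k2 e)"
      proof (rule toricD[OF v(1)])
        have "p = e + (k * fst w, k * snd w)" unfolding k[symmetric] by simp
        then show "lsum (p # replicate k2 (e + w) @ replicate k1 e) = lsum (e # replicate k1 (e + w) @ replicate k2 e)"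
          by (simp add: kk prod_eq_iff algebra_simps)
      qed (use True ew in auto)
      then have "v p * ((x * v e) ^ k2 * v e ^ k1) = v e * ((x * v e) ^ k1 * v e ^ k2)"
        using nz by (simp add: x_def)
      then have "v e ^ (k1 + k2) * (v p * x ^ k2) = v e ^ (k1 + k2) * (v e * x ^ k1)"
        by (simp add: power_mult_distrib power_add algebra_simps)
      then have "v p * x ^ k2 = v e * x ^ k1" using nz by simp
      moreover have "x powi k * x ^ k2 = x ^ k1" using \<open>x \<noteq> 0\<close> by (simp add: kk power_int_diff)
      ultimately have "v p * x ^ k2 = (v e * x powi k) * x ^ k2" by simp
      then have "v p = v e * x powi k" using \<open>x \<noteq> 0\<close> by simp
      also have "x powi k = mon c (p - e)" unfolding k mon_scale[OF c(1)] prod.collapse c(2) ..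
      finally show ?thesis using True c(1) by (simp add: face_vec_def mon_diff)
    qed
    then have "v = (\<lambda>p. v e / mon c e * face_vec w e c p)" by blast
    then have "pt v = pt (\<lambda>p. v e / mon c e * face_vec w e c p)" by (rule arg_cong)
    moreover have "v e / mon c e \<noteq> 0" using nz c(1) by simp
    ultimately have "pt v = pt (face_vec w e c)" by (simp only: pt_scale not_False_eq_True)
    then show ?thesis using face[OF c(1)] by simp
  next
    assume "\<exists>j u. j \<in> A \<and> cross w (j - e) = 0 \<and> v j \<noteq> 0 \<and> (\<forall>p\<in>A. p \<noteq> j \<longrightarrow> v p = 0) \<and>
       (\<forall>p\<in>A. cross w (p - e) = 0 \<longrightarrow> p \<noteq> j \<longrightarrow> cross (p - j) u > 0)"
    then obtain j u where j: "j \<in> A" "cross w (j - e) = 0" "v j \<noteq> 0" "\<forall>p\<in>A. p \<noteq> j \<longrightarrow> v p = 0"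
      "\<forall>p\<in>A. cross w (p - e) = 0 \<longrightarrow> p \<noteq> j \<longrightarrow> cross (p - j) u > 0" by blast
    \<comment> \<open>An arc inside the edge orbit that tends to the vertex: the exponents
      \<open>cross (p - j) u\<close> are 0 at \<open>j\<close> and positive at the other lattice
      points of the edge.\<close>
    define V :: "int \<times> int \<Rightarrow> complex poly" where
      "V = (\<lambda>p. if p \<in> A \<and> cross w (p - e) = 0 then monom 1 (nat (cross (p - j) u)) else 0)"
    define i :: "int \<times> int \<Rightarrow> complex" where "i = (\<lambda>p. if p = j then 1 else 0)"
    have V0: "(\<lambda>p. poly (V p) 0) = i"
    proof
      fix p show "poly (V p) 0 = i p"
        using j(1,2,5) by (cases "p = j") (auto simp: V_def i_def poly_monom power_0_left cross_def)
    qed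
    have "v = (\<lambda>p. v j * i p)"
      using j(4) vA by (auto simp: fun_eq_iff i_def coords_def)
    then have "pt v = pt i" using j(3) by (metis pt_scale)
    moreover have "pt (\<lambda>p. poly (V p) 0) \<in> Z"
    proof (rule zariski_arc_limit[OF Z])
      show "(\<lambda>p. poly (V p) 0) \<in> coords A"
      proof -
        have "i j \<noteq> 0" by (simp add: i_def)
        then have "i \<noteq> (\<lambda>_. 0)" by (auto simp only:)
        then show ?thesis unfolding V0 using j(1) by (auto simp: coords_def i_def)
      qed
      fix z :: complex assume z: "z \<noteq> 0"
      have "(1, 1) \<in> torus2" by (simp add: torus2_def)
      then obtain c where c: "c \<in> torus2" "\<And>p. mon c p = mon (1, 1) p * z powi cross (- u) p"
        using torus_arc[OF _ z] by blast
      have "poly (V p) z = z powi (- cross j u) * face_vec w e c p" for p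
      proof (cases "p \<in> A \<and> cross w (p - e) = 0")
        case True
        then have "cross (p - j) u \<ge> 0" using j(5) by (cases "p = j") (auto simp: cross_def)
        then have "poly (V p) z = z powi cross (p - j) u"
          using True by (simp add: V_def poly_monom power_int_def)
        also have "cross (p - j) u = cross (- u) p - cross j u" by (simp add: cross_def algebra_simps)
        finally show ?thesis
          using True z c(2)[of p] by (simp add: face_vec_def power_int_diff power_int_minus divide_inverse mon_def)
      qed (auto simp: V_def face_vec_def)
      then have "(\<lambda>p. poly (V p) z) = (\<lambda>p. z powi (- cross j u) * face_vec w e c p)" by blast
      then have "pt (\<lambda>p. poly (V p) z) = pt (face_vec w e c)" using z by simp
      then show "pt (\<lambda>p. poly (V p) z) \<in> Z" using face[OF c(1)] by simp
    qed
    ultimately show ?thesis unfolding V0 by simp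
  qed
qed

lemma graph_subset_G: "graph q \<subseteq> G q"
  unfolding graph_def using torus_G_iff[of _ _ q] by blast

lemma face_vec_X:
  assumes "e \<in> A" "\<And>p. p \<in> A \<Longrightarrow> cross w (p - e) \<ge> 0" "c \<in> torus2"
  shows "pt (face_vec w e c) \<in> X"
  using face_limit[OF assms closedin_G graph_subset_G] G_subset by blast

text \<open>A lattice point at height one above the edge allows the character to be written as a
  quotient of monomials exactly one of which vanishes on the edge orbit. So the rational map is
  defined there, with value 0 or infinity according to the sign of
  \<open>cross w (qv h)\<close>.\<close>

lemma face_in_fibre:
  assumes e: "e \<in> A" "e + w \<in> A" "gcd (fst w) (snd w) = 1" and w: "\<forall>p\<in>A. cross w (p - e) \<ge> 0"
    and c: "c \<in> torus2" and nz: "cross w (qv h) \<noteq> 0"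
  shows "pt (face_vec w e c) \<in> R h (face_value (qv h) w c)"
proof -
  define q where "q = qv h"
  have X: "pt (face_vec w e c) \<in> X" using face_vec_X[of e w c] e w c by blast
  obtain p where p: "p \<in> A" "cross w (p - e) \<noteq> 0" by (rule off_line[OF e(3)])
  then have "cross w (p - e) \<ge> 1" using w by force
  obtain r where r: "e + r \<in> A" "cross w r = 1" by (rule height_one[OF e(1,2) p(1) e(3) \<open>cross w (p - e) \<ge> 1\<close>])
  have lists: "\<exists>l l'. bal x 1 l l' \<and> vm (face_vec w e c) l = 0 \<and> vm (face_vec w e c) l' \<noteq> 0"
    if x: "cross w x > 0" for x
  proof -
    define \<alpha> \<beta> where "\<alpha> = cross x r" and "\<beta> = cross w x"
    have xe: "x = (\<alpha> * fst w + \<beta> * fst r, \<alpha> * snd w + \<beta> * snd r)"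
      using unimodular_expansion[OF r(2), of x] by (simp add: \<alpha>_def \<beta>_def)
    define a1 a2 b where ab: "a1 = nat \<alpha>" "a2 = nat (- \<alpha>)" "b = nat \<beta>"
    have \<alpha>: "\<alpha> = int a1 - int a2" "\<beta> = int b" "b > 0" using x by (auto simp: ab \<beta>_def)
    \<comment> \<open>Only this list leaves the edge, through the positive number \<open>b\<close>
      of copies of \<open>e + r\<close>; hence its monomial vanishes on the face and the other one
      does not.\<close>
    let ?l = "replicate a1 (e + w) @ replicate b (e + r) @ replicate a2 e"
    let ?l' = "replicate a2 (e + w) @ replicate (a1 + b) e"
    have "fst x = \<alpha> * fst w + \<beta> * fst r" "snd x = \<alpha> * snd w + \<beta> * snd r"
      by (subst xe, simp)+
    then have "lsum ?l = lsum ?l' + x"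
      by (simp add: \<alpha> prod_eq_iff algebra_simps)
    then have "bal x 1 ?l ?l'" using e r by (auto simp: bal_def)
    moreover have "vm (face_vec w e c) ?l = 0" using r \<alpha>(3) by (simp add: face_vec_def)
    moreover have "vm (face_vec w e c) ?l' \<noteq> 0"
      using e c by (simp add: face_vec_def cross_arith)
    ultimately show ?thesis by blast
  qed
  show ?thesis
  proof (cases "cross w q > 0")
    case True
    then obtain l l' where l: "bal q 1 l l'" "vm (face_vec w e c) l = 0" "vm (face_vec w e c) l' \<noteq> 0"
      using lists by blast
    then have "pt (\<lambda>b. if b then vm (face_vec w e c) l else vm (face_vec w e c) l') = P1_affine 0"
      by (simp add: pt_eq_P1_affine_iff)
    then show ?thesis
      using rational_fibre_lower[of h l l', OF _ X] l True by (simp add: face_value_def q_def)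
  next
    case False
    then have "cross w (- q) > 0" using nz by (simp add: q_def cross_arith)
    then obtain l' l where l: "bal (- q) 1 l' l" "vm (face_vec w e c) l' = 0" "vm (face_vec w e c) l \<noteq> 0"
      using lists by blast
    then have "pt (\<lambda>b. if b then vm (face_vec w e c) l else vm (face_vec w e c) l') = P1_infinity"
      by (simp add: pt_eq_P1_infinity_iff)
    then show ?thesis
      using rational_fibre_lower[of h l l', OF _ X] l False nz by (simp add: face_value_def q_def bal_uminus)
  qed
qed

lemma extremal_points:
  obtains p0 p1 where "p0 \<in> A" "p1 \<in> A" "\<And>p. p \<in> A \<Longrightarrow> cross q (p - p0) \<ge> 0" "\<And>p. p \<in> A \<Longrightarrow> cross q (p1 - p) \<ge> 0"
proof -
  let ?S = "cross q ` A"
  have S: "finite ?S" "?S \<noteq> {}" using finite_A A_nonempty by auto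
  obtain p0 p1 where p: "p0 \<in> A" "cross q p0 = Min ?S" "p1 \<in> A" "cross q p1 = Max ?S"
    using Min_in[OF S] Max_in[OF S] by (metis imageE)
  show ?thesis
    by (rule that[OF p(1,3)]) (use p S in \<open>auto simp: cross_arith\<close>)
qed

lemma extremal_distinct:
  assumes q: "gcd (fst q) (snd q) = 1" and p: "\<And>p. p \<in> A \<Longrightarrow> cross q (p - p0) \<ge> 0" "\<And>p. p \<in> A \<Longrightarrow> cross q (p1 - p) \<ge> 0"
  shows "cross q (p1 - p0) > 0"
proof -
  obtain r where "r \<in> A" "cross q (r - p0) \<noteq> 0" by (rule off_line[OF q])
  then show ?thesis using p(1)[of r] p(2)[of r] by (simp add: cross_arith)
qed

text \<open>After rescaling by a torus point over \<open>z\<close>, the equations only depend on \<open>cross q\<close>, so that the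
  fibre consists of an orbit and its two end points.\<close>

lemma G_affine_fibre:
  assumes q: "gcd (fst q) (snd q) = 1" and z: "z \<noteq> 0" and G: "(P1_affine z, pt v) \<in> G q"
    and c: "c \<in> torus2" "mon c q = z"
    and p: "p0 \<in> A" "p1 \<in> A" "\<And>p. p \<in> A \<Longrightarrow> cross q (p - p0) \<ge> 0" "\<And>p. p \<in> A \<Longrightarrow> cross q (p1 - p) \<ge> 0"
  shows "pt v \<in> TT \<or> pt v = pt (face_vec q p0 c) \<or> pt v = pt (face_vec (- q) p1 c)"
proof -
  have vX: "pt v \<in> X" using G G_subset by blast
  then have vA: "v \<in> coords A" by (rule pt_X_coords)
  have eq: "vm v l = z ^ k * vm v l'" if "bal q k l l'" for k l l'
  proof -
    have "(pt (\<lambda>b. if b then z else 1), pt v) \<in> G q" using G by (simp add: P1_affine_def)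
    then show ?thesis using that unfolding mem_G by fastforce
  qed
  define y where "y = (\<lambda>p. v p / mon c p)"
  have vy: "v = (\<lambda>p. y p * mon c p)" using c(1) by (simp add: y_def)
  have key: "vm y l = vm y l'"
    if l: "set l \<subseteq> A" "set l' \<subseteq> A" "length l = length l'" "cross q (lsum l) = cross q (lsum l')" for l l'
  proof -
    have *: "vm y l = vm y l'" if b: "bal q k l l'" for k l l'
    proof -
      have "lsum l = lsum l' + (int k * fst q, int k * snd q)" using b by (simp add: bal_def)
      then have "mon c (lsum l) = z ^ k * mon c (lsum l')"
        using mon_add[OF c(1)] mon_scale[OF c(1), of "int k" "fst q" "snd q"] c(2) by simp
      moreover have "vm y l * mon c (lsum l) = z ^ k * (vm y l' * mon c (lsum l'))"
        using eq[OF b] unfolding vy vm_mult vm_mon[OF c(1)] .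
      ultimately show ?thesis using z c(1) by simp
    qed
    have "cross q (lsum l - lsum l') = 0" using l(4) by (simp add: cross_arith)
    then obtain k where k: "lsum l - lsum l' = (k * fst q, k * snd q)"
      using cross_eq_0_multiple[OF q] by blast
    show ?thesis
    proof (cases "k \<ge> 0")
      case True
      then have "bal q (nat k) l l'" using k l by (auto simp: bal_def prod_eq_iff algebra_simps)
      then show ?thesis by (rule *)
    next
      case False
      then have "bal q (nat (- k)) l' l" using k l by (auto simp: bal_def prod_eq_iff algebra_simps)
      then show ?thesis using * by metis
    qed
  qed
  have same: "y p = y p'" if "p \<in> A" "p' \<in> A" "cross q p = cross q p'" for p p'
    using key[of "[p]" "[p']"] that by simp
  define n where "n = nat (cross q (p1 - p0))"
  have n: "int n = cross q p1 - cross q p0" "n > 0"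
    using extremal_distinct[OF q p(3,4)] by (auto simp: n_def cross_arith)
  \<comment> \<open>\<open>n\<close> copies of \<open>r\<close> balance against the extreme points,
    each weighted by the distance of the other one. So the coordinates at \<open>p0\<close> and
    \<open>p1\<close> decide which coordinates vanish.\<close>
  have interp: "y r ^ n = y p0 ^ nat (cross q (p1 - r)) * y p1 ^ nat (cross q (r - p0))" if r: "r \<in> A" for r
  proof -
    have cr: "cross q (int k * fst x, int k * snd x) = int k * cross q x" for k x
      by (simp add: cross_arith)
    have i: "int (nat (cross q (p1 - r))) = cross q p1 - cross q r" "int (nat (cross q (r - p0))) = cross q r - cross q p0"
      using p(3)[OF r] p(4)[OF r] by (auto simp: cross_arith)
    have "vm y (replicate n r) = vm y (replicate (nat (cross q (p1 - r))) p0 @ replicate (nat (cross q (r - p0))) p1)"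
    proof (rule key)
      show "length (replicate n r) = length (replicate (nat (cross q (p1 - r))) p0 @ replicate (nat (cross q (r - p0))) p1)"
        using i n(1) unfolding length_replicate length_append by linarith
      show "cross q (lsum (replicate n r)) = cross q (lsum (replicate (nat (cross q (p1 - r))) p0 @ replicate (nat (cross q (r - p0))) p1))"
        unfolding lsum_simps cross_arith(1) cr unfolding i n(1) by (simp add: algebra_simps)
    qed (use r p in auto)
    then show ?thesis by simp
  qed
  obtain j where j: "j \<in> A" "y j \<noteq> 0"
    using vA c(1) by (auto simp: coords_def fun_eq_iff y_def)
  have face: "pt v = pt (face_vec w e c)" if e: "e \<in> A" "w = q \<or> w = - q"
    and off: "\<And>p. p \<in> A \<Longrightarrow> cross w (p - e) \<noteq> 0 \<Longrightarrow> y p = 0" for w e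
  proof -
    have on: "y p = y e" if "p \<in> A" "cross w (p - e) = 0" for p
      by (rule same) (use that e in \<open>auto simp: cross_arith\<close>)
    have "v = (\<lambda>p. y e * face_vec w e c p)"
    proof
      fix p show "v p = y e * face_vec w e c p"
      proof (cases "p \<in> A")
        case True
        then show ?thesis
          using on[of p] off[of p] by (cases "cross w (p - e) = 0") (simp_all add: face_vec_def vy)
      qed (use coords_outside[OF vA] in \<open>simp add: face_vec_def\<close>)
    qed
    moreover have "y e \<noteq> 0" using on[OF j(1)] off[OF j(1)] j(2) by metis
    ultimately show ?thesis by (metis pt_scale)
  qed
  show ?thesis
  proof (cases "y p0 = 0 \<or> y p1 = 0")
    case False
    then have "y p \<noteq> 0" if "p \<in> A" for p using interp[OF that] n(2) by (metis mult_eq_0_iff power_eq_0_iff power_not_zero)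
    then have nz: "v p \<noteq> 0" if "p \<in> A" for p using that c(1) by (simp add: y_def)
    obtain e w w' where e: "e \<in> A" "e + w \<in> A" "e + w' \<in> A" "cross w w' = 1" by (rule unimodular_triangle)
    then obtain c' where "c' \<in> torus2" "pt v = pt (tvec c')"
      using toric_in_TT[OF vX e] nz by metis
    then show ?thesis by (simp add: TT_eq)
  next
    case True
    then show ?thesis
    proof
      assume 0: "y p0 = 0"
      have "pt v = pt (face_vec (- q) p1 c)"
      proof (rule face)
        fix p assume "p \<in> A" "cross (- q) (p - p1) \<noteq> 0"
        then have "nat (cross q (p1 - p)) > 0" using p(4)[of p] by (simp add: cross_arith)
        from zero_power[OF this] show "y p = 0"
          using interp[OF \<open>p \<in> A\<close>] n(2) unfolding 0 by (metis mult_zero_left power_eq_0_iff)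
      qed (use p in auto)
      then show ?thesis by blast
    next
      assume 0: "y p1 = 0"
      have "pt v = pt (face_vec q p0 c)"
      proof (rule face)
        fix p assume "p \<in> A" "cross q (p - p0) \<noteq> 0"
        then have "nat (cross q (p - p0)) > 0" using p(3)[of p] by (simp add: cross_arith)
        from zero_power[OF this] show "y p = 0"
          using interp[OF \<open>p \<in> A\<close>] n(2) unfolding 0 by (metis mult_zero_right power_eq_0_iff)
      qed (use p in auto)
      then show ?thesis by blast
    qed
  qed
qed

lemma torus_over:
  assumes "gcd (fst q) (snd q) = 1" "z \<noteq> 0"
  obtains c where "c \<in> torus2" "mon c q = z"
proof -
  obtain q' where "cross q q' = 1" using primitive_complement[OF assms(1)] by blast
  then show ?thesis using mon_unimodular_surj[of q q' z 1] assms(2) that by auto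
qed

text \<open>The set \<open>Z\<close> is tested only on torus points and on open orbits of edges with
  \<open>cross w q\<close> nonzero; all other points of the fibre are limits of these. With
  \<open>Z\<close> the closure of a rational fibre this yields \<open>view_family_eq_G\<close>, with
  \<open>Z\<close> a slice of the closed graph it yields \<open>closure_graph\<close>.\<close>

lemma G_fibre_minimal:
  assumes q: "gcd (fst q) (snd q) = 1" and G: "(i, x) \<in> G q" and Z: "closedin (zariski A) Z"
    and torus: "\<And>c. c \<in> torus2 \<Longrightarrow> i = P1_affine (mon c q) \<Longrightarrow> pt (tvec c) \<in> Z"
    and faces: "\<And>e w c. e \<in> A \<Longrightarrow> e + w \<in> A \<Longrightarrow> gcd (fst w) (snd w) = 1 \<Longrightarrow> cross w q \<noteq> 0 \<Longrightarrow>
      \<forall>p\<in>A. cross w (p - e) \<ge> 0 \<Longrightarrow> c \<in> torus2 \<Longrightarrow> i = face_value q w c \<Longrightarrow> pt (face_vec w e c) \<in> Z"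
  shows "x \<in> Z"
proof -
  have ix: "i \<in> P1" "x \<in> X" using G G_subset by blast+
  obtain v where v: "x = pt v" using ix(2) X_subset by (auto simp: pspace_def)
  from ix(1) show ?thesis
  proof (cases rule: P1_cases)
    case (1 z)
    show ?thesis
    proof (cases "z = 0")
      case True
      have "(pt (\<lambda>b. if b then 0 else 1), pt v) \<in> G q" using G 1 True v by (simp add: P1_affine_def)
      then have P: "\<forall>k l l'. bal q k l l' \<longrightarrow> k \<ge> 1 \<longrightarrow> vm v l = 0" unfolding mem_G by (fastforce simp: power_0_left)
      show ?thesis
        unfolding v
      proof (rule face_in_closed[OF toric_X _ P q Z])
        show "pt v \<in> X" "pt v \<in> X" using ix v by auto
        fix e w c assume "e \<in> A" "e + w \<in> A" "gcd (fst w) (snd w) = 1" "cross w q > 0"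
          "\<forall>p\<in>A. cross w (p - e) \<ge> 0" "c \<in> torus2"
        then show "pt (face_vec w e c) \<in> Z" using 1 True by (intro faces) (auto simp: face_value_def)
      qed
    next
      case False
      obtain c where c: "c \<in> torus2" "mon c q = z" by (rule torus_over[OF q False])
      obtain p0 p1 where p: "p0 \<in> A" "p1 \<in> A" "\<And>p. p \<in> A \<Longrightarrow> cross q (p - p0) \<ge> 0"
        "\<And>p. p \<in> A \<Longrightarrow> cross q (p1 - p) \<ge> 0" by (rule extremal_points[of q]) blast
      have orbit: "pt (tvec c') \<in> Z" if "c' \<in> torus2" "mon c' q = mon c q" for c'
        using torus[of c'] that c 1 by simp
      have "pt v \<in> TT \<or> pt v = pt (face_vec q p0 c) \<or> pt v = pt (face_vec (- q) p1 c)"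
        by (rule G_affine_fibre[OF q False _ c p]) (use G 1 v in auto)
      then show ?thesis
      proof (elim disjE)
        assume "pt v \<in> TT"
        then obtain c' where c': "c' \<in> torus2" "pt v = pt (tvec c')" by (auto simp: TT_eq)
        then have "i = P1_affine (mon c' q)" using G v torus_G_iff by auto
        then show ?thesis using torus c' v by auto
      next
        assume "pt v = pt (face_vec q p0 c)"
        moreover have "pt (face_vec q p0 c) \<in> Z"
          by (rule face_limit_orbit[OF p(1,3) c(1) _ Z orbit]) (auto simp: cross_arith)
        ultimately show ?thesis using v by simp
      next
        assume "pt v = pt (face_vec (- q) p1 c)"
        moreover have "pt (face_vec (- q) p1 c) \<in> Z"
          by (rule face_limit_orbit[OF p(2) _ c(1) _ Z orbit]) (use p(4) in \<open>auto simp: cross_arith\<close>)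
        ultimately show ?thesis using v by simp
      qed
    qed
  next
    case 2
    have "(pt (\<lambda>b. if b then 1 else 0), pt v) \<in> G q" using G 2 v by (simp add: P1_infinity_def)
    then have "\<forall>k l l'. bal q k l' l \<longrightarrow> k \<ge> 1 \<longrightarrow> vm v l = 0" unfolding mem_G by (fastforce simp: power_0_left)
    then have P: "\<forall>k l l'. bal (- q) k l l' \<longrightarrow> k \<ge> 1 \<longrightarrow> vm v l = 0" unfolding bal_uminus .
    show ?thesis
      unfolding v
    proof (rule face_in_closed[OF toric_X _ P _ Z])
      show "pt v \<in> X" "pt v \<in> X" using ix v by auto
      show "gcd (fst (- q)) (snd (- q)) = 1" using q by simp
      fix e w c assume "e \<in> A" "e + w \<in> A" "gcd (fst w) (snd w) = 1" "cross w (- q) > 0"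
        "\<forall>p\<in>A. cross w (p - e) \<ge> 0" "c \<in> torus2"
      then show "pt (face_vec w e c) \<in> Z" using 2 by (intro faces) (auto simp: face_value_def cross_arith)
    qed
  qed
qed

lemma view_family_eq_G:
  assumes q: "gcd (fst (qv h)) (snd (qv h)) = 1"
  shows "view_family \<Gamma> h = G (qv h)"
proof (intro equalityI subsetI)
  fix y assume "y \<in> view_family \<Gamma> h"
  then obtain i x where "y = (i, x)" "i \<in> P1" "x \<in> zariski A closure_of (R h i)" by (auto simp: view_family_def)
  then show "y \<in> G (qv h)"
    using closure_fibre_subset_G[of TT "view_map \<Gamma> h" "qv h" i x] view_map_torus by auto
next
  fix y assume y: "y \<in> G (qv h)"
  obtain i x where ix: "y = (i, x)" by (cases y)
  have i: "i \<in> P1" using y ix G_subset by blast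
  have sub: "R h i \<subseteq> zariski A closure_of (R h i)"
    using rational_fibre_subset_X X_subset by (intro closure_of_subset) fastforce
  have "x \<in> zariski A closure_of (R h i)"
  proof (rule G_fibre_minimal[OF q y[unfolded ix]])
    show "pt (tvec c) \<in> zariski A closure_of R h i" if "c \<in> torus2" "i = P1_affine (mon c (qv h))" for c
      using sub torus_in_fibre[OF that(1), of h] that(2) by blast
    show "pt (face_vec w e c) \<in> zariski A closure_of R h i"
      if "e \<in> A" "e + w \<in> A" "gcd (fst w) (snd w) = 1" "cross w (qv h) \<noteq> 0"
      "\<forall>p\<in>A. cross w (p - e) \<ge> 0" "c \<in> torus2" "i = face_value (qv h) w c" for e w c
      using sub face_in_fibre[OF that(1-3,5,6,4)] that(7) by blast
  qed simp
  then show "y \<in> view_family \<Gamma> h" using ix i by (simp add: view_family_def)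
qed

lemma closure_graph:
  assumes q: "gcd (fst q) (snd q) = 1"
  shows "zariski_prod UNIV A closure_of graph q = G q"
proof
  show "zariski_prod UNIV A closure_of graph q \<subseteq> G q"
    using closure_of_minimal[OF graph_subset_G closedin_G] .
  let ?Z = "zariski_prod UNIV A closure_of graph q"
  have "graph q \<subseteq> ?Z"
    using graph_subset_G closedin_subset[OF closedin_G] by (intro closure_of_subset) blast
  note Z = closedin_closure_of[of "zariski_prod UNIV A" "graph q"] this
  show "G q \<subseteq> ?Z"
  proof
    fix y assume y: "y \<in> G q"
    obtain i x where ix: "y = (i, x)" by (cases y)
    have i: "i \<in> pspace UNIV" using y ix G_subset[of q] by (auto simp flip: P1_def)
    have "x \<in> fibre ?Z i"
    proof (rule G_fibre_minimal[OF q y[unfolded ix]])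
      show "closedin (zariski A) (fibre ?Z i)" by (rule closedin_slice[OF Z(1) i])
      show "pt (tvec c) \<in> fibre ?Z i" if "c \<in> torus2" "i = P1_affine (mon c q)" for c
        using Z(2) that by (auto simp: fibre_def graph_def)
      show "pt (face_vec w e c) \<in> fibre ?Z i"
        if "e \<in> A" "\<forall>p\<in>A. cross w (p - e) \<ge> 0" "c \<in> torus2" "i = face_value q w c" for e w c
        using face_limit[OF that(1) _ that(3) Z] that(2,4) by (simp add: fibre_def)
    qed
    then show "y \<in> ?Z" using ix by (simp add: fibre_def)
  qed
qed

end

section \<open>View families are toric families\<close>

text \<open>Monomials are grouped by their exponent of \<open>u True\<close>; the degree
  \<open>d\<close> then fixes the exponent of \<open>u False\<close>. This presents the form as a
  polynomial in the base coordinate, ready for division.\<close>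

lemma biform_bool_expand:
  fixes f :: "(bool + 'k \<Rightarrow> complex) \<Rightarrow> complex"
  assumes "biform d e f"
  obtains g where "\<forall>i. hform e (g i)"
    "\<forall>u v. f (case_sum u v) = (\<Sum>i\<le>d. u False ^ (d - i) * u True ^ i * g i v)"
proof -
  obtain F where F: "\<And>m. m \<in> Poly_Mapping.keys F \<Longrightarrow> wdeg (case_sum (\<lambda>_. Suc 0) (\<lambda>_. 0)) m = d \<and>
      wdeg (case_sum (\<lambda>_. 0) (\<lambda>_. Suc 0)) m = e" "f = mpoly_eval F"
    using assms by (auto simp: gform_def)
  define K where "K m = Inr -` Poly_Mapping.keys m" for m :: "(bool + 'k) \<Rightarrow>\<^sub>0 nat"
  define S where "S m = {Inl False, Inl True} \<union> Inr ` K m" for m :: "(bool + 'k) \<Rightarrow>\<^sub>0 nat"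
  define h where "h m v = Poly_Mapping.lookup F m * (\<Prod>k\<in>K m. v k ^ Poly_Mapping.lookup m (Inr k))"
    for m and v :: "'k \<Rightarrow> complex"
  have finK: "finite (K m)" for m unfolding K_def by (rule finite_vimageI) auto
  have S: "finite (S m)" "Poly_Mapping.keys m \<subseteq> S m" for m
  proof -
    show "finite (S m)" using finK by (simp add: S_def)
    show "Poly_Mapping.keys m \<subseteq> S m"
    proof
      fix x assume "x \<in> Poly_Mapping.keys m"
      then show "x \<in> S m" by (cases x) (auto simp: S_def K_def)
    qed
  qed
  have disj: "{Inl False, Inl True} \<inter> Inr ` K m = {}" for m by auto
  have deg: "Poly_Mapping.lookup m (Inl False) + Poly_Mapping.lookup m (Inl True) = d"
    "(\<Sum>k\<in>K m. Poly_Mapping.lookup m (Inr k)) = e" if "m \<in> Poly_Mapping.keys F" for m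
  proof -
    have 1: "wdeg w m = (\<Sum>x\<in>S m. Poly_Mapping.lookup m x * w x)" for w
      by (rule wdeg_superset[OF S])
    have 2: "(\<Sum>x\<in>S m. Poly_Mapping.lookup m x * w x) =
      Poly_Mapping.lookup m (Inl False) * w (Inl False) + Poly_Mapping.lookup m (Inl True) * w (Inl True) +
      (\<Sum>k\<in>K m. Poly_Mapping.lookup m (Inr k) * w (Inr k))" for w
      unfolding S_def using finK disj by (subst sum.union_disjoint) (auto simp: sum.reindex)
    from F(1)[OF that] show "Poly_Mapping.lookup m (Inl False) + Poly_Mapping.lookup m (Inl True) = d"
      "(\<Sum>k\<in>K m. Poly_Mapping.lookup m (Inr k)) = e" unfolding 1 2 by auto
  qed
  define g where "g i v = (\<Sum>m\<in>{m \<in> Poly_Mapping.keys F. Poly_Mapping.lookup m (Inl True) = i}. h m v)" for i v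
  have "\<forall>i. hform e (g i)"
    unfolding g_def
  proof (intro allI gform_sum)
    fix i m assume "m \<in> {m \<in> Poly_Mapping.keys F. Poly_Mapping.lookup m (Inl True) = i}"
    then have m: "m \<in> Poly_Mapping.keys F" by simp
    show "hform e (h m)"
      unfolding h_def
    proof (rule gform_cmult, rule gform_prod)
      show "hform (Poly_Mapping.lookup m (Inr k)) (\<lambda>v. v k ^ Poly_Mapping.lookup m (Inr k))" for k
        by (rule gform_power[OF hform_coord[OF refl]]) auto
      show "e = (\<Sum>k\<in>K m. Poly_Mapping.lookup m (Inr k))" using deg(2)[OF m] by simp
    qed (use finK in auto)
  qed
  moreover have "f (case_sum u v) = (\<Sum>i\<le>d. u False ^ (d - i) * u True ^ i * g i v)" for u v
  proof -
    have tm: "Poly_Mapping.lookup F m * (\<Prod>x\<in>Poly_Mapping.keys m. case_sum u v x ^ Poly_Mapping.lookup m x) =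
      u False ^ (d - Poly_Mapping.lookup m (Inl True)) * u True ^ Poly_Mapping.lookup m (Inl True) * h m v"
      if m: "m \<in> Poly_Mapping.keys F" for m
    proof -
      have "(\<Prod>x\<in>Poly_Mapping.keys m. case_sum u v x ^ Poly_Mapping.lookup m x) =
        (\<Prod>x\<in>S m. case_sum u v x ^ Poly_Mapping.lookup m x)" by (rule monomial_prod_superset[OF S])
      also have "\<dots> = u False ^ Poly_Mapping.lookup m (Inl False) * u True ^ Poly_Mapping.lookup m (Inl True) *
        (\<Prod>k\<in>K m. v k ^ Poly_Mapping.lookup m (Inr k))"
        unfolding S_def using finK disj by (subst prod.union_disjoint) (auto simp: prod.reindex)
      finally show ?thesis using deg(1)[OF m] by (simp add: h_def flip: deg(1)[OF m])
    qed
    have "f (case_sum u v) = (\<Sum>m\<in>Poly_Mapping.keys F.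
      u False ^ (d - Poly_Mapping.lookup m (Inl True)) * u True ^ Poly_Mapping.lookup m (Inl True) * h m v)"
      unfolding F(2) mpoly_eval_def by (rule sum.cong) (auto simp: tm)
    also have "\<dots> = (\<Sum>i\<le>d. \<Sum>m\<in>{m \<in> Poly_Mapping.keys F. Poly_Mapping.lookup m (Inl True) = i}.
      u False ^ (d - Poly_Mapping.lookup m (Inl True)) * u True ^ Poly_Mapping.lookup m (Inl True) * h m v)"
      by (rule sum.group[symmetric]) (use deg(1) in \<open>force+\<close>)
    also have "\<dots> = (\<Sum>i\<le>d. u False ^ (d - i) * u True ^ i * g i v)"
      by (simp add: g_def sum_distrib_left)
    finally show ?thesis .
  qed
  ultimately show ?thesis using that[of g] by blast
qed

lemma primitive_qv: "h \<in> primitive_viewangles \<Longrightarrow> gcd (fst (qv h)) (snd (qv h)) = 1"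
  by (auto simp: primitive_viewangles_def qv_def gcd.commute)

lemma snd_torus3: "p \<in> torus3 \<Longrightarrow> snd p \<in> torus2"
  by (auto simp: torus3_def torus2_def)

context polygon
begin

text \<open>Closure in two stages: the slices of \<open>Z\<close> over nonzero \<open>z\<close>
  contain the torus and hence \<open>X\<close>; then, for fixed \<open>x\<close>, arcs in the base
  lead to 0 and to infinity.\<close>

lemma P1_X_minimal:
  assumes Z: "closedin (zariski_prod UNIV A) Z"
    and sub: "\<And>z c. z \<noteq> 0 \<Longrightarrow> c \<in> torus2 \<Longrightarrow> (P1_affine z, pt (tvec c)) \<in> Z"
  shows "P1 \<times> X \<subseteq> Z"
proof -
  have 1: "(P1_affine z, x) \<in> Z" if z: "z \<noteq> 0" and x: "x \<in> X" for z x
  proof -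
    have "closedin (zariski A) (fibre Z (P1_affine z))"
      using Z by (rule closedin_slice) (simp flip: P1_def)
    moreover have "TT \<subseteq> fibre Z (P1_affine z)" using sub[OF z] by (auto simp: TT_eq fibre_def)
    ultimately have "X \<subseteq> fibre Z (P1_affine z)" unfolding toric_surface_def by (intro closure_of_minimal)
    then show ?thesis using x by (auto simp: fibre_def)
  qed
  show ?thesis
  proof clarify
    fix i x assume i: "i \<in> P1" and x: "x \<in> X"
    then obtain v where v: "x = pt v" "v \<in> coords A" using X_subset by (auto simp: pspace_def)
    from i show "(i, x) \<in> Z"
    proof (cases rule: P1_cases)
      case (1 z)
      show ?thesis
      proof (cases "z = 0")
        case True
        have e: "(\<lambda>b. poly (if b then [:0, 1:] else [:1:]) z) = (\<lambda>b. if b then z else 1)" for z :: complex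
          by (auto simp: fun_eq_iff)
        have "(pt (\<lambda>b. poly (if b then [:0, 1:] else [:1:]) 0), pt (\<lambda>p. poly [:v p:] 0)) \<in> Z"
          by (rule zariski_prod_arc_limit[OF Z])
            (use \<open>\<And>z x. z \<noteq> 0 \<Longrightarrow> x \<in> X \<Longrightarrow> (P1_affine z, x) \<in> Z\<close> x v in \<open>simp_all add: e flip: P1_affine_def\<close>)
        then show ?thesis using v 1 True unfolding e by (simp add: P1_affine_def)
      qed (use \<open>\<And>z x. z \<noteq> 0 \<Longrightarrow> x \<in> X \<Longrightarrow> (P1_affine z, x) \<in> Z\<close> x 1 in auto)
    next
      case 2
      have e: "(\<lambda>b. poly (if b then [:1:] else [:0, 1:]) z) = (\<lambda>b. if b then 1 else z)" for z :: complex
        by (auto simp: fun_eq_iff)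
      have a: "pt (\<lambda>b. if b then 1 else z) = P1_affine (inverse z)" if "z \<noteq> 0" for z
        using that by (simp add: pt_eq_P1_affine_iff)
      have "(pt (\<lambda>b. poly (if b then [:1:] else [:0, 1:]) 0), pt (\<lambda>p. poly [:v p:] 0)) \<in> Z"
        by (rule zariski_prod_arc_limit[OF Z]) (use 1 x v in \<open>simp_all add: e a\<close>)
      then show ?thesis using v 2 unfolding e by (simp add: P1_infinity_def)
    qed
  qed
qed

section \<open>Irreducibility and codimension of the total space\<close>

lemma laurent_tvec: "laurent (\<lambda>(z, s, t). tvec (s, t) p)"
proof (cases "p \<in> A")
  case True
  then show ?thesis using laurent_monom[of 0 "fst p" "snd p"] by (simp add: tvec_def mon_def)
next
  case False
  then show ?thesis using laurent_const[of 0] by (simp add: tvec_def case_prod_unfold)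
qed

lemma irreducible_P1_X: "irreducible_in (zariski_prod UNIV A) (P1 \<times> X)"
proof -
  define V where "V = (\<lambda>p :: complex \<times> complex \<times> complex. \<lambda>b. if b then fst p else 1)"
  define W where "W = (\<lambda>p :: complex \<times> complex \<times> complex. tvec (snd p))"
  let ?I = "(\<lambda>p. (pt (V p), pt (W p))) ` torus3"
  have irr: "irreducible_in (zariski_prod UNIV A) ?I"
  proof (rule irreducible_zariski_prod_torus_image)
    show "V p \<in> coords UNIV" for p by (simp add: V_def)
    show "laurent (\<lambda>p. V p j)" for j
      using laurent_monom[of 1 0 0] laurent_const[of 1] by (cases j) (simp_all add: V_def case_prod_unfold)
    show "W p \<in> coords A" if "p \<in> torus3" for p
      using tvec_coords[OF snd_torus3[OF that]] by (simp add: W_def)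
    show "laurent (\<lambda>p. W p j)" for j
      using laurent_tvec[of j] by (simp add: W_def case_prod_unfold)
  qed
  show ?thesis
  proof (rule irreducible_in_between[OF irr])
    have eq: "(pt (V p), pt (W p)) = (P1_affine (fst p), pt (tvec (snd p)))" for p
      by (simp add: V_def W_def P1_affine_def)
    show sub: "?I \<subseteq> P1 \<times> X"
      unfolding eq using TT_subset_X snd_torus3 by (auto simp: TT_eq)
    have "?I \<subseteq> topspace (zariski_prod UNIV A)" using sub X_subset by (auto simp flip: P1_def)
    from closure_of_subset[OF this] show "P1 \<times> X \<subseteq> zariski_prod UNIV A closure_of ?I"
    proof (intro P1_X_minimal)
      assume I: "?I \<subseteq> zariski_prod UNIV A closure_of ?I"
      fix z c assume "z \<noteq> (0 :: complex)" "c \<in> torus2"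
      then have "(z, c) \<in> torus3" by (auto simp: torus3_def torus2_def)
      then have "(pt (V (z, c)), pt (W (z, c))) \<in> ?I" by blast
      then show "(P1_affine z, pt (tvec c)) \<in> zariski_prod UNIV A closure_of ?I" using I eq[of "(z, c)"] by auto
    qed auto
  qed
qed

lemma irreducible_G:
  assumes "gcd (fst q) (snd q) = 1"
  shows "irreducible_in (zariski_prod UNIV A) (G q)"
proof -
  define V where "V = (\<lambda>p :: complex \<times> complex \<times> complex. \<lambda>b. if b then mon (snd p) q else 1)"
  define W where "W = (\<lambda>p :: complex \<times> complex \<times> complex. tvec (snd p))"
  have "irreducible_in (zariski_prod UNIV A) ((\<lambda>p. (pt (V p), pt (W p))) ` torus3)"
  proof (rule irreducible_zariski_prod_torus_image)
    show "V p \<in> coords UNIV" for p by (simp add: V_def)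
    show "laurent (\<lambda>p. V p j)" for j
      using laurent_monom[of 0 "fst q" "snd q"] laurent_const[of 1]
      by (cases j) (simp_all add: V_def mon_def case_prod_unfold)
    show "W p \<in> coords A" if "p \<in> torus3" for p
      using tvec_coords[OF snd_torus3[OF that]] by (simp add: W_def)
    show "laurent (\<lambda>p. W p j)" for j
      using laurent_tvec[of j] by (simp add: W_def case_prod_unfold)
  qed
  also have "(\<lambda>p. (pt (V p), pt (W p))) ` torus3 = (\<lambda>c. (P1_affine (mon c q), pt (tvec c))) ` (snd ` torus3)"
    by (simp add: image_image V_def W_def P1_affine_def)
  also have "snd ` torus3 = torus2"
    by (force simp: torus3_def torus2_def)
  finally have "irreducible_in (zariski_prod UNIV A) (graph q)" by (simp add: graph_def)
  from irreducible_in_closure_of[OF this] show ?thesis using closure_graph[OF assms] by simp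
qed

text \<open>Pseudo-division of a form of degree \<open>d\<close> on the first factor by the equation of the graph: the
  remainder vanishes on the surface, and the quotient has degree \<open>d - 1\<close>.\<close>

lemma vanishing_on_larger_set:
  assumes Z: "irreducible_in (zariski_prod UNIV A) Z" "G q \<subset> Z" "Z \<subseteq> P1 \<times> X"
    and f: "biform d e f" "\<And>u v. (pt u, pt v) \<in> Z \<Longrightarrow> f (case_sum u v) = 0"
    and uv: "(pt u, pt v) \<in> P1 \<times> X"
  shows "f (case_sum u v) = 0"
  using f uv
proof (induction d arbitrary: e f u v)
  case (0 e f u v)
  obtain g where g': "\<forall>i. hform e (g i)"
    "\<forall>u v. f (case_sum u v) = (\<Sum>i\<le>0. u False ^ (0 - i) * u True ^ i * g i v)"
    by (rule biform_bool_expand[OF 0(1)])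
  note g = g'[rule_format]
  have "g 0 v = 0"
  proof (rule hform_vanish_X[OF g(1)])
    fix c assume c: "c \<in> torus2"
    then have "(P1_affine (mon c q), pt (tvec c)) \<in> Z" using Z(2) torus_G_iff by blast
    then have "f (case_sum (\<lambda>b. if b then mon c q else 1) (tvec c)) = 0"
      unfolding P1_affine_def by (rule 0(2))
    then show "g 0 (tvec c) = 0" by (simp add: g(2))
  qed (use 0(3) in auto)
  then show ?case by (simp add: g(2))
next
  case (Suc d e f u v)
  obtain g where g': "\<forall>i. hform e (g i)"
    "\<forall>u v. f (case_sum u v) = (\<Sum>i\<le>Suc d. u False ^ (Suc d - i) * u True ^ i * g i v)"
    by (rule biform_bool_expand[OF Suc.prems(1)])
  note g = g'[rule_format]
  obtain l l' where b: "bal q 1 l l'" by (rule bal_exists)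
  define N where "N = length l"
  have N: "length l = N" "length l' = N" using b by (auto simp: N_def bal_def)
  \<comment> \<open>The remainder: \<open>f\<close> evaluated at the base point with homogeneous
    coordinates \<open>vm v l'\<close> and \<open>vm v l\<close>, where the equation of the graph
    holds.\<close>
  define Rm where "Rm v = (\<Sum>i\<le>Suc d. g i v * vm v l ^ i * vm v l' ^ (Suc d - i))" for v
  define B where "B x = x (Inl True) * vm (\<lambda>k. x (Inr k)) l' - x (Inl False) * vm (\<lambda>k. x (Inr k)) l"
    for x :: "bool + (int \<times> int) \<Rightarrow> complex"
  \<comment> \<open>The quotient, obtained termwise from the factorization of
    \<open>x ^ i - y ^ i\<close> for \<open>x = u True * vm v l'\<close> and
    \<open>y = u False * vm v l\<close>. The inner sum is empty for \<open>i = 0\<close> and has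
    degree \<open>i - 1\<close> in the base otherwise, so the total degree there is
    \<open>d\<close>.\<close>
  define H where "H x = (\<Sum>i\<le>Suc d. x (Inl False) ^ (Suc d - i) * vm (\<lambda>k. x (Inr k)) l' ^ (Suc d - i) * g i (\<lambda>k. x (Inr k)) *
    (\<Sum>k<i. (x (Inl False) * vm (\<lambda>k. x (Inr k)) l) ^ (i - Suc k) * (x (Inl True) * vm (\<lambda>k. x (Inr k)) l') ^ k))"
    for x :: "bool + (int \<times> int) \<Rightarrow> complex"
  have Rm: "Rm v = 0" if v: "pt v \<in> X" for v
  proof (rule hform_vanish_X[OF _ _ v])
    have "hform (e + N * Suc d) (\<lambda>v. g i v * vm v l ^ i * vm v l' ^ (Suc d - i))" if "i \<le> Suc d" for i
    proof -
      have "N * i + N * (Suc d - i) = N * Suc d" using that by (simp flip: add_mult_distrib2)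
      then show ?thesis
        by (intro gform_mult[OF gform_mult[OF g(1) gform_power[OF hform_vm refl refl] refl refl]
          gform_power[OF hform_vm refl refl]]) (simp_all add: N mult.commute)
    qed
    then show "hform (e + N * Suc d) Rm" unfolding Rm_def by (intro gform_sum) auto
    fix c assume c: "c \<in> torus2"
    then have "(P1_affine (mon c q), pt (tvec c)) \<in> Z" using Z(2) torus_G_iff by blast
    then have "f (case_sum (\<lambda>b. if b then mon c q else 1) (tvec c)) = 0"
      unfolding P1_affine_def by (rule Suc.prems(2))
    then have s: "(\<Sum>i\<le>Suc d. mon c q ^ i * g i (tvec c)) = 0" by (simp only: g(2)) simp
    have "Rm (tvec c) = (\<Sum>i\<le>Suc d. vm (tvec c) l' ^ Suc d * (mon c q ^ i * g i (tvec c)))"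
      unfolding Rm_def
    proof (rule sum.cong)
      fix i assume "i \<in> {..Suc d}"
      then have "vm (tvec c) l' ^ Suc d = vm (tvec c) l' ^ i * vm (tvec c) l' ^ (Suc d - i)"
        by (simp only: power_add[symmetric]) simp
      then show "g i (tvec c) * vm (tvec c) l ^ i * vm (tvec c) l' ^ (Suc d - i) =
        vm (tvec c) l' ^ Suc d * (mon c q ^ i * g i (tvec c))"
        using bal_torus[OF b c] by (simp add: power_mult_distrib)
    qed auto
    then show "Rm (tvec c) = 0" using s by (simp only: sum_distrib_left[symmetric]) simp
  qed
  have key: "vm v l' ^ Suc d * f (case_sum u v) = B (case_sum u v) * H (case_sum u v)" if v: "pt v \<in> X" for u v
  proof -
    define x y where "x = u True * vm v l'" and "y = u False * vm v l"
    have "B (case_sum u v) * H (case_sum u v) =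
      (\<Sum>i\<le>Suc d. (u False * vm v l') ^ (Suc d - i) * g i v * ((x - y) * (\<Sum>k<i. y ^ (i - Suc k) * x ^ k)))"
      unfolding B_def H_def sum_distrib_left by (intro sum.cong) (simp_all add: x_def y_def power_mult_distrib mult_ac)
    also have "\<dots> = (\<Sum>i\<le>Suc d. (u False * vm v l') ^ (Suc d - i) * g i v * (x ^ i - y ^ i))"
      by (simp only: power_diff_sumr2)
    also have "\<dots> = (\<Sum>i\<le>Suc d. vm v l' ^ Suc d * (u False ^ (Suc d - i) * u True ^ i * g i v) -
        u False ^ Suc d * (g i v * vm v l ^ i * vm v l' ^ (Suc d - i)))"
    proof (rule sum.cong)
      fix i assume "i \<in> {..Suc d}"
      then have "vm v l' ^ Suc d = vm v l' ^ (Suc d - i) * vm v l' ^ i"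
        "u False ^ Suc d = u False ^ (Suc d - i) * u False ^ i"
        by (simp_all only: power_add[symmetric]) simp_all
      then show "(u False * vm v l') ^ (Suc d - i) * g i v * (x ^ i - y ^ i) =
        vm v l' ^ Suc d * (u False ^ (Suc d - i) * u True ^ i * g i v) -
        u False ^ Suc d * (g i v * vm v l ^ i * vm v l' ^ (Suc d - i))"
        by (simp only: x_def y_def power_mult_distrib) (simp add: algebra_simps)
    qed auto
    also have "\<dots> = vm v l' ^ Suc d * f (case_sum u v) - u False ^ Suc d * Rm v"
      by (simp only: sum_subtractf sum_distrib_left[symmetric] g(2) Rm_def)
    finally show ?thesis using Rm[OF v] by simp
  qed
  have Bf: "biform 1 N B"
    unfolding B_def
    using gform_mult[OF biform_Inl[OF refl refl] biform_of_hform[OF hform_vm[of l']], of 1 N True]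
      gform_mult[OF biform_Inl[OF refl refl] biform_of_hform[OF hform_vm[of l]], of 1 N False]
    by (intro gform_diff) (simp_all add: N)
  have Hf: "biform d (e + N * d) H"
    unfolding H_def
  proof (rule gform_sum)
    fix i assume "i \<in> {..Suc d}"
    then have i: "i \<le> Suc d" by simp
    show "biform d (e + N * d) (\<lambda>x. x (Inl False) ^ (Suc d - i) * vm (\<lambda>k. x (Inr k)) l' ^ (Suc d - i) * g i (\<lambda>k. x (Inr k)) *
      (\<Sum>k<i. (x (Inl False) * vm (\<lambda>k. x (Inr k)) l) ^ (i - Suc k) * (x (Inl True) * vm (\<lambda>k. x (Inr k)) l') ^ k))"
    proof (cases i)
      case 0
      then show ?thesis using gform_zero by simp
    next
      case (Suc j)
      have 1: "biform 1 N (\<lambda>x. x (Inl b) * vm (\<lambda>k. x (Inr k)) m)" if "length m = N" for b :: bool and m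
        using gform_mult[OF biform_Inl[OF refl refl] biform_of_hform[OF hform_vm[of m]], of 1 N b] that by simp
      have 2: "biform j (N * j) (\<lambda>x. \<Sum>k<i. (x (Inl False) * vm (\<lambda>k. x (Inr k)) l) ^ (i - Suc k) * (x (Inl True) * vm (\<lambda>k. x (Inr k)) l') ^ k)"
      proof (rule gform_sum)
        fix k assume "k \<in> {..<i}"
        then have k: "i - Suc k + k = j" using Suc by auto
        have "N * (i - Suc k) + N * k = N * j" unfolding k[symmetric] by (simp add: algebra_simps)
        then show "biform j (N * j) (\<lambda>x. (x (Inl False) * vm (\<lambda>k. x (Inr k)) l) ^ (i - Suc k) * (x (Inl True) * vm (\<lambda>k. x (Inr k)) l') ^ k)"
          by (intro gform_mult[OF gform_power[OF 1[OF N(1)] refl refl] gform_power[OF 1[OF N(2)] refl refl]])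
            (simp_all add: k mult.commute)
      qed
      have 3: "Suc d - i + j = d" using Suc i by simp
      have "N * (Suc d - i) + N * j = N * d" by (simp only: 3 flip: add_mult_distrib2)
      then show ?thesis
        by (intro gform_mult[OF gform_mult[OF gform_mult[OF gform_power[OF biform_Inl[OF refl refl] refl refl]
          gform_power[OF biform_of_hform[OF hform_vm] refl refl] refl refl] biform_of_hform[OF g(1)] refl refl] 2])
          (use 3 in \<open>simp_all add: N mult.commute\<close>)
    qed
  qed
  let ?F = "\<lambda>f. (\<lambda>(v, w). f (case_sum v w))"
  have mem: "?F k \<in> {(\<lambda>(v, w). f (case_sum v w)) | f. \<exists>d e. biform d e f}" if "biform a b k"
    for a b and k :: "(bool + (int \<times> int) \<Rightarrow> complex) \<Rightarrow> complex"
    using that by blast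
  have Zc: "u \<in> coords UNIV \<and> v \<in> coords A \<and> pt v \<in> X" if "(pt u, pt v) \<in> Z" for u v
  proof -
    have "pt u \<in> P1" "pt v \<in> X" using that Z(3) by auto
    then show ?thesis using pt_X_coords by (auto simp: P1_def pt_in_pspace_iff)
  qed
  have "(\<forall>p\<in>coords UNIV \<times> coords A. (case p of (v, w) \<Rightarrow> (pt v, pt w)) \<in> Z \<longrightarrow> ?F B p = 0) \<or>
    (\<forall>p\<in>coords UNIV \<times> coords A. (case p of (v, w) \<Rightarrow> (pt v, pt w)) \<in> Z \<longrightarrow> ?F H p = 0)"
  proof (rule zpr.irreducible_in_prod[OF Z(1) mem[OF Bf] mem[OF Hf]])
    fix p :: "(bool \<Rightarrow> complex) \<times> (int \<times> int \<Rightarrow> complex)"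
    assume p: "(case p of (v, w) \<Rightarrow> (pt v, pt w)) \<in> Z"
    obtain u v where "p = (u, v)" by (cases p)
    then show "?F B p * ?F H p = 0" using p key[of v u] Suc.prems(2)[of u v] Zc by auto
  qed
  then show ?case
  proof
    assume "\<forall>p\<in>coords UNIV \<times> coords A. (case p of (v, w) \<Rightarrow> (pt v, pt w)) \<in> Z \<longrightarrow> ?F H p = 0"
    \<comment> \<open>The induction hypothesis spreads the vanishing of \<open>H\<close> over the
      whole product. By \<open>key\<close> the left-hand side vanishes too, and on the torus the
      monomial of \<open>l'\<close> can be cancelled.\<close>
    then have HZ: "H (case_sum u v) = 0" if "(pt u, pt v) \<in> Z" for u v using that Zc by force
    have tor: "f (case_sum (\<lambda>b. if b then z else 1) (tvec c)) = 0" if c: "c \<in> torus2" for z c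
    proof -
      have x: "pt (tvec c) \<in> X" using c TT_subset_X by (auto simp: TT_eq)
      then have "H (case_sum (\<lambda>b. if b then z else 1) (tvec c)) = 0"
        by (intro Suc.IH[OF Hf HZ]) (auto simp flip: P1_affine_def)
      then have "vm (tvec c) l' ^ Suc d * f (case_sum (\<lambda>b. if b then z else 1) (tvec c)) = 0"
        using key[OF x] by simp
      then show ?thesis using vm_tvec_nonzero[of l' c] b c by (simp add: bal_def)
    qed
    have "P1 \<times> X \<subseteq> {(case p of (v, w) \<Rightarrow> (pt v, pt w)) | p. p \<in> coords UNIV \<times> coords A \<and> ?F f p = 0}"
      by (rule P1_X_minimal[OF zpr.closedin_zeros[OF mem[OF Suc.prems(1)]]])
        (use tor tvec_coords in \<open>fastforce simp: P1_affine_def\<close>)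
    then obtain u' v' where u': "pt u = pt u'" "pt v = pt v'" "f (case_sum u' v') = 0"
      using Suc.prems(3) by auto
    then obtain a b where e: "u = (\<lambda>j. a * u' j)" "v = (\<lambda>j. b * v' j)"
      by (metis pt_eq_iff)
    show ?case unfolding e biform_scale[OF Suc.prems(1)] using u'(3) by simp
  next
    assume "\<forall>p\<in>coords UNIV \<times> coords A. (case p of (v, w) \<Rightarrow> (pt v, pt w)) \<in> Z \<longrightarrow> ?F B p = 0"
    \<comment> \<open>If the equation of the graph vanishes on \<open>Z\<close>, then
      \<open>Z\<close> lies in \<open>G q\<close> together with the locus where a coordinate of a
      unimodular triangle vanishes. Irreducibility would leave that locus alone, but
      \<open>Z\<close> contains a torus point.\<close>
    then have BZ: "B (case_sum u v) = 0" if "(pt u, pt v) \<in> Z" for u v using that Zc by force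
    obtain e0 w w' where e: "e0 \<in> A" "e0 + w \<in> A" "e0 + w' \<in> A" "cross w w' = 1" by (rule unimodular_triangle)
    define k where "k x = vm (\<lambda>j. x (Inr j)) [e0, e0 + w, e0 + w']" for x :: "bool + (int \<times> int) \<Rightarrow> complex"
    have kf: "biform 0 (Suc (Suc (Suc 0))) k" unfolding k_def using biform_of_hform[OF hform_vm[of "[e0, e0 + w, e0 + w']"]] by simp
    let ?K = "{(case p of (v, w) \<Rightarrow> (pt v, pt w)) | p. p \<in> coords UNIV \<times> coords A \<and> ?F k p = 0}"
    have "Z \<subseteq> G q \<union> ?K"
    proof
      fix y assume y: "y \<in> Z"
      then obtain u v where uv: "y = (pt u, pt v)" using Z(3) X_subset by (fastforce simp: P1_def pspace_def)
      then have c: "u \<in> coords UNIV" "v \<in> coords A" "pt v \<in> X" using Zc y by auto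
      show "y \<in> G q \<union> ?K"
      proof (cases "k (case_sum u v) = 0")
        case True
        then have "y \<in> ?K" unfolding uv using c by (intro CollectI exI[of _ "(u, v)"]) auto
        then show ?thesis by blast
      next
        case False
        then have nz: "v e0 \<noteq> 0" "v (e0 + w) \<noteq> 0" "v (e0 + w') \<noteq> 0" by (auto simp: k_def)
        then obtain c' where c': "c' \<in> torus2" "pt v = pt (tvec c')"
          using toric_in_TT[OF c(3) e] by metis
        then have "B (case_sum u (tvec c')) = 0" using BZ y uv by auto
        then have "u True * vm (tvec c') l' = u False * (mon c' q * vm (tvec c') l')"
          using bal_torus[OF b c'(1)] by (simp add: B_def)
        then have ut: "u True = mon c' q * u False"
          using vm_tvec_nonzero[of l' c'] b c'(1) by (simp add: bal_def)
        moreover have "u False \<noteq> 0" using ut c(1) by (auto simp: coords_def fun_eq_iff all_bool_eq)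
        ultimately have "pt u = P1_affine (mon c' q)" by (simp add: pt_eq_P1_affine_iff)
        then show ?thesis using torus_G_iff[OF c'(1)] c'(2) uv by simp
      qed
    qed
    then have "Z \<subseteq> G q \<or> Z \<subseteq> ?K"
      using Z(1) closedin_G zpr.closedin_zeros[OF mem[OF kf], of UNIV A] unfolding irreducible_in_def by blast
    then have "Z \<subseteq> ?K" using Z(2) by blast
    moreover have "(1, 1) \<in> torus2" by (simp add: torus2_def)
    moreover from this have "(P1_affine (mon (1, 1) q), pt (tvec (1, 1))) \<in> Z" using Z(2) torus_G_iff by blast
    ultimately obtain u' v' where "pt (tvec (1, 1)) = pt v'" "k (case_sum u' v') = 0" by auto
    then have "k (case_sum u' (tvec (1, 1))) = 0" by (auto simp: pt_eq_iff k_def)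
    then show ?case using e by (simp add: k_def tvec_def mon_def)
  qed
qed

text \<open>A fibre of the primitive character \<open>q\<close> on the torus is a single orbit; the
  parameter \<open>t\<close> is read off from a character \<open>q'\<close> that completes
  \<open>q\<close> to a basis.\<close>

lemma orbit_arc:
  assumes q: "gcd (fst q) (snd q) = 1" and e: "\<forall>p\<in>A. cross q (p - e) \<ge> 0"
    and c: "c \<in> torus2" "c' \<in> torus2" "mon c' q = mon c q"
  obtains t where "t \<noteq> 0" "pt (tvec c') = pt (arc_vec q e c t)"
proof -
  obtain q' where q': "cross q q' = 1" using primitive_complement[OF q] by blast
  define t where "t = mon c' q' / mon c q'"
  have t: "t \<noteq> 0" using c by (simp add: t_def)
  obtain c'' where c'': "c'' \<in> torus2" "\<forall>d. mon c'' d = mon c d * t powi cross q d" "pt (arc_vec q e c t) = pt (tvec c'')"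
    by (rule arc_vec_torus[OF c(1) t e])
  have "c'' = c'"
    by (rule mon_unimodular_inj[OF q' c''(1) c(2)]) (use c c''(2)[rule_format, of q] c''(2)[rule_format, of q'] q' in \<open>simp_all add: t_def cross_arith\<close>)
  then show ?thesis using that[OF t] c''(3) by simp
qed

lemma arc_inj:
  assumes q: "gcd (fst q) (snd q) = 1" and c: "c \<in> torus2" and e: "\<forall>p\<in>A. cross q (p - e) \<ge> 0"
  shows "inj_on (\<lambda>t. pt (arc_vec q e c t)) (- {0})"
proof (rule inj_onI)
  fix s t assume st: "s \<in> - {0}" "t \<in> - {0}" "pt (arc_vec q e c s) = pt (arc_vec q e c t)"
  then have nz: "s \<noteq> 0" "t \<noteq> 0" by auto
  obtain q' where q': "cross q q' = 1" using primitive_complement[OF q] by blast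
  obtain c' where c': "c' \<in> torus2" "\<forall>d. mon c' d = mon c d * s powi cross q d" "pt (arc_vec q e c s) = pt (tvec c')"
    by (rule arc_vec_torus[OF c nz(1) e])
  obtain c'' where c'': "c'' \<in> torus2" "\<forall>d. mon c'' d = mon c d * t powi cross q d" "pt (arc_vec q e c t) = pt (tvec c'')"
    by (rule arc_vec_torus[OF c nz(2) e])
  have "c' = c''" by (rule tvec_inj) (use c' c'' st in auto)
  moreover have "mon c' q' = mon c q' * s" "mon c'' q' = mon c q' * t"
    using c'(2)[rule_format, of q'] c''(2)[rule_format, of q'] q' by simp_all
  ultimately show "s = t" using c by (metis mon_nonzero mult_cancel_left)
qed

lemma fibre_affine:
  assumes q: "gcd (fst q) (snd q) = 1" and c: "c \<in> torus2"
    and p: "p0 \<in> A" "p1 \<in> A" "\<forall>p\<in>A. cross q (p - p0) \<ge> 0" "\<forall>p\<in>A. cross q (p1 - p) \<ge> 0"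
  shows "fibre (G q) (P1_affine (mon c q)) =
    (\<lambda>t. pt (arc_vec q p0 c t)) ` (- {0}) \<union> {pt (face_vec q p0 c), pt (face_vec (- q) p1 c)}"
    (is "?C = ?O \<union> ?F")
proof
  show "?C \<subseteq> ?O \<union> ?F"
  proof
    fix x assume x: "x \<in> ?C"
    then have "x \<in> X" using G_subset[of q] by (auto simp: fibre_def)
    then obtain v where v: "x = pt v" using X_subset by (auto simp: pspace_def)
    have "pt v \<in> TT \<or> pt v = pt (face_vec q p0 c) \<or> pt v = pt (face_vec (- q) p1 c)"
      by (rule G_affine_fibre[OF q _ _ c refl p(1,2)]) (use x v c p in \<open>auto simp: fibre_def\<close>)
    then show "x \<in> ?O \<union> ?F"
    proof
      assume "pt v \<in> TT"
      then obtain c' where c': "c' \<in> torus2" "pt v = pt (tvec c')" by (auto simp: TT_eq)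
      then have "mon c' q = mon c q" using x v torus_G_iff[OF c'(1)] by (auto simp: fibre_def)
      then obtain t where "t \<noteq> 0" "pt (tvec c') = pt (arc_vec q p0 c t)"
        by (rule orbit_arc[OF q p(3) c c'(1)])
      then show ?thesis using c' v by auto
    qed (use v in auto)
  qed
  have cl: "closedin (zariski A) ?C"
    using closedin_G by (rule closedin_slice) (simp flip: P1_def)
  have tor: "pt (tvec c') \<in> ?C" if "c' \<in> torus2" "mon c' q = mon c q" for c'
    using that torus_G_iff by (auto simp: fibre_def)
  have "?O \<subseteq> ?C"
  proof (rule image_subsetI)
    fix t :: complex assume "t \<in> - {0}"
    then have "t \<noteq> 0" by simp
    then obtain c' where c': "c' \<in> torus2" "\<forall>d. mon c' d = mon c d * t powi cross q d" "pt (arc_vec q p0 c t) = pt (tvec c')"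
      by (rule arc_vec_torus[OF c _ p(3)])
    then show "pt (arc_vec q p0 c t) \<in> ?C" using tor[of c'] c'(2)[rule_format, of q] by (simp add: cross_arith)
  qed
  moreover have "pt (face_vec q p0 c) \<in> ?C"
    by (rule face_limit_orbit[OF p(1) _ c _ cl tor]) (use p in \<open>auto simp: cross_arith\<close>)
  moreover have "pt (face_vec (- q) p1 c) \<in> ?C"
    by (rule face_limit_orbit[OF p(2) _ c _ cl tor]) (use p in \<open>auto simp: cross_arith\<close>)
  ultimately show "?O \<union> ?F \<subseteq> ?C" by blast
qed

lemma arc_vec_coords:
  assumes "c \<in> torus2" "t \<noteq> 0"
  shows "arc_vec q e c t \<in> coords A"
proof -
  obtain p where "p \<in> A" using A_nonempty by blast
  then have "arc_vec q e c t p \<noteq> 0" using assms by (simp add: arc_vec_def)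
  then have "arc_vec q e c t \<noteq> (\<lambda>_. 0)" by (auto simp only:)
  then show ?thesis by (simp add: coords_def arc_vec_def)
qed

text \<open>The fibre is the closure of an orbit parametrized by a torus, hence irreducible. A form
  that does not vanish on all of it pulls back to a nonzero polynomial along the orbit, so proper
  closed subsets are finite and the dimension is one.\<close>

lemma fibre_irreducible_curve:
  assumes q: "gcd (fst q) (snd q) = 1" and z: "z \<noteq> 0"
  shows "irreducible_curve A (fibre (G q) (P1_affine z))"
proof -
  obtain c where c: "c \<in> torus2" "mon c q = z" by (rule torus_over[OF q z])
  obtain p0 p1 where "p0 \<in> A" "p1 \<in> A" "\<And>p. p \<in> A \<Longrightarrow> cross q (p - p0) \<ge> 0"
    "\<And>p. p \<in> A \<Longrightarrow> cross q (p1 - p) \<ge> 0" by (rule extremal_points[of q]) blast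
  then have p: "p0 \<in> A" "p1 \<in> A" "\<forall>p\<in>A. cross q (p - p0) \<ge> 0" "\<forall>p\<in>A. cross q (p1 - p) \<ge> 0" by blast+
  let ?C = "fibre (G q) (P1_affine z)"
  define arc where "arc t = pt (arc_vec q p0 c t)" for t
  have C: "?C = arc ` (- {0}) \<union> {pt (face_vec q p0 c), pt (face_vec (- q) p1 c)}"
    using fibre_affine[OF q c(1) p] unfolding c(2) arc_def .
  have cl: "closedin (zariski A) ?C"
    using closedin_G by (rule closedin_slice) (simp flip: P1_def)
  have Csub: "?C \<subseteq> pspace A" using closedin_subset[OF cl] by simp
  have "irreducible_in (zariski A) ((\<lambda>p. pt (arc_vec q p0 c (fst p))) ` torus3)"
  proof (rule irreducible_zariski_torus_image)
    show "arc_vec q p0 c (fst p) \<in> coords A" if "p \<in> torus3" for p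
      using that by (intro arc_vec_coords[OF c(1)]) (auto simp: torus3_def)
    show "laurent (\<lambda>p. arc_vec q p0 c (fst p) j)" for j
    proof (cases "j \<in> A")
      case True
      have "laurent (\<lambda>p. mon c j * fst p ^ n)" for n
        using laurent_mult[OF laurent_const laurent_monom[of "int n" 0 0], of "mon c j"]
        by (simp add: case_prod_unfold)
      then show ?thesis using True by (simp add: arc_vec_def)
    qed (use laurent_const[of 0] in \<open>simp add: arc_vec_def\<close>)
  qed
  moreover have "(\<lambda>p. pt (arc_vec q p0 c (fst p))) ` torus3 = arc ` (- {0})"
  proof -
    have "fst ` torus3 = - {0}"
    proof (intro equalityI subsetI)
      fix x :: complex assume "x \<in> - {0}"
      then have "(x, 1, 1) \<in> torus3" by (simp add: torus3_def)
      then show "x \<in> fst ` torus3" by (rule rev_image_eqI) simp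
    next
      fix x assume "x \<in> fst ` torus3"
      then obtain p where "p \<in> torus3" "x = fst p" by blast
      then show "x \<in> - {0}" by (auto simp: torus3_def)
    qed
    moreover have "(\<lambda>p. pt (arc_vec q p0 c (fst p))) ` torus3 = arc ` (fst ` torus3)"
      unfolding arc_def image_image ..
    ultimately show ?thesis by simp
  qed
  ultimately have irr: "irreducible_in (zariski A) (arc ` (- {0}))" by simp
  have dense: "?C \<subseteq> zariski A closure_of (arc ` (- {0}))"
  proof -
    let ?Z = "zariski A closure_of (arc ` (- {0}))"
    have sub: "arc ` (- {0}) \<subseteq> ?Z"
      by (rule closure_of_subset) (use C Csub in auto)
    have tor: "pt (tvec c') \<in> ?Z" if c': "c' \<in> torus2" "mon c' q = mon c q" for c'
    proof -
      obtain t where "t \<noteq> 0" "pt (tvec c') = pt (arc_vec q p0 c t)"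
        by (rule orbit_arc[OF q p(3) c(1) c'])
      then show ?thesis using sub by (auto simp: arc_def)
    qed
    have "pt (face_vec q p0 c) \<in> ?Z"
      by (rule face_limit_orbit[OF p(1) _ c(1) _ _ tor]) (use p in \<open>auto simp: cross_arith\<close>)
    moreover have "pt (face_vec (- q) p1 c) \<in> ?Z"
      by (rule face_limit_orbit[OF p(2) _ c(1) _ _ tor]) (use p in \<open>auto simp: cross_arith\<close>)
    ultimately show ?thesis using sub unfolding C by blast
  qed
  have irrC: "irreducible_in (zariski A) ?C"
    by (rule irreducible_in_between[OF irr _ dense]) (use C in blast)
  have inj: "inj_on arc (- {0})"
    using arc_inj[OF q c(1) p(3)] unfolding arc_def .
  have infC: "infinite ?C"
  proof
    assume "finite ?C"
    then have "finite (arc ` (- {0}))" unfolding C by simp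
    then have "finite (- {0 :: complex})" using inj by (rule finite_imageD)
    then show False using infinite_UNIV_char_0[where 'a = complex] by (simp add: Compl_eq_Diff_UNIV)
  qed
  have fin: "finite Y" if Y: "closedin (zariski A) Y" "Y \<subset> ?C" for Y
  proof -
    obtain x where x: "x \<in> ?C" "x \<notin> Y" using Y(2) by blast
    then obtain v where v: "v \<in> coords A" "x = pt v" using Csub by (auto simp: pspace_def)
    obtain f where f: "\<exists>d. hform d f" "f v \<noteq> 0" "\<And>u. u \<in> coords A \<Longrightarrow> pt u \<in> Y \<Longrightarrow> f u = 0"
      using zar.closedin_separate[OF Y(1) v(1)] x v by blast
    then obtain d where d: "hform d f" by blast
    define V where "V = (\<lambda>p. if p \<in> A then monom (mon c p) (nat (cross q (p - p0))) else 0)"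
    have V: "arc_vec q p0 c t = (\<lambda>p. poly (V p) t)" for t unfolding V_def arc_vec_poly ..
    obtain P where P: "\<And>t. f (\<lambda>p. poly (V p) t) = poly P t" using gform_poly_curve[OF d, of V] by blast
    have "P \<noteq> 0"
    proof
      assume "P = 0"
      then have 0: "f (arc_vec q p0 c t) = 0" for t using P unfolding V by simp
      have "f u = 0" if u: "pt u \<in> arc ` (- {0})" for u
      proof -
        obtain t where "pt (arc_vec q p0 c t) = pt u" using u by (auto simp: arc_def)
        then obtain a where "u = (\<lambda>j. a * arc_vec q p0 c t j)" by (auto simp: pt_eq_iff)
        then show ?thesis using hform_scale[OF d] 0 by simp
      qed
      then have "f v = 0" using x(1) dense d in_zariski_closure_iff[OF v(1)] unfolding v(2) by blast
      then show False using f(2) by simp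
    qed
    then have "finite (arc ` {t. poly P t = 0} \<union> {pt (face_vec q p0 c), pt (face_vec (- q) p1 c)})"
      using poly_roots_finite by blast
    moreover have "Y \<subseteq> arc ` {t. poly P t = 0} \<union> {pt (face_vec q p0 c), pt (face_vec (- q) p1 c)}"
    proof
      fix y assume y: "y \<in> Y"
      then have "y \<in> arc ` (- {0}) \<union> {pt (face_vec q p0 c), pt (face_vec (- q) p1 c)}" using Y(2) C by blast
      then show "y \<in> arc ` {t. poly P t = 0} \<union> {pt (face_vec q p0 c), pt (face_vec (- q) p1 c)}"
      proof
        assume "y \<in> arc ` (- {0})"
        then obtain t where t: "t \<noteq> 0" "y = pt (arc_vec q p0 c t)" by (auto simp: arc_def)
        then have "f (arc_vec q p0 c t) = 0" using f(3) arc_vec_coords[OF c(1)] y by blast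
        then show ?thesis using P[of t] t unfolding V arc_def by auto
      qed blast
    qed
    ultimately show ?thesis by (rule finite_subset[rotated])
  qed
  have "has_dimension (subtopology (zariski A) ?C) 1"
  proof (rule has_dimension_1I[OF cl irrC infC _ fin])
    show "closedin (zariski A) {x}" if "x \<in> ?C" for x
      using that Csub closedin_zariski_point by (auto simp: pspace_def)
  qed auto
  then show ?thesis using cl irrC by (simp add: irreducible_curve_def)
qed

section \<open>The axioms of a toric family\<close>

lemma view_is_family:
  assumes h: "h \<in> primitive_viewangles"
  shows "is_family UNIV P1 A X (view_family \<Gamma> h)"
proof -
  define q where "q = qv h"
  have q: "gcd (fst q) (snd q) = 1" unfolding q_def by (rule primitive_qv[OF h])
  let ?T = "subtopology (zariski_prod UNIV A) (P1 \<times> X)"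
  have top: "topspace ?T = P1 \<times> X" using X_subset by (auto simp: P1_def)
  have cl: "closedin ?T (G q)"
    unfolding closedin_subtopology using closedin_G[of q] G_subset[of q] by blast
  have irr: "irreducible_in ?T (G q)"
    using irreducible_in_subtopology[OF G_subset] irreducible_G[OF q] by blast
  have tor: "(1, 1) \<in> torus2" by (simp add: torus2_def)
  have cod: "has_codimension ?T (G q) 1"
  proof (rule has_codimension_1I[OF cl irr])
    show "irreducible_in ?T (topspace ?T)"
      unfolding top using irreducible_in_subtopology[of "P1 \<times> X"] irreducible_P1_X by blast
    have "pt (tvec (1, 1)) \<in> X" using tor TT_subset_X by (auto simp: TT_eq)
    then have "(P1_affine 0, pt (tvec (1, 1))) \<in> P1 \<times> X" by simp
    moreover have "(P1_affine 0, pt (tvec (1, 1))) \<notin> G q" using torus_G_iff[OF tor] tor by simp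
    ultimately show "G q \<noteq> topspace ?T" unfolding top by blast
    fix Z assume Z: "closedin ?T Z" "irreducible_in ?T Z" "G q \<subset> Z"
    then obtain Z' where Z': "closedin (zariski_prod UNIV A) Z'" "Z = Z' \<inter> (P1 \<times> X)"
      by (auto simp: closedin_subtopology)
    then have ZX: "Z \<subseteq> P1 \<times> X" by blast
    then have irrZ: "irreducible_in (zariski_prod UNIV A) Z" using irreducible_in_subtopology Z(2) by blast
    have "P1 \<times> X \<subseteq> Z"
    proof (rule ccontr)
      assume "\<not> P1 \<times> X \<subseteq> Z"
      then obtain i x where ix: "i \<in> P1" "x \<in> X" "(i, x) \<notin> Z" by blast
      then obtain u v where uv: "u \<in> coords UNIV" "v \<in> coords A" "i = pt u" "x = pt v"
        using X_subset by (auto simp: P1_def pspace_def)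
      obtain g where g: "g \<in> {(\<lambda>(v, w). f (case_sum v w)) | f. \<exists>d e. biform d e f}" "g (u, v) \<noteq> 0"
        "\<And>p. p \<in> coords UNIV \<times> coords A \<Longrightarrow> (case p of (v, w) \<Rightarrow> (pt v, pt w)) \<in> Z' \<Longrightarrow> g p = 0"
      proof -
        have "(u, v) \<in> coords UNIV \<times> coords A" "(case (u, v) of (v, w) \<Rightarrow> (pt v, pt w)) \<notin> Z'"
          using uv ix Z'(2) by auto
        then show thesis by (rule zpr.closedin_separate[OF Z'(1)]) (rule that, assumption, assumption, blast)
      qed
      then obtain f d e where f: "biform d e f" "g = (\<lambda>(v, w). f (case_sum v w))" by blast
      have "f (case_sum u v) = 0"
      proof (rule vanishing_on_larger_set[OF irrZ Z(3) ZX f(1)])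
        fix u v assume uv: "(pt u, pt v) \<in> Z"
        then have "u \<in> coords UNIV" "v \<in> coords A"
          using ZX X_subset by (auto simp: P1_def pt_in_pspace_iff)
        then show "f (case_sum u v) = 0" using g(3)[of "(u, v)"] uv f(2) Z'(2) by simp
      qed (use ix uv in auto)
      then show False using g(2) f(2) by simp
    qed
    then show "Z = topspace ?T" unfolding top using ZX by blast
  qed
  have "TT \<subseteq> snd ` G q"
  proof
    fix x assume "x \<in> TT"
    then obtain c where "c \<in> torus2" "x = pt (tvec c)" by (auto simp: TT_eq)
    then have "(P1_affine (mon c q), x) \<in> G q" using torus_G_iff by simp
    then show "x \<in> snd ` G q" by (rule rev_image_eqI) simp
  qed
  moreover have "snd ` G q \<subseteq> X" using G_subset[of q] by force
  ultimately have clos: "zariski A closure_of (snd ` G q) = X"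
    using closure_of_mono[of TT "snd ` G q" "zariski A"] closure_of_minimal[OF _ closedin_X]
    unfolding toric_surface_def by blast
  have "generically (subtopology (zariski UNIV) P1) (\<lambda>i. irreducible_curve A (fibre (G q) i))"
  proof (rule generically_P1I[of "{P1_affine 0, P1_infinity}"])
    fix i assume "i \<in> P1" "i \<notin> {P1_affine 0, P1_infinity}"
    then obtain z where "i = P1_affine z" "z \<noteq> 0" by (cases rule: P1_cases) auto
    then show "irreducible_curve A (fibre (G q) i)" using fibre_irreducible_curve[OF q] by simp
  qed simp
  then show ?thesis
    unfolding is_family_def view_family_eq_G[OF q[unfolded q_def]] q_def[symmetric]
    using nonsingular_P1 cl irr cod clos by blast
qed

lemma view_is_fibration: "is_fibration_map UNIV P1 A X (view_family \<Gamma> h) TT (view_map \<Gamma> h)"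
  unfolding is_fibration_map_def using rational_map_view by (auto simp: fibre_def view_family_def)

lemma view_toric_family:
  assumes h: "h \<in> primitive_viewangles"
  shows "toric_family \<Gamma> (view_family \<Gamma> h)"
proof -
  have "toric_rational_map \<Gamma> TT (view_map \<Gamma> h)"
    unfolding toric_rational_map_def
  proof (intro conjI exI[of _ "\<lambda>c. mon c (qv h)"] allI impI)
    fix s t assume st: "(s, t) \<in> torus2"
    show "mon (s, t) (qv h) \<noteq> 0" using st by simp
    show "view_map \<Gamma> h (torus_point \<Gamma> (s, t)) = P1_affine (mon (s, t) (qv h))"
      using view_map_torus[OF st] by (simp add: torus_point_eq)
  qed (auto simp: rational_map_view mon_mult)
  then show ?thesis
    unfolding toric_family_def fibration_family_def
    using view_is_family[OF h] view_is_fibration by blast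
qed

end

section \<open>Toric families are view families\<close>

text \<open>Composed with \<open>exp\<close>, the homomorphism solves \<open>\<rho>' = \<alpha> \<rho>\<close>, and its period \<open>2 \<pi> \<i>\<close> makes \<open>\<alpha>\<close> an
  integer.\<close>

lemma differentiable_mult_hom:
  fixes \<psi> :: "complex \<Rightarrow> complex"
  assumes nz: "\<And>s. s \<noteq> 0 \<Longrightarrow> \<psi> s \<noteq> 0"
    and hom: "\<And>s t. s \<noteq> 0 \<Longrightarrow> t \<noteq> 0 \<Longrightarrow> \<psi> (s * t) = \<psi> s * \<psi> t"
    and diff: "\<psi> field_differentiable (at 1)"
  obtains a :: int where "\<And>s. s \<noteq> 0 \<Longrightarrow> \<psi> s = s powi a"
proof -
  define \<rho> where "\<rho> w = \<psi> (exp w)" for w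
  have \<psi>1: "\<psi> 1 = 1" using hom[of 1 1] nz[of 1] by simp
  obtain \<alpha> where "(\<psi> has_field_derivative \<alpha>) (at (exp 0))"
    using diff by (auto simp: field_differentiable_def)
  then have "(\<rho> has_field_derivative \<alpha>) (at 0)"
    unfolding \<rho>_def using DERIV_chain2[OF _ DERIV_exp[of 0]] by fastforce
  then have \<rho>0: "(\<rho> has_field_derivative \<alpha>) (at 0)" .
  have add: "\<rho> (w + x) = \<rho> w * \<rho> x" for w x by (simp add: \<rho>_def exp_add hom)
  have der: "(\<rho> has_field_derivative \<alpha> * \<rho> w) (at w)" for w
  proof -
    have "((\<lambda>x. \<rho> (x - w)) has_field_derivative \<alpha>) (at w)"
      using DERIV_shift[of \<rho> \<alpha> w "- w"] \<rho>0 by simp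
    then have "((\<lambda>x. \<rho> w * \<rho> (x - w)) has_field_derivative \<rho> w * \<alpha>) (at w)" by (rule DERIV_cmult)
    moreover have "\<rho> w * \<rho> (x - w) = \<rho> x" for x using add[of w "x - w"] by simp
    ultimately show ?thesis by (simp add: mult.commute)
  qed
  have "((\<lambda>w. \<rho> w * exp (- \<alpha> * w)) has_field_derivative 0) (at w)" for w
    by (rule derivative_eq_intros der refl | simp)+
  then obtain C where C: "\<And>w. \<rho> w * exp (- \<alpha> * w) = C"
    using has_field_derivative_zero_constant[of UNIV "\<lambda>w. \<rho> w * exp (- \<alpha> * w)"] by auto
  have "C = 1" using C[of 0] \<psi>1 by (simp add: \<rho>_def)
  have \<rho>: "\<rho> w = exp (\<alpha> * w)" for w
    using C[of w] unfolding \<open>C = 1\<close> by (simp add: exp_minus field_simps)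
  have "exp (\<alpha> * (2 * of_real pi * \<i>)) = 1"
    using \<rho>[of "2 * of_real pi * \<i>"] \<psi>1 by (simp add: \<rho>_def)
  then obtain n :: int where "Re (\<alpha> * (2 * of_real pi * \<i>)) = 0" "Im (\<alpha> * (2 * of_real pi * \<i>)) = of_int (2 * n) * pi"
    unfolding exp_eq_1 by blast
  then have \<alpha>: "\<alpha> = of_int n" by (simp add: complex_eq_iff)
  have "\<psi> s = s powi n" if "s \<noteq> 0" for s
  proof -
    have "\<psi> s = exp (of_int n * Ln s)" using \<rho>[of "Ln s"] that by (simp add: \<rho>_def \<alpha>)
    also have "\<dots> = s powi n" using that by (metis exp_Ln exp_power_int)
    finally show ?thesis .
  qed
  then show ?thesis by (rule that)
qed

lemma concat_replicate_simps:
  "vm v (concat (replicate d l)) = vm v l ^ d"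
  "length (concat (replicate d l)) = d * length l"
  "lsum (concat (replicate d l)) = (int d * fst (lsum l), int d * snd (lsum l))"
  by (induction d) (auto simp: prod_eq_iff algebra_simps)

context polygon
begin

text \<open>The two-by-two minor of two local expressions is a form that vanishes on the torus
  points of a common neighbourhood, hence at the point itself. This is uniqueness of extension from
  the dense torus.\<close>

lemma rational_maps_agree:
  assumes D: "rational_map A X UNIV P1 D f" "rational_map A X UNIV P1 D' f'"
    and eq: "\<And>x. x \<in> TT \<Longrightarrow> x \<in> D \<Longrightarrow> x \<in> D' \<Longrightarrow> f x = f' x" and x: "pt v \<in> D" "pt v \<in> D'"
  shows "f (pt v) = f' (pt v)"
proof -
  obtain W d F where W: "openin (subtopology (zariski A) X) W" "pt v \<in> W" "W \<subseteq> D" "\<forall>k. hform d (F k)"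
    "\<forall>u\<in>coords A. pt u \<in> W \<longrightarrow> (\<lambda>k. F k u) \<in> coords UNIV \<and> f (pt u) = pt (\<lambda>k. F k u)"
    by (rule rational_map_local[OF D(1) x(1)])
  obtain W' d' F' where W': "openin (subtopology (zariski A) X) W'" "pt v \<in> W'" "W' \<subseteq> D'" "\<forall>k. hform d' (F' k)"
    "\<forall>u\<in>coords A. pt u \<in> W' \<longrightarrow> (\<lambda>k. F' k u) \<in> coords UNIV \<and> f' (pt u) = pt (\<lambda>k. F' k u)"
    by (rule rational_map_local[OF D(2) x(2)])
  have vA: "v \<in> coords A" using openin_subset[OF W(1)] W(2) pt_X_coords by auto
  have "F False v * F' True v - F True v * F' False v = 0"
  proof (rule hform_vanish_open[of "W \<inter> W'" "d + d'" "\<lambda>v. F False v * F' True v - F True v * F' False v"])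
    show "openin (subtopology (zariski A) X) (W \<inter> W')" using W W' by (intro openin_Int)
    show "hform (d + d') (\<lambda>v. F False v * F' True v - F True v * F' False v)"
      using W(4) W'(4) by (intro gform_diff gform_mult[where e = 0 and e' = 0]) auto
    show "pt v \<in> W \<inter> W'" using W W' by blast
    fix c assume c: "c \<in> torus2" "pt (tvec c) \<in> W \<inter> W'"
    then have "f (pt (tvec c)) = f' (pt (tvec c))" using eq W(3) W'(3) by (auto simp: TT_eq)
    then have "pt (\<lambda>k. F k (tvec c)) = pt (\<lambda>k. F' k (tvec c))"
      using W(5) W'(5) c tvec_coords[OF c(1)] by simp
    then obtain a where "(\<lambda>k. F' k (tvec c)) = (\<lambda>k. a * F k (tvec c))" by (auto simp: pt_eq_iff)
    then have "F' k (tvec c) = a * F k (tvec c)" for k by (rule fun_cong)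
    then show "F False (tvec c) * F' True (tvec c) - F True (tvec c) * F' False (tvec c) = 0" by simp
  qed
  then have cr: "F False v * F' True v = F True v * F' False v" by simp
  have nz: "F False v \<noteq> 0 \<or> F True v \<noteq> 0" "F' False v \<noteq> 0 \<or> F' True v \<noteq> 0"
  proof -
    have "(\<lambda>k. F k v) \<in> coords UNIV" "(\<lambda>k. F' k v) \<in> coords UNIV" using W(2,5) W'(2,5) vA by blast+
    then show "F False v \<noteq> 0 \<or> F True v \<noteq> 0" "F' False v \<noteq> 0 \<or> F' True v \<noteq> 0"
      by (auto simp: coords_def fun_eq_iff all_bool_eq)
  qed
  have "pt (\<lambda>k. F k v) = pt (\<lambda>k. F' k v)"
  proof (cases "F False v = 0")
    case True
    then have "F True v \<noteq> 0" "F' False v = 0" "F' True v \<noteq> 0" using cr nz by auto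
    then show ?thesis
      using True pt_eq_P1_infinity_iff[of "\<lambda>k. F k v"] pt_eq_P1_infinity_iff[of "\<lambda>k. F' k v"] by simp
  next
    case False
    then have nz': "F' False v \<noteq> 0" using cr nz by auto
    have "pt (\<lambda>k. F k v) = P1_affine (F True v / F False v)"
      using False by (simp add: pt_eq_P1_affine_iff)
    moreover have "pt (\<lambda>k. F' k v) = P1_affine (F True v / F False v)"
      using False nz' cr by (simp add: pt_eq_P1_affine_iff field_simps)
    ultimately show ?thesis by simp
  qed
  then show ?thesis using W(2,5) W'(2,5) vA by simp
qed

text \<open>On an open set around 1 the values of \<open>f\<close> along the curve
  \<open>(s ^ i, s ^ j)\<close> are quotients of forms, hence holomorphic in \<open>s\<close>. The
  exponents 1, 0 and 0, 1 give the two factors of the torus, and for a multiplicative map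
  differentiability at 1 suffices.\<close>

lemma torus_hom_differentiable:
  assumes D: "rational_map A X UNIV P1 D f" "TT \<subseteq> D"
    and f: "\<And>c. c \<in> torus2 \<Longrightarrow> f (pt (tvec c)) = P1_affine (\<phi> c)"
  shows "(\<lambda>s. \<phi> (s ^ i, s ^ j)) field_differentiable (at 1)"
proof -
  define \<gamma> where "\<gamma> s = (s ^ i, s ^ j)" for s :: complex
  have \<gamma>: "\<gamma> s \<in> torus2" if "s \<noteq> 0" for s using that by (simp add: \<gamma>_def torus2_def)
  have hol: "(\<lambda>s. k (tvec (\<gamma> s))) holomorphic_on (- {0})" if "hform d k" for d k
  proof (rule gform_closed[OF that, where Q = "\<lambda>f. f holomorphic_on (- {0})"])
    show "(\<lambda>s. tvec (\<gamma> s) p) holomorphic_on - {0}" for p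
      by (cases "p \<in> A") (auto simp: tvec_def \<gamma>_def mon_def intro!: holomorphic_intros)
  qed (auto intro: holomorphic_intros)
  have "pt (tvec (\<gamma> 1)) \<in> D" using D(2) \<gamma>[of 1] by (auto simp: TT_eq)
  then obtain W d F where W: "openin (subtopology (zariski A) X) W" "pt (tvec (\<gamma> 1)) \<in> W" "W \<subseteq> D" "\<forall>k. hform d (F k)"
    "\<forall>u\<in>coords A. pt u \<in> W \<longrightarrow> (\<lambda>k. F k u) \<in> coords UNIV \<and> f (pt u) = pt (\<lambda>k. F k u)"
    by (rule rational_map_local[OF D(1)])
  obtain Y where Y: "openin (zariski A) Y" "W = Y \<inter> X" using W(1) by (auto simp: openin_subtopology)
  obtain g d' where g: "hform d' g" "g (tvec (\<gamma> 1)) \<noteq> 0" "\<forall>u\<in>coords A. g u \<noteq> 0 \<longrightarrow> pt u \<in> Y"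
    using Y W(2) tvec_coords[OF \<gamma>[of 1]] unfolding zar.openin_iff by auto
  let ?N = "{s \<in> - {0}. g (tvec (\<gamma> s)) \<noteq> 0}"
  have "?N = {s \<in> - {0}. g (tvec (\<gamma> s)) \<in> - {0}}" by auto
  then have opN: "open ?N"
    using continuous_open_preimage[OF holomorphic_on_imp_continuous_on[OF hol[OF g(1)]], of "- {0}"]
    by (simp add: vimage_def Int_def open_Compl)
  have N: "F False (tvec (\<gamma> s)) \<noteq> 0 \<and> \<phi> (\<gamma> s) = F True (tvec (\<gamma> s)) / F False (tvec (\<gamma> s))" if s: "s \<in> ?N" for s
  proof -
    have c: "\<gamma> s \<in> torus2" using s \<gamma> by simp
    then have "pt (tvec (\<gamma> s)) \<in> W" using g(3) s tvec_coords[OF c] Y(2) TT_subset_X by (auto simp: TT_eq)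
    then have "pt (\<lambda>k. F k (tvec (\<gamma> s))) = P1_affine (\<phi> (\<gamma> s))" using W(5) f[OF c] tvec_coords[OF c] by metis
    then show ?thesis by (simp add: pt_eq_P1_affine_iff)
  qed
  have "(\<lambda>s. F True (tvec (\<gamma> s)) / F False (tvec (\<gamma> s))) holomorphic_on ?N"
    using N W(4) by (intro holomorphic_on_divide holomorphic_on_subset[OF hol]) auto
  then have "(\<lambda>s. \<phi> (\<gamma> s)) holomorphic_on ?N"
    using N by (subst holomorphic_cong[OF refl]) auto
  then show ?thesis
    using holomorphic_on_imp_differentiable_at[OF _ opN, of _ 1] g(2) by (simp add: \<gamma>_def)
qed

lemma toric_map_monomial:
  assumes f: "toric_rational_map \<Gamma> D f"
  obtains q where "\<forall>c\<in>torus2. f (pt (tvec c)) = P1_affine (mon c q)"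
proof -
  obtain \<phi> where D: "rational_map A X UNIV P1 D f" "TT \<subseteq> D" and
    \<phi>: "\<And>s t. (s, t) \<in> torus2 \<Longrightarrow> \<phi> (s, t) \<noteq> 0 \<and> f (torus_point \<Gamma> (s, t)) = P1_affine (\<phi> (s, t))"
    "\<And>s t s' t'. (s, t) \<in> torus2 \<Longrightarrow> (s', t') \<in> torus2 \<Longrightarrow> \<phi> (s * s', t * t') = \<phi> (s, t) * \<phi> (s', t')"
    using f unfolding toric_rational_map_def by blast
  have f\<phi>: "f (pt (tvec c)) = P1_affine (\<phi> c)" if "c \<in> torus2" for c
    using \<phi>(1)[of "fst c" "snd c"] that by (simp add: torus_point_eq)
  have T: "(s, t) \<in> torus2 \<longleftrightarrow> s \<noteq> 0 \<and> t \<noteq> 0" for s t by (simp add: torus2_def)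
  obtain a where a: "\<And>s. s \<noteq> 0 \<Longrightarrow> \<phi> (s, 1) = s powi a"
  proof (rule differentiable_mult_hom[of "\<lambda>s. \<phi> (s, 1)"])
    show "\<phi> (s * t, 1) = \<phi> (s, 1) * \<phi> (t, 1)" if "s \<noteq> 0" "t \<noteq> 0" for s t
      using \<phi>(2)[of s 1 t 1] that by (simp add: T)
    show "(\<lambda>s. \<phi> (s, 1)) field_differentiable at 1"
      using torus_hom_differentiable[OF D f\<phi>, of 1 0] by simp
  qed (use \<phi>(1) T in auto)
  obtain b where b: "\<And>t. t \<noteq> 0 \<Longrightarrow> \<phi> (1, t) = t powi b"
  proof (rule differentiable_mult_hom[of "\<lambda>t. \<phi> (1, t)"])
    show "\<phi> (1, s * t) = \<phi> (1, s) * \<phi> (1, t)" if "s \<noteq> 0" "t \<noteq> 0" for s t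
      using \<phi>(2)[of 1 s 1 t] that by (simp add: T)
    show "(\<lambda>t. \<phi> (1, t)) field_differentiable at 1"
      using torus_hom_differentiable[OF D f\<phi>, of 0 1] by simp
  qed (use \<phi>(1) T in auto)
  have "\<phi> c = mon c (a, b)" if c: "c \<in> torus2" for c
  proof -
    obtain s t where st: "c = (s, t)" "s \<noteq> 0" "t \<noteq> 0" using c by (cases c) (auto simp: T)
    have "\<phi> (s, t) = \<phi> (s, 1) * \<phi> (1, t)" using \<phi>(2)[of s 1 1 t] st by (simp add: T)
    then show ?thesis using a[of s] b[of t] st by (simp add: mon_def)
  qed
  then show ?thesis using that[of "(a, b)"] f\<phi> by simp
qed

text \<open>If \<open>q\<close> were \<open>n\<close> times \<open>q1\<close> with
  \<open>n \<ge> 2\<close>, the fibre would split according to the \<open>n\<close>-th roots of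
  \<open>z\<close> taken by the character \<open>q1\<close>. The case \<open>q = 0\<close> is
  excluded by \<open>z \<noteq> 1\<close>: its equations read \<open>v p = z * v p\<close>.\<close>

lemma connected_fibre_primitive:
  assumes C: "irreducible_in (zariski A) C" "C \<subseteq> fibre (G q) (P1_affine z)" and z: "z \<noteq> 0" "z \<noteq> 1"
    and tor: "\<And>c. c \<in> torus2 \<Longrightarrow> mon c q = z \<Longrightarrow> pt (tvec c) \<in> C"
  shows "gcd (fst q) (snd q) = 1"
proof -
  have CX: "C \<subseteq> X" using C(2) G_subset[of q] by (auto simp: fibre_def)
  have eq: "vm v l = z ^ k * vm v l'" if "pt v \<in> C" "bal q k l l'" for v k l l'
  proof -
    have "(pt (\<lambda>b. if b then z else 1), pt v) \<in> G q" using C(2) that(1) by (auto simp: fibre_def P1_affine_def)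
    then show ?thesis using that(2) unfolding mem_G by fastforce
  qed
  have "q \<noteq> 0"
  proof
    assume "q = 0"
    obtain x where "x \<in> C" using C(1) by (auto simp: irreducible_in_def)
    then obtain v where v: "v \<in> coords A" "pt v \<in> C" using CX X_subset by (auto simp: pspace_def)
    then obtain p where "v p \<noteq> 0" by (auto simp: coords_def fun_eq_iff)
    moreover from this have "p \<in> A" using coords_outside[OF v(1)] by blast
    then have "bal q 1 [p] [p]" using \<open>q = 0\<close> by (simp add: bal_def zero_prod_def)
    then have "v p = z * v p" using eq[OF v(2)] by fastforce
    ultimately show False using z(2) by simp
  qed
  define d where "d = gcd (fst q) (snd q)"
  define q1 where "q1 = (fst q div d, snd q div d)"
  have d: "d > 0" using \<open>q \<noteq> 0\<close> by (auto simp: d_def prod_eq_iff)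
  have q: "q = (d * fst q1, d * snd q1)" by (simp add: q1_def d_def)
  have prim: "gcd (fst q1) (snd q1) = 1"
    unfolding q1_def d_def fst_conv snd_conv using \<open>q \<noteq> 0\<close>
    by (intro div_gcd_coprime[THEN coprime_imp_gcd_eq_1]) (auto simp: prod_eq_iff)
  define n where "n = nat d"
  have n: "n > 0" "int n = d" using d by (auto simp: n_def)
  have monq: "mon c q = mon c q1 ^ n" if "c \<in> torus2" for c
  proof -
    have "mon c q = mon c (fst q1, snd q1) powi int n" unfolding n(2) by (subst q) (rule mon_scale[OF that])
    then show ?thesis by simp
  qed
  show ?thesis
  proof (rule ccontr)
    assume "gcd (fst q) (snd q) \<noteq> 1"
    then have "int n \<noteq> 1" unfolding n(2) d_def .
    then have n2: "n \<ge> 2" using n(1) by linarith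
    define z1 where "z1 = exp (Ln z / of_nat n)"
    define \<omega> where "\<omega> = exp (2 * of_real pi * \<i> / of_nat n)"
    have z1: "z1 \<noteq> 0" "z1 ^ n = z" using z(1) n by (auto simp: z1_def simp flip: exp_of_nat_mult)
    have \<omega>: "\<omega> ^ n = 1" "\<omega> \<noteq> 1" "\<omega> \<noteq> 0"
    proof -
      show "\<omega> ^ n = 1" using n by (simp add: \<omega>_def flip: exp_of_nat_mult)
      show "\<omega> \<noteq> 1"
        using complex_root_unity_eq_1[of n 1] n2 by (simp add: \<omega>_def)
    qed (simp add: \<omega>_def)
    obtain c1 where c1: "c1 \<in> torus2" "mon c1 q1 = z1" by (rule torus_over[OF prim z1(1)])
    have "z1 * \<omega> \<noteq> 0" using z1 \<omega> by simp
    then obtain c2 where c2: "c2 \<in> torus2" "mon c2 q1 = z1 * \<omega>" by (rule torus_over[OF prim])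
    have inC: "pt (tvec c1) \<in> C" "pt (tvec c2) \<in> C"
      using c1 c2 z1 \<omega> by (auto intro!: tor simp: monq power_mult_distrib)
    obtain l l' where b: "bal q1 1 l l'" by (rule bal_exists)
    have len: "length l = length l'" using b by (simp add: bal_def)
    have bq: "bal q 1 (concat (replicate n l)) (concat (replicate n l'))"
      using b q n by (auto simp: bal_def concat_replicate_simps prod_eq_iff algebra_simps)
    have bal1: "vm (tvec c) l = mon c q1 * vm (tvec c) l'" "vm (tvec c) l' \<noteq> 0" if "c \<in> torus2" for c
      using bal_torus[OF b that] vm_tvec_nonzero[of l' c] b that by (auto simp: bal_def)
    \<comment> \<open>The equation of the fibre factors into \<open>f1\<close>, for the root
      \<open>z1\<close>, and \<open>f2\<close>, for all the other roots. The point of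
      \<open>c1\<close> is not a zero of \<open>f2\<close> and that of \<open>c2\<close> not a zero
      of \<open>f1\<close>, which contradicts irreducibility.\<close>
    define f1 where "f1 v = vm v l - z1 * vm v l'" for v
    define f2 where "f2 v = (\<Sum>k<n. (z1 * vm v l') ^ (n - Suc k) * vm v l ^ k)" for v
    have h1: "hform (length l) f1"
      unfolding f1_def using hform_vm[of l] hform_vm[of l'] len by (intro gform_diff gform_cmult) auto
    have h2: "hform (length l * (n - 1)) f2"
      unfolding f2_def
    proof (rule gform_sum)
      fix k assume "k \<in> {..<n}"
      then have "n - Suc k + k = n - 1" by auto
      then have "length l * (n - Suc k) + length l * k = length l * (n - 1)" by (simp flip: add_mult_distrib2)
      then show "hform (length l * (n - 1)) (\<lambda>v. (z1 * vm v l') ^ (n - Suc k) * vm v l ^ k)"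
        by (intro gform_mult[OF gform_power[OF gform_cmult[OF hform_vm] refl refl] gform_power[OF hform_vm refl refl]])
          (simp_all add: len mult.commute)
    qed
    have prod: "f1 v * f2 v = vm v l ^ n - z1 ^ n * vm v l' ^ n" for v
      unfolding f1_def f2_def power_diff_sumr2[symmetric] by (simp add: power_mult_distrib)
    have "(\<forall>v\<in>coords A. pt v \<in> C \<longrightarrow> f1 v = 0) \<or> (\<forall>v\<in>coords A. pt v \<in> C \<longrightarrow> f2 v = 0)"
    proof (rule zar.irreducible_in_prod[OF C(1)])
      fix v assume "pt v \<in> C"
      from eq[OF this bq] show "f1 v * f2 v = 0"
        unfolding prod z1(2) by (simp add: concat_replicate_simps)
    qed (use h1 h2 in blast)+
    moreover have "f1 (tvec c2) \<noteq> 0"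
      using bal1[OF c2(1)] c2(2) z1(1) \<omega>(2) by (simp add: f1_def)
    moreover have "f2 (tvec c1) \<noteq> 0"
    proof -
      have "f2 (tvec c1) = (\<Sum>k<n. (z1 * vm (tvec c1) l') ^ (n - 1))"
        unfolding f2_def bal1(1)[OF c1(1)] c1(2) by (intro sum.cong) (auto simp flip: power_add)
      then show ?thesis using n z1(1) bal1(2)[OF c1(1)] by simp
    qed
    ultimately show False using inC tvec_coords[OF c1(1)] tvec_coords[OF c2(1)] by blast
  qed
qed

text \<open>The family is squeezed: its fibres lie in those of \<open>G q\<close>, which is the view
  family once \<open>q\<close> is primitive, and conversely they contain the rational fibres of the
  view map.\<close>

lemma toric_family_is_view_family:
  assumes U: "toric_family \<Gamma> U"
  obtains h where "h \<in> primitive_viewangles" "U = view_family \<Gamma> h"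
proof -
  obtain D f where fib: "is_fibration_map UNIV P1 A X U D f" and tor: "toric_rational_map \<Gamma> D f"
    using U by (auto simp: toric_family_def)
  have fam: "is_family UNIV P1 A X U" using U by (simp add: toric_family_def fibration_family_def)
  have D: "rational_map A X UNIV P1 D f" "TT \<subseteq> D" using tor by (auto simp: toric_rational_map_def)
  obtain q where q: "\<forall>c\<in>torus2. f (pt (tvec c)) = P1_affine (mon c q)"
    by (rule toric_map_monomial[OF tor])
  define h where "h = (snd q, - fst q)"
  have qh: "qv h = q" by (simp add: qv_def h_def)
  have fibre_U: "fibre U i = zariski A closure_of rational_fibre A X UNIV P1 D f i" if "i \<in> P1" for i
    using fib that by (simp add: is_fibration_map_def)
  have sub: "rational_fibre A X UNIV P1 D f i \<subseteq> zariski A closure_of rational_fibre A X UNIV P1 D f i" for i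
    using rational_fibre_subset_X X_subset by (intro closure_of_subset) fastforce
  have torus: "pt (tvec c) \<in> rational_fibre A X UNIV P1 D f (P1_affine (mon c q))" if c: "c \<in> torus2" for c
  proof -
    have "pt (tvec c) \<in> D" using c D(2) by (auto simp: TT_eq)
    then show ?thesis unfolding rational_fibre_def using D(1) q c by blast
  qed
  have le: "fibre U i \<subseteq> fibre (G q) i" if "i \<in> P1" for i
    using closure_fibre_subset_G[OF D(2) _ that, of f q] q fibre_U[OF that] by (auto simp: fibre_def)
  \<comment> \<open>The value 0 is avoided because the character does not take it, the value 1 in
    order to rule out the constant character.\<close>
  obtain z where z: "z \<notin> {0, 1}" "irreducible_curve A (fibre U (P1_affine z))"
    using fam generically_P1D[of "\<lambda>i. irreducible_curve A (fibre U i)" "{0, 1}"]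
    by (auto simp: is_family_def)
  have prim: "gcd (fst q) (snd q) = 1"
  proof (rule connected_fibre_primitive)
    show "irreducible_in (zariski A) (fibre U (P1_affine z))" using z(2) by (simp add: irreducible_curve_def)
    show "fibre U (P1_affine z) \<subseteq> fibre (G q) (P1_affine z)" by (rule le) simp
    show "pt (tvec c) \<in> fibre U (P1_affine z)" if "c \<in> torus2" "mon c q = z" for c
      using torus[OF that(1)] sub that(2) fibre_U by auto
  qed (use z in auto)
  have hprim: "h \<in> primitive_viewangles"
    using prim by (auto simp: primitive_viewangles_def h_def gcd.commute)
  \<comment> \<open>A representative of the rational map of \<open>h\<close> agrees with
    \<open>f\<close> wherever both are defined, by density of the torus, and is therefore also a
    representative of the rational map of \<open>f\<close>.\<close>
  have R: "R h i \<subseteq> rational_fibre A X UNIV P1 D f i" for i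
  proof
    fix x assume "x \<in> R h i"
    then obtain D' f' where D': "rational_map A X UNIV P1 D' f'" "\<forall>z\<in>TT \<inter> D'. f' z = view_map \<Gamma> h z" "x \<in> D'" "f' x = i"
      by (auto simp: rational_fibre_def)
    have eq: "f y = f' y" if y: "y \<in> D \<inter> D'" for y
    proof -
      have "y \<in> X" using y D'(1) openin_subset[of "subtopology (zariski A) X" D'] by (auto simp: rational_map_def)
      then obtain v where v: "y = pt v" using X_subset by (auto simp: pspace_def)
      show ?thesis
        unfolding v
      proof (rule rational_maps_agree[OF D(1) D'(1)])
        fix x assume x: "x \<in> TT" "x \<in> D'"
        then obtain c where c: "c \<in> torus2" "x = pt (tvec c)" by (auto simp: TT_eq)
        then show "f x = f' x" using D'(2) x q view_map_torus[OF c(1), of h] by (simp add: qh)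
      qed (use y v in auto)
    qed
    then show "x \<in> rational_fibre A X UNIV P1 D f i"
      unfolding rational_fibre_def using D' by (intro CollectI exI[of _ D'] exI[of _ f']) auto
  qed
  have "U = view_family \<Gamma> h"
  proof
    have "U \<subseteq> P1 \<times> X"
      using fam closedin_subset[of "subtopology (zariski_prod UNIV A) (P1 \<times> X)" U] by (auto simp: is_family_def)
    then show "U \<subseteq> view_family \<Gamma> h"
      using le unfolding view_family_eq_G[OF prim[folded qh]] qh by (fastforce simp: fibre_def)
    show "view_family \<Gamma> h \<subseteq> U"
    proof
      fix y assume "y \<in> view_family \<Gamma> h"
      then obtain i x where y: "y = (i, x)" "i \<in> P1" "x \<in> zariski A closure_of R h i" by (auto simp: view_family_def)
      then have "x \<in> fibre U i" using closure_of_mono[OF R] fibre_U by blast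
      then show "y \<in> U" using y by (simp add: fibre_def)
    qed
  qed
  then show ?thesis using that hprim by blast
qed

end

section \<open>Degrees\<close>

text \<open>The Sylvester matrix of a polynomial of degree at most \<open>n\<close>, given by its coefficients, and its
  derivative: its rows are the coefficients of \<open>x\<^sup>r P\<close> for \<open>r < n - 1\<close> and of \<open>x\<^sup>i P'\<close> for \<open>i < n\<close>.\<close>

definition sylvester :: "nat \<Rightarrow> (nat \<Rightarrow> complex) \<Rightarrow> complex Matrix.mat" where
  "sylvester n a = Matrix.mat (2 * n - 1) (2 * n - 1) (\<lambda>(r, k).
     if r < n - 1 then (if k < r then 0 else a (k - r))
     else (if k < r - (n - 1) then 0
       else of_nat (Suc (k - (r - (n - 1)))) * a (Suc (k - (r - (n - 1))))))"

text \<open>Each row lists the coefficients of a polynomial multiple of \<open>P\<close> or of its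
  derivative, so the vector of powers of a common root \<open>t\<close> lies in the kernel.\<close>

lemma sylvester_double_root:
  assumes n: "n > 0" and P: "degree P \<le> n" "poly P t = 0" "poly (pderiv P) t = 0"
  shows "Determinant.det (sylvester n (coeff P)) = 0"
proof -
  define N where "N = 2 * n - 1"
  define v where "v = Matrix.vec N (\<lambda>k. t ^ k)"
  have A: "sylvester n (coeff P) \<in> carrier_mat N N" by (simp add: sylvester_def N_def)
  have v: "v \<in> carrier_vec N" by (simp add: v_def)
  have "vec_index v 0 = 1" using n by (simp add: v_def N_def)
  then have "v \<noteq> 0\<^sub>v N" using n by (auto simp: N_def)
  have eval: "(\<Sum>k = 0..<N. coeff Q k * t ^ k) = poly Q t" if "degree Q < N" for Q
  proof -
    have "(\<Sum>k = 0..<N. coeff Q k * t ^ k) = (\<Sum>k\<le>degree Q. coeff Q k * t ^ k)"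
      by (rule sum.mono_neutral_right) (use that in \<open>auto intro: coeff_eq_0\<close>)
    then show ?thesis by (simp add: poly_altdef)
  qed
  have "sylvester n (coeff P) *\<^sub>v v = 0\<^sub>v N"
  proof (rule eq_vecI)
    fix r assume "r < dim_vec (0\<^sub>v N :: complex Matrix.vec)"
    then have r: "r < N" by simp
    define Q where "Q = (if r < n - 1 then monom 1 r * P else monom 1 (r - (n - 1)) * pderiv P)"
    have "degree (monom 1 i * Q') < N" if "i + degree Q' < N" for i and Q' :: "complex poly"
      using degree_mult_le[of "monom 1 i" Q'] degree_monom_le[of "1 :: complex" i] that by linarith
    then have dQ: "degree Q < N"
      using P(1) r n by (auto simp: Q_def N_def degree_pderiv)
    have entry: "sylvester n (coeff P) $$ (r, k) = coeff Q k" if "k < N" for k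
      using r that by (simp add: sylvester_def N_def Q_def coeff_monom_mult coeff_pderiv)
    have "vec_index (sylvester n (coeff P) *\<^sub>v v) r = (\<Sum>k = 0..<N. sylvester n (coeff P) $$ (r, k) * t ^ k)"
      using r A by (simp add: scalar_prod_def v_def)
    also have "\<dots> = (\<Sum>k = 0..<N. coeff Q k * t ^ k)" by (intro sum.cong) (simp_all add: entry)
    also have "\<dots> = poly Q t" by (rule eval[OF dQ])
    also have "\<dots> = 0" using P by (simp add: Q_def)
    finally show "vec_index (sylvester n (coeff P) *\<^sub>v v) r = vec_index (0\<^sub>v N) r" using r by simp
  qed (use A in auto)
  then show ?thesis
    using det_0_iff_vec_prod_zero[OF A] v \<open>v \<noteq> 0\<^sub>v N\<close> by blast
qed

text \<open>For \<open>x\<^sup>n - 1\<close> the matrix is upper triangular.\<close>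

lemma sylvester_unity:
  assumes n: "n > 0" and a: "\<And>k. a k = (if k = n then 1 else if k = 0 then -1 else 0)"
  shows "Determinant.det (sylvester n a) \<noteq> 0"
proof -
  define N where "N = 2 * n - 1"
  have A: "sylvester n a \<in> carrier_mat N N" by (simp add: sylvester_def N_def)
  have "upper_triangular (sylvester n a)"
    unfolding upper_triangular_def using n by (auto simp: sylvester_def a)
  then have "Determinant.det (sylvester n a) = prod_list (diag_mat (sylvester n a))"
    using A by (rule det_upper_triangular)
  moreover have "0 \<notin> set (diag_mat (sylvester n a))"
    using n A by (auto simp: diag_mat_def sylvester_def a)
  ultimately show ?thesis by (simp add: prod_list_zero_iff)
qed

text \<open>The entries are linear in \<open>u\<close>, so each term of the Leibniz formula is a
  product of \<open>2 * n - 1\<close> linear forms. Being a form, the determinant vanishes on a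
  closed set of hyperplanes.\<close>

lemma hform_sylvester:
  assumes "\<And>k. hform 1 (\<lambda>u. a u k)"
  shows "hform (2 * n - 1) (\<lambda>u. Determinant.det (sylvester n (a u)))"
proof -
  define N where "N = 2 * n - 1"
  have "Determinant.det (sylvester n (a u)) = (\<Sum>p\<in>{p. p permutes {0..<N}}.
      signof p * (\<Prod>i = 0..<N. sylvester n (a u) $$ (i, p i)))" for u
    by (rule det_def') (simp add: sylvester_def N_def)
  moreover have "hform N (\<lambda>u. \<Sum>p\<in>{p. p permutes {0..<N}}. signof p * (\<Prod>i = 0..<N. sylvester n (a u) $$ (i, p i)))"
  proof (rule gform_sum, rule gform_cmult, rule gform_prod)
    fix p i assume p: "p \<in> {p. p permutes {0..<N}}" and i: "i \<in> {0..<N}"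
    then have pi: "p i < N" using permutes_in_image[of p "{0..<N}" i] by auto
    have "hform 1 (\<lambda>u. if i < n - 1 then (if p i < i then 0 else a u (p i - i))
     else (if p i < i - (n - 1) then 0
       else of_nat (Suc (p i - (i - (n - 1)))) * a u (Suc (p i - (i - (n - 1))))))"
      by (intro gform_if gform_zero gform_cmult assms)
    then show "hform 1 (\<lambda>u. sylvester n (a u) $$ (i, p i))"
      using i pi by (simp add: sylvester_def N_def)
  qed auto
  ultimately show ?thesis by (simp add: N_def)
qed

lemma card_roots_squarefree:
  fixes P :: "complex poly"
  assumes "P \<noteq> 0" "\<And>t. poly P t = 0 \<Longrightarrow> poly (pderiv P) t \<noteq> 0"
  shows "card {t. poly P t = 0} = degree P"
proof -
  have "rsquarefree P" using assms(2) by (auto simp: rsquarefree_roots)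
  from complex_poly_decompose_rsquarefree[OF this]
  have "degree P = degree (\<Prod>z | poly P z = 0. [:- z, 1:])"
    using assms(1) by (metis degree_smult_eq leading_coeff_0_iff)
  also have "\<dots> = (\<Sum>z | poly P z = 0. degree [:- z, 1:])"
    by (rule degree_prod_sum_eq) auto
  finally show ?thesis by simp
qed

context polygon
begin

text \<open>The pullback of the linear form with coefficients \<open>u\<close> to the arc
  \<open>t \<mapsto> arc_vec q e c t\<close>.\<close>

definition section_poly :: "int \<times> int \<Rightarrow> int \<times> int \<Rightarrow> complex \<times> complex \<Rightarrow> (int \<times> int \<Rightarrow> complex) \<Rightarrow> complex poly" where
  "section_poly q e c u = (\<Sum>p\<in>A. monom (u p * mon c p) (nat (cross q (p - e))))"

lemma coeff_section_poly:
  "coeff (section_poly q e c u) k = (\<Sum>p\<in>A. if nat (cross q (p - e)) = k then u p * mon c p else 0)"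
  by (simp add: section_poly_def coeff_sum)

lemma in_hyperplane_iff:
  "pt v \<in> hyperplane A (pt u) \<longleftrightarrow> v \<in> coords A \<and> (\<Sum>j\<in>A. u j * v j) = 0"
proof -
  have "(\<forall>u'\<in>pt u. \<forall>v'\<in>pt v. (\<Sum>j\<in>A. u' j * v' j) = 0) \<longleftrightarrow> (\<Sum>j\<in>A. u j * v j) = 0"
  proof
    assume "(\<Sum>j\<in>A. u j * v j) = 0"
    moreover have "(\<Sum>j\<in>A. (a * u j) * (b * v j)) = (a * b) * (\<Sum>j\<in>A. u j * v j)" for a b
      by (simp add: sum_distrib_left mult_ac)
    ultimately show "\<forall>u'\<in>pt u. \<forall>v'\<in>pt v. (\<Sum>j\<in>A. u' j * v' j) = 0" by (auto simp: pt_def)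
  qed (use self_in_pt in blast)
  then show ?thesis by (simp add: hyperplane_def pt_in_pspace_iff)
qed

text \<open>The coefficients of degree 0 and \<open>n\<close> are the values of the linear form at
  the two end points of the orbit. Where they are nonzero, the hyperplane misses both end points,
  all roots are nonzero and the degree is exactly \<open>n\<close>, so that intersection points
  correspond to roots.\<close>

lemma fibre_degree:
  assumes q: "gcd (fst q) (snd q) = 1" and z: "z \<noteq> 0"
    and p: "p0 \<in> A" "p1 \<in> A" "\<forall>p\<in>A. cross q (p - p0) \<ge> 0" "\<forall>p\<in>A. cross q (p1 - p) \<ge> 0"
  shows "curve_degree A (fibre (G q) (P1_affine z)) (nat (cross q (p1 - p0)))"
proof -
  obtain c where c: "c \<in> torus2" "mon c q = z" by (rule torus_over[OF q z])
  let ?C = "fibre (G q) (P1_affine z)"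
  define n where "n = nat (cross q (p1 - p0))"
  have npos: "n > 0" using extremal_distinct[OF q, of p0 p1] p by (simp add: n_def)
  define arc where "arc t = pt (arc_vec q p0 c t)" for t
  have C: "?C = arc ` (- {0}) \<union> {pt (face_vec q p0 c), pt (face_vec (- q) p1 c)}"
    using fibre_affine[OF q c(1) p] unfolding c(2) arc_def .
  have inj: "inj_on arc (- {0})"
    using arc_inj[OF q c(1) p(3)] unfolding arc_def .
  define P where "P = section_poly q p0 c"
  have top: "cross q (p - p0) \<le> int n" if "p \<in> A" for p
    using p(3,4) that by (auto simp: n_def cross_arith)
  have deg: "degree (P u) \<le> n" for u
  proof (rule degree_le, intro allI impI)
    fix k assume "k > n"
    then have "nat (cross q (p - p0)) \<noteq> k" if "p \<in> A" for p using top[OF that] by auto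
    then show "coeff (P u) k = 0" unfolding P_def coeff_section_poly by (intro sum.neutral) auto
  qed
  have poly: "poly (P u) t = (\<Sum>j\<in>A. u j * arc_vec q p0 c t j)" for u t
    unfolding P_def section_poly_def poly_sum by (intro sum.cong) (auto simp: poly_monom arc_vec_def)
  have c0: "coeff (P u) 0 = (\<Sum>j\<in>A. u j * face_vec q p0 c j)" for u
    unfolding P_def coeff_section_poly using p(3) by (intro sum.cong) (auto simp: face_vec_def)
  have cn: "coeff (P u) n = (\<Sum>j\<in>A. u j * face_vec (- q) p1 c j)" for u
    unfolding P_def coeff_section_poly
  proof (intro sum.cong refl)
    fix j assume "j \<in> A"
    then have "nat (cross q (j - p0)) = n \<longleftrightarrow> cross (- q) (j - p1) = 0"
      using p(3,4) npos by (auto simp: n_def cross_arith)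
    then show "(if nat (cross q (j - p0)) = n then u j * mon c j else 0) = u j * face_vec (- q) p1 c j"
      using \<open>j \<in> A\<close> by (simp add: face_vec_def)
  qed
  have hc: "hform 1 (\<lambda>u. coeff (P u) k)" for k
    unfolding P_def coeff_section_poly
  proof (rule gform_sum)
    fix j
    show "hform 1 (\<lambda>u. if nat (cross q (j - p0)) = k then u j * mon c j else 0)"
      using gform_cmult[OF hform_coord[OF refl], of "mon c j" j]
      by (cases "nat (cross q (j - p0)) = k") (auto intro: gform_zero simp: mult.commute)
  qed
  define \<Phi> where "\<Phi> u = coeff (P u) 0 * (coeff (P u) n * Determinant.det (sylvester n (coeff (P u))))" for u
  have "hform (1 + (1 + (2 * n - 1))) \<Phi>"
    unfolding \<Phi>_def
    by (rule gform_mult[OF hc gform_mult[OF hc hform_sylvester[of "\<lambda>u. coeff (P u)", OF hc] refl refl]]) auto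
  then have \<Phi>: "\<Phi> \<in> {f. \<exists>d. hform d f}" by blast
  \<comment> \<open>This hyperplane pulls back to \<open>t ^ n - 1\<close>, which shows that the
    form \<open>\<Phi>\<close> is not identically zero.\<close>
  define u0 where "u0 j = (if j = p1 then 1 / mon c p1 else if j = p0 then - 1 / mon c p0 else 0)" for j
  have pne: "p1 \<noteq> p0" using npos by (auto simp: n_def cross_def)
  have "u0 p1 \<noteq> 0" using c(1) by (simp add: u0_def)
  then have "u0 \<noteq> (\<lambda>_. 0)" by (auto simp only:)
  then have u0: "u0 \<in> coords A" using p(1,2) by (simp add: coords_def u0_def)
  have cu0: "coeff (P u0) k = (if k = n then 1 else if k = 0 then -1 else 0)" for k
  proof -
    have "coeff (P u0) k = (\<Sum>j\<in>{p0, p1}. if nat (cross q (j - p0)) = k then u0 j * mon c j else 0)"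
      unfolding P_def coeff_section_poly
      by (rule sum.mono_neutral_right) (use finite_A p in \<open>auto simp: u0_def\<close>)
    also have "\<dots> = (if k = n then 1 else if k = 0 then -1 else 0)"
      using pne npos c(1) by (auto simp: u0_def n_def cross_arith)
    finally show ?thesis .
  qed
  have "\<Phi> u0 \<noteq> 0"
    using sylvester_unity[OF npos, of "coeff (P u0)"] cu0 npos by (simp add: \<Phi>_def)
  then have "zar.nz A \<Phi> \<noteq> {}" using zar.mem_nz[OF \<Phi> u0] by blast
  moreover have "finite (?C \<inter> hyperplane A \<xi>) \<and> card (?C \<inter> hyperplane A \<xi>) = n" if \<xi>: "\<xi> \<in> zar.nz A \<Phi>" for \<xi>
  proof -
    obtain u where u: "u \<in> coords A" "\<xi> = pt u" using \<xi> zar.nz_subset[of A \<Phi>] by auto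
    then have nz: "coeff (P u) 0 \<noteq> 0" "coeff (P u) n \<noteq> 0" "Determinant.det (sylvester n (coeff (P u))) \<noteq> 0"
      using \<xi> zar.mem_nz[OF \<Phi> u(1)] by (auto simp: \<Phi>_def)
    have dP: "degree (P u) = n" using deg[of u] le_degree[OF nz(2)] by simp
    have P0: "P u \<noteq> 0" using nz by auto
    have card: "card {t. poly (P u) t = 0} = n"
      using card_roots_squarefree[OF P0] sylvester_double_root[OF npos deg, of u] nz(3) dP by auto
    have r0: "t \<noteq> 0" if "poly (P u) t = 0" for t
      using that nz(1) by (auto simp: poly_0_coeff_0)
    have "?C \<inter> hyperplane A \<xi> = arc ` {t. poly (P u) t = 0}"
    proof (intro equalityI subsetI)
      fix x assume x: "x \<in> ?C \<inter> hyperplane A \<xi>"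
      then have "x \<in> arc ` (- {0}) \<union> {pt (face_vec q p0 c), pt (face_vec (- q) p1 c)}" using C by blast
      then show "x \<in> arc ` {t. poly (P u) t = 0}"
      proof (elim UnE insertE emptyE)
        assume "x \<in> arc ` (- {0})"
        then obtain t where "x = arc t" by blast
        then show ?thesis using x unfolding u(2) by (auto simp: arc_def in_hyperplane_iff poly)
      next
        assume "x = pt (face_vec q p0 c)"
        then show ?thesis using x nz(1) unfolding u(2) c0 by (simp add: in_hyperplane_iff)
      next
        assume "x = pt (face_vec (- q) p1 c)"
        then show ?thesis using x nz(2) unfolding u(2) cn by (simp add: in_hyperplane_iff)
      qed
    next
      fix x assume "x \<in> arc ` {t. poly (P u) t = 0}"
      then obtain t where t: "poly (P u) t = 0" "x = arc t" by blast
      then have "t \<noteq> 0" using r0 by blast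
      then show "x \<in> ?C \<inter> hyperplane A \<xi>"
        using C t arc_vec_coords[OF c(1)] unfolding u(2) by (auto simp: arc_def in_hyperplane_iff poly)
    qed
    moreover have "inj_on arc {t. poly (P u) t = 0}"
      by (rule inj_on_subset[OF inj]) (use r0 in auto)
    ultimately show ?thesis using card poly_roots_finite[OF P0] by (simp add: card_image)
  qed
  ultimately show ?thesis
    unfolding curve_degree_def generically_def n_def[symmetric]
    using zar.openin_nz[OF \<Phi>] by (intro exI[of _ "zar.nz A \<Phi>"]) blast
qed

text \<open>Since \<open>cross (qv h)\<close> is the negative of \<open>h\<close>, the viewangle is
  maximal at \<open>p0\<close> and minimal at \<open>p1\<close>. Linearity reduces the extrema over
  the polygon to the lattice points spanning it.\<close>

lemma width_eq:
  assumes p: "p0 \<in> A" "p1 \<in> A" "\<forall>p\<in>A. cross (qv h) (p - p0) \<ge> 0" "\<forall>p\<in>A. cross (qv h) (p1 - p) \<ge> 0"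
  shows "width \<Gamma> h = real_of_int (cross (qv h) (p1 - p0))"
proof -
  let ?r = "\<lambda>p. (real_of_int (fst p), real_of_int (snd p))"
  have v: "view h (?r p) = - real_of_int (cross (qv h) p)" for p
    by (simp add: view_def cross_def qv_def algebra_simps)
  obtain S where S: "S \<subseteq> A" "\<Gamma> = convex hull (?r ` S)" by (rule hull)
  have lin: "view h x = (real_of_int (fst h), real_of_int (snd h)) \<bullet> x" for x
    by (simp add: view_def algebra_simps split: prod.splits)
  have "\<Gamma> \<subseteq> {x. (real_of_int (fst h), real_of_int (snd h)) \<bullet> x \<le> view h (?r p0)}"
    unfolding S(2)
  proof (rule hull_minimal)
    show "?r ` S \<subseteq> {x. (real_of_int (fst h), real_of_int (snd h)) \<bullet> x \<le> view h (?r p0)}"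
    proof (intro image_subsetI CollectI)
      fix p assume "p \<in> S"
      then have "cross (qv h) (p - p0) \<ge> 0" using S(1) p(3) by blast
      then show "(real_of_int (fst h), real_of_int (snd h)) \<bullet> ?r p \<le> view h (?r p0)"
        unfolding lin[symmetric] v by (simp add: cross_arith)
    qed
  qed (rule convex_halfspace_le)
  then have up: "view h x \<le> view h (?r p0)" if "x \<in> \<Gamma>" for x using that by (auto simp: lin)
  have "\<Gamma> \<subseteq> {x. (real_of_int (fst h), real_of_int (snd h)) \<bullet> x \<ge> view h (?r p1)}"
    unfolding S(2)
  proof (rule hull_minimal)
    show "?r ` S \<subseteq> {x. (real_of_int (fst h), real_of_int (snd h)) \<bullet> x \<ge> view h (?r p1)}"
    proof (intro image_subsetI CollectI)
      fix p assume "p \<in> S"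
      then have "cross (qv h) (p1 - p) \<ge> 0" using S(1) p(4) by blast
      then show "view h (?r p1) \<le> (real_of_int (fst h), real_of_int (snd h)) \<bullet> ?r p"
        unfolding lin[symmetric] v by (simp add: cross_arith)
    qed
  qed (rule convex_halfspace_ge)
  then have low: "view h (?r p1) \<le> view h x" if "x \<in> \<Gamma>" for x using that by (auto simp: lin)
  have in\<Gamma>: "?r p0 \<in> \<Gamma>" "?r p1 \<in> \<Gamma>" using p(1,2) by (auto simp: lattice_points_def)
  have "(SUP x\<in>\<Gamma>. view h x) = view h (?r p0)"
    by (rule cSup_eq_maximum) (use in\<Gamma> up in auto)
  moreover have "(INF x\<in>\<Gamma>. view h x) = view h (?r p1)"
    by (rule cInf_eq_minimum) (use in\<Gamma> low in auto)
  ultimately show ?thesis by (simp add: width_def v cross_arith)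
qed

lemma reparametrize_degree:
  assumes h: "h \<in> primitive_viewangles" and w: "width \<Gamma> h = real n"
    and g: "curve_isomorphism UNIV P1 UNIV P1 g"
  shows "family_degree UNIV P1 A (reparametrize g (view_family \<Gamma> h)) n"
proof -
  define q where "q = qv h"
  have q: "gcd (fst q) (snd q) = 1" unfolding q_def by (rule primitive_qv[OF h])
  obtain p0 p1 where "p0 \<in> A" "p1 \<in> A" "\<And>p. p \<in> A \<Longrightarrow> cross q (p - p0) \<ge> 0"
    "\<And>p. p \<in> A \<Longrightarrow> cross q (p1 - p) \<ge> 0" by (rule extremal_points[of q]) blast
  then have p: "p0 \<in> A" "p1 \<in> A" "\<forall>p\<in>A. cross q (p - p0) \<ge> 0" "\<forall>p\<in>A. cross q (p1 - p) \<ge> 0" by blast+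
  have "real_of_int (cross q (p1 - p0)) = real n"
    using width_eq[of p0 p1 h] p w unfolding q_def by simp
  then have n: "nat (cross q (p1 - p0)) = n" by linarith
  have U: "view_family \<Gamma> h = G q" using view_family_eq_G[OF q[unfolded q_def]] by (simp add: q_def)
  have bij: "bij_betw g P1 P1" using g by (simp add: curve_isomorphism_def)
  show ?thesis
    unfolding family_degree_def U
  proof (rule generically_P1I[of "{g (P1_affine 0), g P1_infinity}"])
    fix i assume i: "i \<in> P1" "i \<notin> {g (P1_affine 0), g P1_infinity}"
    have "i \<in> g ` P1" using bij i(1) by (simp add: bij_betw_def)
    then obtain j where j: "j \<in> P1" "g j = i" by blast
    then obtain z where z: "j = P1_affine z" "z \<noteq> 0" using i(2) by (cases rule: P1_cases) auto
    have "fibre (reparametrize g (G q)) i = fibre (G q) j"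
    proof (intro equalityI subsetI)
      fix x assume "x \<in> fibre (reparametrize g (G q)) i"
      then obtain k where k: "(k, x) \<in> G q" "g k = i" by (auto simp: fibre_def reparametrize_def)
      then have "k \<in> P1" using G_subset by blast
      then have "k = j" using bij j k(2) by (auto simp: bij_betw_def inj_on_def)
      then show "x \<in> fibre (G q) j" using k by (simp add: fibre_def)
    next
      fix x assume "x \<in> fibre (G q) j"
      then show "x \<in> fibre (reparametrize g (G q)) i"
        using j by (force simp: fibre_def reparametrize_def)
    qed
    then show "curve_degree A (fibre (reparametrize g (G q)) i) n"
      using fibre_degree[OF q z(2) p] n z(1) by simp
  qed simp
qed

section \<open>The correspondence\<close>

text \<open>Changing the sign of \<open>q\<close> exchanges the two lists in each equation, and so
  does exchanging the two coordinates of the base.\<close>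

lemma G_uminus: "G (- q) = reparametrize P1_swap (G q)"
proof -
  have *: "(pt u, pt v) \<in> G (- q) \<longleftrightarrow> (pt (\<lambda>b. u (\<not> b)), pt v) \<in> G q" for u v q
    unfolding mem_G bal_uminus coords_swap by (auto simp: eq_commute)
  have sub: "y \<in> G (- q) \<Longrightarrow> y \<in> reparametrize P1_swap (G q)" for y
  proof -
    assume y: "y \<in> G (- q)"
    then obtain u v where uv: "y = (pt u, pt v)" by (auto simp: G_def)
    then have "(pt (\<lambda>b. u (\<not> b)), pt v) \<in> G q" using y * by blast
    moreover have "y = (P1_swap (pt (\<lambda>b. u (\<not> b))), pt v)" by (simp add: uv P1_swap_pt)
    ultimately show ?thesis unfolding reparametrize_def by force
  qed
  have "y \<in> reparametrize P1_swap (G q) \<Longrightarrow> y \<in> G (- q)" for y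
  proof -
    assume "y \<in> reparametrize P1_swap (G q)"
    then obtain u v where uv: "(pt u, pt v) \<in> G q" "y = (P1_swap (pt u), pt v)"
      by (auto simp: reparametrize_def G_def)
    then show ?thesis using *[of "\<lambda>b. u (\<not> b)" v q] by (simp add: P1_swap_pt)
  qed
  then show ?thesis using sub by blast
qed

lemma qv_uminus: "qv (- fst h, - snd h) = - qv h"
  by (simp add: qv_def prod_eq_iff)

lemma uminus_primitive: "h \<in> primitive_viewangles \<Longrightarrow> (- fst h, - snd h) \<in> primitive_viewangles"
  by (auto simp: primitive_viewangles_def)

lemma view_family_uminus:
  assumes "h \<in> primitive_viewangles"
  shows "view_family \<Gamma> h = reparametrize P1_swap (view_family \<Gamma> (- fst h, - snd h))"
  using view_family_eq_G[OF primitive_qv[OF assms]] view_family_eq_G[OF primitive_qv[OF uminus_primitive[OF assms]]]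
    G_uminus[of "- qv h"]
  by (simp add: qv_uminus)

lemma G_reparametrize_imp:
  assumes q: "gcd (fst q) (snd q) = 1" "gcd (fst q') (snd q') = 1" and g: "G q' = reparametrize g (G q)"
  shows "q' = q \<or> q' = - q"
proof -
  have T1: "(1, 1) \<in> torus2" by (simp add: torus2_def)
  have tr: "(g (P1_affine (mon c q)), pt (tvec c)) \<in> G q'" if "c \<in> torus2" for c
    using torus_G_iff[OF that, of _ q] unfolding g reparametrize_def by force
  \<comment> \<open>All characters are 1 at the unit of the torus, so the reparametrization fixes 1
    and the two fibres over 1 have the same torus points.\<close>
  have "g (P1_affine 1) = P1_affine 1"
    using tr[OF T1] torus_G_iff[OF T1] by (simp add: mon_def)
  then have key: "mon c q' = 1" if "c \<in> torus2" "mon c q = 1" for c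
    using tr[OF that(1)] torus_G_iff[OF that(1), of _ q'] that(2) by simp
  have "(2 :: complex) \<noteq> 0" by simp
  \<comment> \<open>A point of the one-parameter subgroup on which the character \<open>q\<close> is
    1. Its parameter 2 is not a root of unity, so the value 1 of the character \<open>q'\<close>
    there forces \<open>cross q q' = 0\<close>.\<close>
  then obtain c where c: "c \<in> torus2" "\<And>p. mon c p = mon (1, 1) p * 2 powi cross q p"
    using torus_arc[OF T1, of 2] by blast
  have "mon c q = 1" using c(2)[of q] by (simp add: mon_def cross_arith)
  then have "(2 :: complex) powi cross q q' = 1" using key[OF c(1)] c(2)[of q'] by (simp add: mon_def)
  then have "norm ((2 :: complex) powi cross q q') = 1" by simp
  then have "(2 :: real) powi cross q q' = 2 powi 0" by (simp add: norm_power_int)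
  then have "cross q q' = 0"
    using power_int_strict_increasing[of "cross q q'" 0 "2 :: real"]
      power_int_strict_increasing[of 0 "cross q q'" "2 :: real"] by fastforce
  then obtain k where k: "q' = (k * fst q, k * snd q)" using cross_eq_0_multiple[OF q(1)] by blast
  then have "\<bar>k\<bar> = 1" using q by (simp add: gcd_mult_left)
  then have "k = 1 \<or> k = -1" by linarith
  then show ?thesis using k by (auto simp: prod_eq_iff)
qed

lemma view_class_subset:
  assumes h: "h \<in> primitive_viewangles"
  shows "toric_families_rel \<Gamma> `` {view_family \<Gamma> h} \<subseteq> toric_families_rel \<Gamma> `` {view_family \<Gamma> (- fst h, - snd h)}"
proof
  fix U assume "U \<in> toric_families_rel \<Gamma> `` {view_family \<Gamma> h}"
  then obtain g where U: "toric_family \<Gamma> U" "curve_isomorphism UNIV P1 UNIV P1 g"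
    "U = reparametrize g (view_family \<Gamma> h)"
    by (auto simp: toric_families_rel_def)
  have "U = reparametrize (\<lambda>x. g (P1_swap x)) (view_family \<Gamma> (- fst h, - snd h))"
    unfolding U(3) view_family_uminus[OF h] by (auto simp: reparametrize_def image_image case_prod_unfold)
  then show "U \<in> toric_families_rel \<Gamma> `` {view_family \<Gamma> (- fst h, - snd h)}"
    using U(1) curve_isomorphism_swap_right[OF U(2)] view_toric_family[OF uminus_primitive[OF h]]
    unfolding toric_families_rel_def by blast
qed

lemma view_class_uminus:
  assumes h: "h \<in> primitive_viewangles"
  shows "toric_families_rel \<Gamma> `` {view_family \<Gamma> (- fst h, - snd h)} = toric_families_rel \<Gamma> `` {view_family \<Gamma> h}"
  using view_class_subset[OF h] view_class_subset[OF uminus_primitive[OF h]] by auto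

lemma view_class_respects: "(\<lambda>h. toric_families_rel \<Gamma> `` {view_family \<Gamma> h}) respects sign_rel"
proof (rule congruentI)
  fix h h' assume "(h, h') \<in> sign_rel"
  then have "h \<in> primitive_viewangles" "h' = h \<or> h' = (- fst h, - snd h)" by (auto simp: sign_rel_def)
  then show "toric_families_rel \<Gamma> `` {view_family \<Gamma> h} = toric_families_rel \<Gamma> `` {view_family \<Gamma> h'}"
    using view_class_uminus[of h] by auto
qed

text \<open>The union that defines \<open>theta\<close> runs over \<open>h\<close> and its negative,
  which give the same class by \<open>view_class_uminus\<close>; so any representative computes
  it.\<close>

lemma theta_eq:
  assumes "c \<in> viewangles" "h \<in> c"
  shows "h \<in> primitive_viewangles" "c = sign_rel `` {h}" "theta \<Gamma> c = toric_families_rel \<Gamma> `` {view_family \<Gamma> h}"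
proof -
  obtain h0 where h0: "h0 \<in> primitive_viewangles" "c = sign_rel `` {h0}"
    using assms(1) by (auto simp: viewangles_def quotient_def)
  have c0: "c = {h0, (- fst h0, - snd h0)}"
    using h0 uminus_primitive[OF h0(1)] by (auto simp: sign_rel_def)
  show h: "h \<in> primitive_viewangles" using assms(2) c0 h0 uminus_primitive by blast
  have c: "c = {h, (- fst h, - snd h)}" using assms(2) c0 by auto
  show "c = sign_rel `` {h}" using c h uminus_primitive[OF h] by (auto simp: sign_rel_def)
  show "theta \<Gamma> c = toric_families_rel \<Gamma> `` {view_family \<Gamma> h}"
    using view_class_uminus[OF h] by (simp add: theta_def c)
qed

lemma view_family_in_class:
  assumes "h \<in> primitive_viewangles"
  shows "view_family \<Gamma> h \<in> toric_families_rel \<Gamma> `` {view_family \<Gamma> h}"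
proof -
  have "view_family \<Gamma> h = reparametrize (\<lambda>x. x) (view_family \<Gamma> h)" by (auto simp: reparametrize_def)
  then show ?thesis
    using view_toric_family[OF assms] curve_isomorphism_id unfolding toric_families_rel_def by blast
qed

lemma viewangles_nonempty: "c \<in> viewangles \<Longrightarrow> \<exists>h. h \<in> c"
  by (auto simp: viewangles_def quotient_def sign_rel_def)

lemma theta_bij: "bij_betw (theta \<Gamma>) viewangles (toric_families \<Gamma>)"
proof (rule bij_betw_imageI)
  show "inj_on (theta \<Gamma>) viewangles"
  proof (rule inj_onI)
    fix c c' assume c: "c \<in> viewangles" "c' \<in> viewangles" "theta \<Gamma> c = theta \<Gamma> c'"
    obtain h h' where h: "h \<in> c" "h' \<in> c'" using c viewangles_nonempty by meson
    note t = theta_eq[OF c(1) h(1)] and t' = theta_eq[OF c(2) h(2)]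
    have "view_family \<Gamma> h' \<in> toric_families_rel \<Gamma> `` {view_family \<Gamma> h}"
      using view_family_in_class[OF t'(1)] c(3) t(3) t'(3) by simp
    then obtain g where "view_family \<Gamma> h' = reparametrize g (view_family \<Gamma> h)"
      by (auto simp: toric_families_rel_def)
    then have "qv h' = qv h \<or> qv h' = - qv h"
      using G_reparametrize_imp[OF primitive_qv[OF t(1)] primitive_qv[OF t'(1)]]
        view_family_eq_G[OF primitive_qv[OF t(1)]] view_family_eq_G[OF primitive_qv[OF t'(1)]] by simp
    then have "h' = h \<or> h' = (- fst h, - snd h)" by (auto simp: qv_def prod_eq_iff)
    then have "h' \<in> c" using t(1,2) t'(1) by (auto simp: sign_rel_def)
    then show "c = c'" using theta_eq(2)[OF c(1)] t'(2) by blast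
  qed
  show "theta \<Gamma> ` viewangles = toric_families \<Gamma>"
  proof (intro equalityI subsetI)
    fix T assume "T \<in> theta \<Gamma> ` viewangles"
    then obtain c where c: "c \<in> viewangles" "T = theta \<Gamma> c" by blast
    obtain h where h: "h \<in> c" using viewangles_nonempty[OF c(1)] by blast
    note t = theta_eq[OF c(1) h]
    show "T \<in> toric_families \<Gamma>"
      unfolding c(2) t(3) toric_families_def using view_toric_family[OF t(1)] by (intro quotientI) simp
  next
    fix T assume "T \<in> toric_families \<Gamma>"
    then obtain U where U: "toric_family \<Gamma> U" "T = toric_families_rel \<Gamma> `` {U}"
      by (auto simp: toric_families_def quotient_def)
    obtain h where h: "h \<in> primitive_viewangles" "U = view_family \<Gamma> h"
      by (rule toric_family_is_view_family[OF U(1)])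
    have c: "sign_rel `` {h} \<in> viewangles" unfolding viewangles_def by (rule quotientI[OF h(1)])
    have hc: "h \<in> sign_rel `` {h}" using h(1) by (simp add: sign_rel_def)
    show "T \<in> theta \<Gamma> ` viewangles"
      using theta_eq(3)[OF c hc] U(2) h(2) c by blast
  qed
qed

lemma theta_degree:
  assumes c: "c \<in> viewangles" "h \<in> c" and w: "width \<Gamma> h = real n" and U: "U \<in> theta \<Gamma> c"
  shows "family_degree UNIV P1 A U n"
proof -
  note t = theta_eq[OF c]
  obtain g where "curve_isomorphism UNIV P1 UNIV P1 g" "U = reparametrize g (view_family \<Gamma> h)"
    using U unfolding t(3) by (auto simp: toric_families_rel_def)
  then show ?thesis using reparametrize_degree[OF t(1) w] by simp
qed

end

theorem proposition31:
  fixes \<Gamma> :: "(real \<times> real) set"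
  assumes "lattice_polygon \<Gamma>"
  shows "(\<lambda>h. toric_families_rel \<Gamma> `` {view_family \<Gamma> h}) respects sign_rel \<and>
         bij_betw (theta \<Gamma>) viewangles (toric_families \<Gamma>) \<and>
         (\<forall>c\<in>viewangles. \<forall>h\<in>c. \<forall>n::nat. width \<Gamma> h = real n \<longrightarrow>
            (\<forall>U\<in>theta \<Gamma> c. family_degree UNIV P1 (lattice_points \<Gamma>) U n))"
proof -
  interpret polygon \<Gamma> by unfold_locales (rule assms)
  show ?thesis using view_class_respects theta_bij theta_degree by blast
qed

end
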